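(* (1) Let $\Delta^h$ be a linear connection on a vector bundle $(E,\pi,M)$, $E$ and $M$ being $C^1$ manifolds. Let $\{u^I\}=\{x^\mu\circ\pi,u^a\}$, with $\{x^\mu\}$ a coordinate system on $M$, be vector bundle coordinates on $E$ generated by a frame $\{e_a\}$ in $E$, let $\{X_I\}$ be the frame adapted to $\{u^I\}$ and let $\Gamma^a_{b\mu}$ be the 3-index coefficients of $\Delta^h$ in $\{X_I\}$. If $P$ is the parallel transport along paths assigned to $\Delta^h$, then the coefficients of $P$ in $\{e_a\}$ along a $C^1$ path $\gamma\colon J\to M$ are $$\Gamma^a_b(s;\gamma)=\Gamma^a_{b\mu}(\gamma(s))\,\dot\gamma^\mu(s),\qquad s\in J\qquad( * )$$ (summation over $\mu$). (2) Conversely, if $I$ is a $C^1$ linear transport along paths in $(E,\pi,M)$ and in $\{e_a\}$ its coefficients have a representation $( * )$ along every $C^1$ path $\gamma$ for some functions $\Gamma^a_{b\mu}$ on $M$, then there exists a unique linear connection $\Delta^h$ on $(E,\pi,M)$ such that the parallel transport $P$ along paths generated by $\Delta^h$ coincides with $I$, $P=I$; besides, $\Gamma^a_{b\mu}$ are exactly the 3-index coefficients of $\Delta^h$.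
   Context: $\mathbb K=\mathbb R$ or $\mathbb C$. $(E,\pi,M)$ is a $\mathbb K$-vector bundle; $M$ and $E$ are $C^1$ manifolds over $\mathbb K$ of finite dimensions $n\ge1$ and $n+r$, $r\ge1$. Indices $\mu$ run over $1,\dots,n$, indices $a,b$ over the $r$ fibre values, $I$ over all; repeated indices are summed. $J$ denotes a real interval; paths are $C^1$ maps from real intervals (one-sided derivatives at closed endpoints). Coordinates and frames are treated as defined on their common domain in $M$; if this is not all of $M$, coordinate identities are understood for paths (or pieces of paths) in the domain, and in the converse part the representation $( * )$ is required in frames/coordinates whose domains cover $M$. Transport along paths: a map $I$ assigning to every path $\gamma\colon J\to M$ maps $I^\gamma_{s\to t}\colon\pi^{-1}(\gamma(s))\to\pi^{-1}(\gamma(t))$, $s,t\in J$, with $I^\gamma_{s\to t}\circ I^\gamma_{r\to s}=I^\gamma_{r\to t}$ and $I^\gamma_{s\to s}=\mathrm{id}$; it is linear if every $I^\gamma_{s\to t}$ is $\mathbb K$-linear. A frame $\{e_a\}$ in $E$ gives a basis $\{e_a(x)\}$ of $\pi^{-1}(x)$ for each $x$. The matrix $[L^a_b(t,s;\gamma)]$ of a linear transport $L$ is defined by $L^\gamma_{s\to t}(e_a(\gamma(s)))=L^b_a(t,s;\gamma)\,e_b(\gamma(t))$; for $L$ of class $C^1$ (its matrix is $C^1$ in the parameters) its coefficients are $\Gamma^a_b(s;\gamma):=\frac{\partial L^a_b(s,t;\gamma)}{\partial t}\big|_{t=s}$. $\dot\gamma^\mu$ are the components of $\dot\gamma$ in $\{\partial/\partial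 x^\mu\}$. Connection: an $n$-dimensional distribution $\Delta^h$ on $E$ with $\Delta^v_p\oplus\Delta^h_p=T_p(E)$ for all $p\in E$, where $\Delta^v_p=T_p(\pi^{-1}(\pi(p)))$. A horizontal lift of a $C^1$ path $\gamma\colon J\to M$ is a $C^1$ path $\bar\gamma\colon J\to E$ with $\pi\circ\bar\gamma=\gamma$ and $\dot{\bar\gamma}(s)\in\Delta^h_{\bar\gamma(s)}$ for all $s$; connections are such that for each $\gamma$, $s_0\in J$, $p\in\pi^{-1}(\gamma(s_0))$ there is a unique horizontal lift with value $p$ at $s_0$. The parallel transport $\mathsf P$ assigned to $\Delta^h$ is $\mathsf P^\gamma(p)=\bar\gamma_p(\tau)$ for $\gamma\colon[\sigma,\tau]\to M$, $p\in\pi^{-1}(\gamma(\sigma))$, $\bar\gamma_p$ the horizontal lift with $\bar\gamma_p(\sigma)=p$. The parallel transport $P$ along paths assigned to (generated by) $\Delta^h$ is $P^\gamma_{s\to t}=\mathsf P^{\gamma|[s,t]}$ for $s\le t$ and $P^\gamma_{s\to t}=(\mathsf P^{\gamma|[t,s]})^{-1}$ for $s\ge t$. The connection is linear if every $\mathsf P^\gamma$ is $\mathbb K$-linear. The vector bundle coordinates generated by $\{e_a\}$ and $\{x^\mu\}$ are $u^\mu=x^\mu\circ\pi$ and $u^a$ with $p=u^a(p)\,e_a(\pi(p))$. The frame $\{X_I\}$ in $T(E)$ adapted to $\{u^I\}$ for $\Delta^h$ is $X_\mu=\frac{\partial}{\partial u^\mu}+\Gamma^b_\mu\frac{\partial}{\partial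 u^b}$, $X_a=\frac{\partial}{\partial u^a}$, where the functions $\Gamma^b_\mu$ on $E$ (the 2-index coefficients of $\Delta^h$) are determined by $X_\mu\in\Delta^h$. The connection is linear iff $\Gamma^a_\mu=-(\Gamma^a_{b\mu}\circ\pi)\,u^b$ for some functions $\Gamma^a_{b\mu}$ on $M$; these are the 3-index coefficients of $\Delta^h$. *)

theory Defs
  imports "HOL-Analysis.Analysis" "HOL-Library.Function_Algebras"
begin

text \<open>
  The scalar field is a type of class \<open>{real_normed_field, euclidean_space}\<close>: a commutative,
  finite-dimensional, normed division algebra over the reals. Up to isometric isomorphism the
  only such fields are the real and the complex numbers, and both are instances. The dimensions
  of the base and of the fibre are \<open>CARD('n)\<close> and \<open>CARD('r)\<close>, so that the coordinates on the total
  space are indexed by the disjoint sum \<open>'n + 'r\<close>.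
\<close>


subsection \<open>Manifolds of class C1 over the scalar field\<close>

text \<open>Representing the derivative by a matrix over \<open>'k\<close> makes it \<open>'k\<close>-linear, and not only
  linear over the reals; the definition is meant for open \<open>S\<close>.\<close>

definition C1_on ::
  "('k::{real_normed_field,euclidean_space} ^ 'd) set \<Rightarrow> ('k ^ 'd \<Rightarrow> 'k ^ 'f) \<Rightarrow> bool" where
  "C1_on S f \<longleftrightarrow>
     (\<exists>A :: 'k ^ 'd \<Rightarrow> 'k ^ 'd ^ 'f.
        continuous_on S A \<and> (\<forall>x\<in>S. (f has_derivative (\<lambda>h. A x *v h)) (at x)))"

type_synonym ('a, 'k, 'd) chart = "'a set \<times> ('a \<Rightarrow> 'k ^ 'd)"

abbreviation chart_inv ::
  "('a, 'k, 'd::finite) chart \<Rightarrow> 'k ^ 'd \<Rightarrow> 'a" where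
  "chart_inv c \<equiv> inv_into (fst c) (snd c)"

definition is_chart ::
  "'a::t2_space set \<Rightarrow> ('a, 'k::{real_normed_field,euclidean_space}, 'd::finite) chart \<Rightarrow> bool" where
  "is_chart X c \<longleftrightarrow>
     openin (top_of_set X) (fst c) \<and> open (snd c ` fst c) \<and>
     homeomorphism (fst c) (snd c ` fst c) (snd c) (chart_inv c)"

definition C1_compatible ::
  "('a::t2_space, 'k::{real_normed_field,euclidean_space}, 'd::finite) chart
    \<Rightarrow> ('a, 'k, 'd) chart \<Rightarrow> bool" where
  "C1_compatible c d \<longleftrightarrow>
     C1_on (snd c ` (fst c \<inter> fst d)) (snd d \<circ> chart_inv c) \<and>
     C1_on (snd d ` (fst c \<inter> fst d)) (snd c \<circ> chart_inv d)"

text \<open>The atlas is the maximal one, so its members are all the admissible coordinate systems.\<close>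

definition C1_manifold ::
  "'a::t2_space set \<Rightarrow> ('a, 'k::{real_normed_field,euclidean_space}, 'd::finite) chart set
    \<Rightarrow> bool" where
  "C1_manifold X \<A> \<longleftrightarrow>
     (\<forall>c\<in>\<A>. is_chart X c) \<and>
     (\<Union>c\<in>\<A>. fst c) = X \<and>
     (\<forall>c\<in>\<A>. \<forall>d\<in>\<A>. C1_compatible c d) \<and>
     (\<forall>c. is_chart X c \<and> (\<forall>d\<in>\<A>. C1_compatible c d) \<longrightarrow> c \<in> \<A>)"

definition C1_map ::
  "('a::t2_space, 'k::{real_normed_field,euclidean_space}, 'd::finite) chart set \<Rightarrow> 'a set
    \<Rightarrow> 'b::t2_space set \<Rightarrow> ('b, 'k, 'f::finite) chart set \<Rightarrow> ('a \<Rightarrow> 'b) \<Rightarrow> bool" where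
  "C1_map \<A> U Y \<B> f \<longleftrightarrow>
     f ` U \<subseteq> Y \<and> continuous_on U f \<and>
     (\<forall>c\<in>\<A>. \<forall>d\<in>\<B>.
        C1_on (snd c ` (U \<inter> fst c \<inter> f -` fst d)) (snd d \<circ> f \<circ> chart_inv c))"

text \<open>A path is a map on a real interval \<open>J\<close> of any kind; it is represented by a total function
  of which only the values on \<open>J\<close> count. At endpoints belonging to \<open>J\<close> derivatives are one-sided.\<close>

definition C1_path ::
  "'a::t2_space set \<Rightarrow> ('a, 'k::{real_normed_field,euclidean_space}, 'd::finite) chart set
    \<Rightarrow> real set \<Rightarrow> (real \<Rightarrow> 'a) \<Rightarrow> bool" where
  "C1_path X \<A> J \<gamma> \<longleftrightarrow>
     is_interval J \<and> \<gamma> ` J \<subseteq> X \<and> continuous_on J \<gamma> \<and>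
     (\<forall>c\<in>\<A>. \<exists>g. continuous_on (J \<inter> \<gamma> -` fst c) g \<and>
        (\<forall>s \<in> J \<inter> \<gamma> -` fst c. ((snd c \<circ> \<gamma>) has_vector_derivative g s) (at s within J)))"


subsection \<open>Tangent vectors\<close>

text \<open>A tangent vector at \<open>p\<close> is the family of its component vectors in all charts around \<open>p\<close>,
  related by the derivatives of the transition maps (and 0, by convention, at other arguments).
  The linear operations are pointwise.\<close>

type_synonym ('a, 'k, 'd) tvec = "('a, 'k, 'd) chart \<Rightarrow> 'k ^ 'd"

definition tscale ::
  "'k::field \<Rightarrow> ('a, 'k, 'd::finite) tvec \<Rightarrow> ('a, 'k, 'd) tvec" where
  "tscale k v = (\<lambda>c. k *s v c)"

interpretation tvec: vector_space tscale
  by unfold_locales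
    (auto simp: tscale_def fun_eq_iff vec_eq_iff algebra_simps)

definition push_components ::
  "('a, 'k::{real_normed_field,euclidean_space}, 'd::finite) chart \<Rightarrow> ('a, 'k, 'd) chart
    \<Rightarrow> 'a \<Rightarrow> 'k ^ 'd \<Rightarrow> 'k ^ 'd" where
  "push_components c d p = frechet_derivative (snd d \<circ> chart_inv c) (at (snd c p))"

definition tangent_space ::
  "('a, 'k::{real_normed_field,euclidean_space}, 'd::finite) chart set \<Rightarrow> 'a
    \<Rightarrow> ('a, 'k, 'd) tvec set" where
  "tangent_space \<A> p =
     {v. (\<forall>c. \<not> (c \<in> \<A> \<and> p \<in> fst c) \<longrightarrow> v c = 0) \<and>
         (\<forall>c\<in>\<A>. \<forall>d\<in>\<A>. p \<in> fst c \<and> p \<in> fst d \<longrightarrow> v d = push_components c d p (v c))}"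

definition coord_vector ::
  "('a, 'k::{real_normed_field,euclidean_space}, 'd::finite) chart set \<Rightarrow> ('a, 'k, 'd) chart
    \<Rightarrow> 'd \<Rightarrow> 'a \<Rightarrow> ('a, 'k, 'd) tvec" where
  "coord_vector \<A> c i p =
     (\<lambda>d. if d \<in> \<A> \<and> p \<in> fst d then push_components c d p (axis i 1) else 0)"

text \<open>On an interval with more than one point the velocity is unique; on a one-point
  interval every tangent vector is a velocity.\<close>

definition has_velocity ::
  "('a, 'k::{real_normed_field,euclidean_space}, 'd::finite) chart set \<Rightarrow> real set
    \<Rightarrow> (real \<Rightarrow> 'a) \<Rightarrow> real \<Rightarrow> ('a, 'k, 'd) tvec \<Rightarrow> bool" where
  "has_velocity \<A> J \<delta> s v \<longleftrightarrow>
     v \<in> tangent_space \<A> (\<delta> s) \<and>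
     (\<forall>c\<in>\<A>. \<delta> s \<in> fst c \<longrightarrow> ((snd c \<circ> \<delta>) has_vector_derivative v c) (at s within J))"


subsection \<open>Vector bundles and frames\<close>

record ('e, 'm, 'k, 'n, 'r) vbundle =
  total_space :: "'e set"
  total_atlas :: "('e, 'k, 'n + 'r) chart set"
  base_space :: "'m set"
  base_atlas :: "('m, 'k, 'n) chart set"
  proj :: "'e \<Rightarrow> 'm"
  fadd :: "'e \<Rightarrow> 'e \<Rightarrow> 'e"
  fzero :: "'m \<Rightarrow> 'e"
  fscale :: "'k \<Rightarrow> 'e \<Rightarrow> 'e"

definition fibre :: "('e, 'm, 'k, 'n::finite, 'r::finite) vbundle \<Rightarrow> 'm \<Rightarrow> 'e set" where
  "fibre B x = {p \<in> total_space B. proj B p = x}"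

definition vector_space_axioms_on ::
  "'e set \<Rightarrow> ('e \<Rightarrow> 'e \<Rightarrow> 'e) \<Rightarrow> 'e \<Rightarrow> ('k::field \<Rightarrow> 'e \<Rightarrow> 'e) \<Rightarrow> bool" where
  "vector_space_axioms_on V add z scl \<longleftrightarrow>
     z \<in> V \<and>
     (\<forall>p\<in>V. \<forall>q\<in>V. add p q \<in> V \<and> add p q = add q p) \<and>
     (\<forall>p\<in>V. \<forall>q\<in>V. \<forall>w\<in>V. add (add p q) w = add p (add q w)) \<and>
     (\<forall>p\<in>V. add z p = p \<and> (\<exists>q\<in>V. add p q = z)) \<and>
     (\<forall>k. \<forall>p\<in>V. scl k p \<in> V) \<and>
     (\<forall>k. \<forall>p\<in>V. \<forall>q\<in>V. scl k (add p q) = add (scl k p) (scl k q)) \<and>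
     (\<forall>k l. \<forall>p\<in>V. scl (k + l) p = add (scl k p) (scl l p) \<and> scl (k * l) p = scl k (scl l p)) \<and>
     (\<forall>p\<in>V. scl 1 p = p)"

definition join :: "'k ^ 'n \<Rightarrow> 'k ^ 'r \<Rightarrow> 'k ^ ('n + 'r)" where
  "join x y = (\<chi> i. case i of Inl \<mu> \<Rightarrow> x $ \<mu> | Inr a \<Rightarrow> y $ a)"

text \<open>Local triviality: \<open>\<psi>\<close> is the fibre part of a local trivialization over the domain of the
  chart \<open>c\<close>; it is linear on the fibres, and \<open>p \<mapsto> (proj p, \<psi> p)\<close>, read in the coordinates \<open>c\<close> on
  the base, is an admissible chart of the total space that maps onto a full product.\<close>

definition vector_bundle ::
  "('e::t2_space, 'm::t2_space, 'k::{real_normed_field,euclidean_space}, 'n::finite, 'r::finite)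
    vbundle \<Rightarrow> bool" where
  "vector_bundle B \<longleftrightarrow>
     C1_manifold (total_space B) (total_atlas B) \<and>
     C1_manifold (base_space B) (base_atlas B) \<and>
     proj B ` total_space B = base_space B \<and>
     (\<forall>x\<in>base_space B. vector_space_axioms_on (fibre B x) (fadd B) (fzero B x) (fscale B)) \<and>
     (\<forall>x\<in>base_space B. \<exists>c\<in>base_atlas B. \<exists>\<psi> :: 'e \<Rightarrow> 'k ^ 'r.
        let W = {p \<in> total_space B. proj B p \<in> fst c};
            \<Phi> = (\<lambda>p. join (snd c (proj B p)) (\<psi> p))
        in x \<in> fst c \<and>
           (\<forall>y\<in>fst c. \<forall>p\<in>fibre B y. \<forall>q\<in>fibre B y. \<forall>k.
              \<psi> (fadd B p q) = \<psi> p + \<psi> q \<and> \<psi> (fscale B k p) = k *s \<psi> p) \<and>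
           (W, \<Phi>) \<in> total_atlas B \<and>
           \<Phi> ` W = {join y z | y z. y \<in> snd c ` fst c})"

text \<open>The linear combination with coefficients \<open>k\<close> of the vectors \<open>f a\<close> in the fibre over \<open>x\<close>. The
  fibre is not a type, hence the sum is written as an iterated addition along an enumeration of
  the index type, whose choice is immaterial by commutativity.\<close>

definition lincomb ::
  "('e, 'm, 'k, 'n::finite, 'r::finite) vbundle \<Rightarrow> 'm \<Rightarrow> 'k ^ 'r \<Rightarrow> ('r \<Rightarrow> 'e) \<Rightarrow> 'e" where
  "lincomb B x k f =
     foldr (\<lambda>a q. fadd B (fscale B (k $ a) (f a)) q)
       (SOME as. distinct as \<and> set as = (UNIV :: 'r set)) (fzero B x)"

definition fibre_basis ::
  "('e, 'm, 'k, 'n::finite, 'r::finite) vbundle \<Rightarrow> 'm \<Rightarrow> ('r \<Rightarrow> 'e) \<Rightarrow> bool" where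
  "fibre_basis B x f \<longleftrightarrow>
     (\<forall>a. f a \<in> fibre B x) \<and> (\<forall>p\<in>fibre B x. \<exists>!k. p = lincomb B x k f)"

definition frame ::
  "('e::t2_space, 'm::t2_space, 'k::{real_normed_field,euclidean_space}, 'n::finite, 'r::finite)
    vbundle \<Rightarrow> 'm set \<Rightarrow> ('r \<Rightarrow> 'm \<Rightarrow> 'e) \<Rightarrow> bool" where
  "frame B U e \<longleftrightarrow>
     openin (top_of_set (base_space B)) U \<and>
     (\<forall>x\<in>U. fibre_basis B x (\<lambda>a. e a x)) \<and>
     (\<forall>a. C1_map (base_atlas B) U (total_space B) (total_atlas B) (e a))"

definition frame_components ::
  "('e, 'm, 'k, 'n::finite, 'r::finite) vbundle \<Rightarrow> ('r \<Rightarrow> 'm \<Rightarrow> 'e) \<Rightarrow> 'e \<Rightarrow> 'k ^ 'r" where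
  "frame_components B e p = (THE k. p = lincomb B (proj B p) k (\<lambda>a. e a (proj B p)))"

definition vb_coordinates ::
  "('e, 'm, 'k, 'n::finite, 'r::finite) vbundle \<Rightarrow> 'm set \<Rightarrow> ('r \<Rightarrow> 'm \<Rightarrow> 'e)
    \<Rightarrow> ('m, 'k, 'n) chart \<Rightarrow> ('e, 'k, 'n + 'r) chart" where
  "vb_coordinates B U e c =
     ({p \<in> total_space B. proj B p \<in> U \<inter> fst c},
      \<lambda>p. join (snd c (proj B p)) (frame_components B e p))"

definition fibre_linear ::
  "('e, 'm, 'k, 'n::finite, 'r::finite) vbundle \<Rightarrow> 'm \<Rightarrow> 'm \<Rightarrow> ('e \<Rightarrow> 'e) \<Rightarrow> bool" where
  "fibre_linear B x y T \<longleftrightarrow>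
     T ` fibre B x \<subseteq> fibre B y \<and>
     (\<forall>p\<in>fibre B x. \<forall>q\<in>fibre B x. T (fadd B p q) = fadd B (T p) (T q)) \<and>
     (\<forall>k. \<forall>p\<in>fibre B x. T (fscale B k p) = fscale B k (T p))"


subsection \<open>Transports along paths\<close>

text \<open>\<open>I J \<gamma> s t\<close> is the transport along \<open>\<gamma> : J \<rightarrow> M\<close> from \<open>s\<close> to \<open>t\<close>. Nothing relates, a priori, the
  transports along a path and along its restrictions.\<close>

type_synonym ('e, 'm) transport = "real set \<Rightarrow> (real \<Rightarrow> 'm) \<Rightarrow> real \<Rightarrow> real \<Rightarrow> 'e \<Rightarrow> 'e"

abbreviation base_path ::
  "('e, 'm::t2_space, 'k::{real_normed_field,euclidean_space}, 'n::finite, 'r::finite) vbundle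
    \<Rightarrow> real set \<Rightarrow> (real \<Rightarrow> 'm) \<Rightarrow> bool" where
  "base_path B J \<gamma> \<equiv> C1_path (base_space B) (base_atlas B) J \<gamma>"

definition transports_agree ::
  "('e, 'm::t2_space, 'k::{real_normed_field,euclidean_space}, 'n::finite, 'r::finite) vbundle
    \<Rightarrow> ('e, 'm) transport \<Rightarrow> ('e, 'm) transport \<Rightarrow> bool" where
  "transports_agree B I I' \<longleftrightarrow>
     (\<forall>J \<gamma>. base_path B J \<gamma> \<longrightarrow>
        (\<forall>s\<in>J. \<forall>t\<in>J. \<forall>p\<in>fibre B (\<gamma> s). I J \<gamma> s t p = I' J \<gamma> s t p))"

text \<open>The first clause says that \<open>I\<close> depends on \<open>\<gamma>\<close> only as a map on \<open>J\<close>.\<close>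

definition transport_along_paths ::
  "('e, 'm::t2_space, 'k::{real_normed_field,euclidean_space}, 'n::finite, 'r::finite) vbundle
    \<Rightarrow> ('e, 'm) transport \<Rightarrow> bool" where
  "transport_along_paths B I \<longleftrightarrow>
     (\<forall>J \<gamma>. base_path B J \<gamma> \<longrightarrow>
        (\<forall>\<gamma>'. (\<forall>s\<in>J. \<gamma>' s = \<gamma> s) \<longrightarrow>
           (\<forall>s\<in>J. \<forall>t\<in>J. \<forall>p\<in>fibre B (\<gamma> s). I J \<gamma>' s t p = I J \<gamma> s t p)) \<and>
        (\<forall>s\<in>J. \<forall>t\<in>J. I J \<gamma> s t ` fibre B (\<gamma> s) \<subseteq> fibre B (\<gamma> t)) \<and>
        (\<forall>r\<in>J. \<forall>s\<in>J. \<forall>t\<in>J. \<forall>p\<in>fibre B (\<gamma> r). I J \<gamma> s t (I J \<gamma> r s p) = I J \<gamma> r t p) \<and>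
        (\<forall>s\<in>J. \<forall>p\<in>fibre B (\<gamma> s). I J \<gamma> s s p = p))"

definition linear_transport ::
  "('e, 'm::t2_space, 'k::{real_normed_field,euclidean_space}, 'n::finite, 'r::finite) vbundle
    \<Rightarrow> ('e, 'm) transport \<Rightarrow> bool" where
  "linear_transport B I \<longleftrightarrow>
     transport_along_paths B I \<and>
     (\<forall>J \<gamma>. base_path B J \<gamma> \<longrightarrow>
        (\<forall>s\<in>J. \<forall>t\<in>J. fibre_linear B (\<gamma> s) (\<gamma> t) (I J \<gamma> s t)))"

text \<open>The entry in row \<open>b\<close> and column \<open>a\<close> is the component with upper index \<open>b\<close> of the image,
  under the transport from \<open>s\<close> to \<open>t\<close>, of the frame vector with lower index \<open>a\<close>; mind the order
  of the arguments \<open>t\<close>, \<open>s\<close>.\<close>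

definition transport_matrix ::
  "('e, 'm, 'k, 'n::finite, 'r::finite) vbundle \<Rightarrow> ('r \<Rightarrow> 'm \<Rightarrow> 'e) \<Rightarrow> ('e, 'm) transport
    \<Rightarrow> real set \<Rightarrow> (real \<Rightarrow> 'm) \<Rightarrow> real \<Rightarrow> real \<Rightarrow> 'k ^ 'r ^ 'r" where
  "transport_matrix B e I J \<gamma> t s =
     (\<chi> b a. frame_components B e (I J \<gamma> s t (e a (\<gamma> s))) $ b)"

text \<open>The matrix is required to be continuously differentiable in both parameters, on the part
  of \<open>J \<times> J\<close> where it is defined; \<open>F\<close> and \<open>G\<close> are its partial derivatives.\<close>

definition C1_linear_transport ::
  "('e::t2_space, 'm::t2_space, 'k::{real_normed_field,euclidean_space}, 'n::finite, 'r::finite)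
    vbundle \<Rightarrow> ('e, 'm) transport \<Rightarrow> bool" where
  "C1_linear_transport B I \<longleftrightarrow>
     linear_transport B I \<and>
     (\<forall>U e J \<gamma>. frame B U e \<and> base_path B J \<gamma> \<longrightarrow>
        (let S = (J \<inter> \<gamma> -` U) \<times> (J \<inter> \<gamma> -` U) in
         \<exists>F G. continuous_on S F \<and> continuous_on S G \<and>
           (\<forall>z\<in>S. ((\<lambda>w. transport_matrix B e I J \<gamma> (fst w) (snd w)) has_derivative
                    (\<lambda>h. fst h *\<^sub>R F z + snd h *\<^sub>R G z)) (at z within S))))"

text \<open>The derivative is with respect to the second parameter of the matrix, at coinciding
  parameters.\<close>

definition has_transport_coefficients ::
  "('e, 'm, 'k::{real_normed_field,euclidean_space}, 'n::finite, 'r::finite) vbundle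
    \<Rightarrow> ('r \<Rightarrow> 'm \<Rightarrow> 'e) \<Rightarrow> ('e, 'm) transport \<Rightarrow> real set \<Rightarrow> (real \<Rightarrow> 'm) \<Rightarrow> real
    \<Rightarrow> 'k ^ 'r ^ 'r \<Rightarrow> bool" where
  "has_transport_coefficients B e I J \<gamma> s C \<longleftrightarrow>
     ((\<lambda>t. transport_matrix B e I J \<gamma> s t) has_vector_derivative C) (at s within J)"

text \<open>The representation of the coefficients of \<open>I\<close> through the functions \<open>\<Gamma> a b \<mu>\<close> (upper index
  \<open>a\<close>, lower indices \<open>b\<close>, \<open>\<mu>\<close>), along every path and at each of its points in the common domain of
  the frame and of the coordinates.\<close>

definition coefficients_representation ::
  "('e, 'm::t2_space, 'k::{real_normed_field,euclidean_space}, 'n::finite, 'r::finite) vbundle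
    \<Rightarrow> 'm set \<Rightarrow> ('r \<Rightarrow> 'm \<Rightarrow> 'e) \<Rightarrow> ('m, 'k, 'n) chart \<Rightarrow> ('e, 'm) transport
    \<Rightarrow> ('r \<Rightarrow> 'r \<Rightarrow> 'n \<Rightarrow> 'm \<Rightarrow> 'k) \<Rightarrow> bool" where
  "coefficients_representation B U e c I \<Gamma> \<longleftrightarrow>
     (\<forall>J \<gamma>. base_path B J \<gamma> \<longrightarrow>
        (\<forall>s\<in>J. \<gamma> s \<in> U \<inter> fst c \<longrightarrow>
           has_transport_coefficients B e I J \<gamma> s
             (\<chi> a b. \<Sum>\<mu>\<in>UNIV. \<Gamma> a b \<mu> (\<gamma> s)
                * vector_derivative (snd c \<circ> \<gamma>) (at s within J) $ \<mu>)))"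


subsection \<open>Connections and parallel transport\<close>

type_synonym ('e, 'k, 'd) distribution = "'e \<Rightarrow> ('e, 'k, 'd) tvec set"

text \<open>The tangent space at \<open>p\<close> of the fibre through \<open>p\<close>, as a subset of the tangent space of the
  total space: the velocities of paths lying in the fibre.\<close>

definition vertical_space ::
  "('e::t2_space, 'm, 'k::{real_normed_field,euclidean_space}, 'n::finite, 'r::finite) vbundle
    \<Rightarrow> ('e, 'k, 'n + 'r) distribution" where
  "vertical_space B p =
     {v. \<exists>\<epsilon>>0. \<exists>\<delta>. C1_path (total_space B) (total_atlas B) {-\<epsilon><..<\<epsilon>} \<delta> \<and> \<delta> 0 = p \<and>
           \<delta> ` {-\<epsilon><..<\<epsilon>} \<subseteq> fibre B (proj B p) \<and>
           has_velocity (total_atlas B) {-\<epsilon><..<\<epsilon>} \<delta> 0 v}"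

definition horizontal_lift ::
  "('e::t2_space, 'm, 'k::{real_normed_field,euclidean_space}, 'n::finite, 'r::finite) vbundle
    \<Rightarrow> ('e, 'k, 'n + 'r) distribution \<Rightarrow> real set \<Rightarrow> (real \<Rightarrow> 'm) \<Rightarrow> (real \<Rightarrow> 'e) \<Rightarrow> bool" where
  "horizontal_lift B H J \<gamma> \<delta> \<longleftrightarrow>
     C1_path (total_space B) (total_atlas B) J \<delta> \<and>
     (\<forall>s\<in>J. proj B (\<delta> s) = \<gamma> s) \<and>
     (\<forall>s\<in>J. \<exists>v\<in>H (\<delta> s). has_velocity (total_atlas B) J \<delta> s v)"

definition connection ::
  "('e::t2_space, 'm::t2_space, 'k::{real_normed_field,euclidean_space}, 'n::finite, 'r::finite)
    vbundle \<Rightarrow> ('e, 'k, 'n + 'r) distribution \<Rightarrow> bool" where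
  "connection B H \<longleftrightarrow>
     (\<forall>p\<in>total_space B.
        tvec.subspace (H p) \<and> tvec.dim (H p) = CARD('n) \<and>
        H p \<inter> vertical_space B p = {0} \<and>
        {v + h | v h. v \<in> vertical_space B p \<and> h \<in> H p} = tangent_space (total_atlas B) p) \<and>
     (\<forall>J \<gamma>. base_path B J \<gamma> \<longrightarrow>
        (\<forall>s\<^sub>0\<in>J. \<forall>p\<in>fibre B (\<gamma> s\<^sub>0).
           \<exists>\<delta>. horizontal_lift B H J \<gamma> \<delta> \<and> \<delta> s\<^sub>0 = p \<and>
             (\<forall>\<delta>'. horizontal_lift B H J \<gamma> \<delta>' \<and> \<delta>' s\<^sub>0 = p \<longrightarrow> (\<forall>s\<in>J. \<delta>' s = \<delta> s))))"

definition parallel_transport ::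
  "('e::t2_space, 'm::t2_space, 'k::{real_normed_field,euclidean_space}, 'n::finite, 'r::finite)
    vbundle \<Rightarrow> ('e, 'k, 'n + 'r) distribution \<Rightarrow> real \<Rightarrow> real \<Rightarrow> (real \<Rightarrow> 'm) \<Rightarrow> 'e \<Rightarrow> 'e" where
  "parallel_transport B H \<sigma> \<tau> \<gamma> p =
     (THE q. \<exists>\<delta>. horizontal_lift B H {\<sigma>..\<tau>} \<gamma> \<delta> \<and> \<delta> \<sigma> = p \<and> \<delta> \<tau> = q)"

definition parallel_transport_along ::
  "('e::t2_space, 'm::t2_space, 'k::{real_normed_field,euclidean_space}, 'n::finite, 'r::finite)
    vbundle \<Rightarrow> ('e, 'k, 'n + 'r) distribution \<Rightarrow> ('e, 'm) transport" where
  "parallel_transport_along B H J \<gamma> s t =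
     (if s \<le> t then parallel_transport B H s t \<gamma>
      else inv_into (fibre B (\<gamma> t)) (parallel_transport B H t s \<gamma>))"

definition linear_connection ::
  "('e::t2_space, 'm::t2_space, 'k::{real_normed_field,euclidean_space}, 'n::finite, 'r::finite)
    vbundle \<Rightarrow> ('e, 'k, 'n + 'r) distribution \<Rightarrow> bool" where
  "linear_connection B H \<longleftrightarrow>
     connection B H \<and>
     (\<forall>\<sigma> \<tau> \<gamma>. \<sigma> \<le> \<tau> \<and> base_path B {\<sigma>..\<tau>} \<gamma> \<longrightarrow>
        fibre_linear B (\<gamma> \<sigma>) (\<gamma> \<tau>) (parallel_transport B H \<sigma> \<tau> \<gamma>))"

text \<open>The condition says that the vectors \<open>X \<mu>\<close> of the frame adapted to the vector bundle
  coordinates, when formed with the functions \<open>\<Gamma>2 b \<mu>\<close>, are horizontal.\<close>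

definition two_index_coefficients ::
  "('e::t2_space, 'm::t2_space, 'k::{real_normed_field,euclidean_space}, 'n::finite, 'r::finite)
    vbundle \<Rightarrow> ('e, 'k, 'n + 'r) distribution \<Rightarrow> 'm set \<Rightarrow> ('r \<Rightarrow> 'm \<Rightarrow> 'e)
    \<Rightarrow> ('m, 'k, 'n) chart \<Rightarrow> ('r \<Rightarrow> 'n \<Rightarrow> 'e \<Rightarrow> 'k) \<Rightarrow> bool" where
  "two_index_coefficients B H U e c \<Gamma>2 \<longleftrightarrow>
     (let u = vb_coordinates B U e c; \<A> = total_atlas B in
      \<forall>p\<in>fst u. \<forall>\<mu>.
        coord_vector \<A> u (Inl \<mu>) p
          + (\<Sum>b\<in>UNIV. tscale (\<Gamma>2 b \<mu> p) (coord_vector \<A> u (Inr b) p)) \<in> H p)"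

definition three_index_coefficients ::
  "('e::t2_space, 'm::t2_space, 'k::{real_normed_field,euclidean_space}, 'n::finite, 'r::finite)
    vbundle \<Rightarrow> ('e, 'k, 'n + 'r) distribution \<Rightarrow> 'm set \<Rightarrow> ('r \<Rightarrow> 'm \<Rightarrow> 'e)
    \<Rightarrow> ('m, 'k, 'n) chart \<Rightarrow> ('r \<Rightarrow> 'r \<Rightarrow> 'n \<Rightarrow> 'm \<Rightarrow> 'k) \<Rightarrow> bool" where
  "three_index_coefficients B H U e c \<Gamma> \<longleftrightarrow>
     two_index_coefficients B H U e c
       (\<lambda>a \<mu> p. - (\<Sum>b\<in>UNIV. \<Gamma> a b \<mu> (proj B p) * frame_components B e p $ b))"

end

theory Submission
  imports Defs
begin

text \<open>
  In a frame, a lift with components \<open>y\<close> of a path \<open>\<gamma>\<close> is horizontal iff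
  \<open>y' = - (\<Gamma> \<gamma>') y\<close>, and the orbits of a linear transport with matrix \<open>L\<close> and coefficients \<open>C\<close>
  satisfy \<open>y' = - C y\<close>, because \<open>L t t = 1\<close> makes the two partial derivatives of \<open>L\<close> opposite
  on the diagonal. Comparing the two equations gives the representation of the coefficients of a
  parallel transport; that the latter is C1 follows from \<open>L t s = L t s\<^sub>0 ** L s\<^sub>0 s\<close>,
  as the first factor is C1 by definition of a lift and the second one is an inverse matrix.
  Conversely, the horizontal space at \<open>p\<close> has to consist of the velocities at \<open>p\<close> of the orbits
  through \<open>p\<close>. No theorem on differential equations is needed: orbits are horizontal lifts, and any
  horizontal lift is an orbit since transporting it back to a fixed fibre gives a locally constant map.
\<close>

subsection \<open>Scalar functions of class C1\<close>

text \<open>The velocities of orbits at \<open>p\<close> form a linear space because of the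
  representation of the coefficients: it makes such a velocity a function \<open>hvec\<close> of the
  velocity of the base path alone, linear in it. This also bridges a gap in the notion of transport,
  where the transports along \<gamma> on \<open>J\<close> and on a subinterval are a priori
  unrelated: orbits over any two intervals have velocities given by the same \<open>hvec\<close>, so
  orbits over every \<open>J\<close> are horizontal for a distribution built from paths on
  \<open>{0..\<epsilon>}\<close>, and uniqueness of lifts then yields the compatibility with
  restrictions on which parallel transport rests. In the converse part the functions \<Gamma> come
  without any continuity, so lifts are taken from the transport itself and not from the equation.
  Much of the length is due to tangent vectors being families over all charts of a maximal atlas:
  vector bundle coordinates must first be shown to be admissible charts of the total space.
  Velocities on one-point intervals are not unique, hence the separate cases
  \<open>J \<subseteq> {s}\<close>.\<close>

text \<open>Fixing the coordinate functionals \<open>l\<close> covers at the same time functions on \<open>'k ^ 'd\<close> with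
  \<open>'k\<close>-linear derivatives and functions of one or two real parameters.\<close>

definition C1_wrt ::
  "('i::finite \<Rightarrow> 'a::real_normed_vector \<Rightarrow> 'k::real_normed_field) \<Rightarrow> 'a set \<Rightarrow> ('a \<Rightarrow> 'k) \<Rightarrow> bool" where
  "C1_wrt l S f \<longleftrightarrow> (\<exists>g. (\<forall>i. continuous_on S (g i)) \<and>
     (\<forall>x\<in>S. (f has_derivative (\<lambda>h. \<Sum>i\<in>UNIV. g i x * l i h)) (at x within S)))"

lemma C1_wrtI:
  assumes "\<And>i. continuous_on S (g i)"
    and "\<And>x. x \<in> S \<Longrightarrow> (f has_derivative (\<lambda>h. \<Sum>i\<in>UNIV. g i x * l i h)) (at x within S)"
  shows "C1_wrt l S f"
  unfolding C1_wrt_def by (intro exI[where x = g] conjI allI ballI assms)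

lemma C1_wrt_continuous_on:
  assumes "C1_wrt l S f"
  shows "continuous_on S f"
proof -
  obtain g where "(\<forall>i. continuous_on S (g i)) \<and>
      (\<forall>x\<in>S. (f has_derivative (\<lambda>h. \<Sum>i\<in>UNIV. g i x * l i h)) (at x within S))"
    using assms unfolding C1_wrt_def ..
  then have g: "\<And>i. continuous_on S (g i)"
    "\<And>x. x \<in> S \<Longrightarrow> (f has_derivative (\<lambda>h. \<Sum>i\<in>UNIV. g i x * l i h)) (at x within S)"
    by simp_all
  show ?thesis
    unfolding continuous_on_eq_continuous_within using has_derivative_continuous[OF g(2)] by simp
qed

lemma C1_wrt_const: "C1_wrt l S (\<lambda>x. k)"
  by (rule C1_wrtI[where g = "\<lambda>i x. 0"]) auto

lemma C1_wrt_add: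
  assumes "C1_wrt l S f" "C1_wrt l S f'"
  shows "C1_wrt l S (\<lambda>x. f x + f' x)"
proof -
  obtain g where "(\<forall>i. continuous_on S (g i)) \<and>
      (\<forall>x\<in>S. (f has_derivative (\<lambda>h. \<Sum>i\<in>UNIV. g i x * l i h)) (at x within S))"
    using assms(1) unfolding C1_wrt_def ..
  then have g: "\<And>i. continuous_on S (g i)"
    "\<And>x. x \<in> S \<Longrightarrow> (f has_derivative (\<lambda>h. \<Sum>i\<in>UNIV. g i x * l i h)) (at x within S)"
    by simp_all
  obtain g' where "(\<forall>i. continuous_on S (g' i)) \<and>
      (\<forall>x\<in>S. (f' has_derivative (\<lambda>h. \<Sum>i\<in>UNIV. g' i x * l i h)) (at x within S))"
    using assms(2) unfolding C1_wrt_def ..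
  then have g': "\<And>i. continuous_on S (g' i)"
    "\<And>x. x \<in> S \<Longrightarrow> (f' has_derivative (\<lambda>h. \<Sum>i\<in>UNIV. g' i x * l i h)) (at x within S)"
    by simp_all
  show ?thesis
    by (rule C1_wrtI[where g = "\<lambda>i x. g i x + g' i x"])
      (auto intro!: continuous_intros g(1) g'(1) has_derivative_eq_rhs[OF has_derivative_add[OF g(2) g'(2)]]
        simp: fun_eq_iff sum.distrib algebra_simps)
qed

lemma C1_wrt_mult:
  assumes "C1_wrt l S f" "C1_wrt l S f'"
  shows "C1_wrt l S (\<lambda>x. f x * f' x)"
proof -
  note cont = assms[THEN C1_wrt_continuous_on]
  obtain g where "(\<forall>i. continuous_on S (g i)) \<and>
      (\<forall>x\<in>S. (f has_derivative (\<lambda>h. \<Sum>i\<in>UNIV. g i x * l i h)) (at x within S))"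
    using assms(1) unfolding C1_wrt_def ..
  then have g: "\<And>i. continuous_on S (g i)"
    "\<And>x. x \<in> S \<Longrightarrow> (f has_derivative (\<lambda>h. \<Sum>i\<in>UNIV. g i x * l i h)) (at x within S)"
    by simp_all
  obtain g' where "(\<forall>i. continuous_on S (g' i)) \<and>
      (\<forall>x\<in>S. (f' has_derivative (\<lambda>h. \<Sum>i\<in>UNIV. g' i x * l i h)) (at x within S))"
    using assms(2) unfolding C1_wrt_def ..
  then have g': "\<And>i. continuous_on S (g' i)"
    "\<And>x. x \<in> S \<Longrightarrow> (f' has_derivative (\<lambda>h. \<Sum>i\<in>UNIV. g' i x * l i h)) (at x within S)"
    by simp_all
  show ?thesis
    by (rule C1_wrtI[where g = "\<lambda>i x. f x * g' i x + g i x * f' x"])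
      (auto intro!: continuous_intros cont g(1) g'(1) has_derivative_eq_rhs[OF has_derivative_mult[OF g(2) g'(2)]]
        simp: fun_eq_iff sum.distrib sum_distrib_left sum_distrib_right algebra_simps)
qed

lemma C1_wrt_inverse:
  assumes "C1_wrt l S f" "\<And>x. x \<in> S \<Longrightarrow> f x \<noteq> 0"
  shows "C1_wrt l S (\<lambda>x. inverse (f x))"
proof -
  note cont = assms(1)[THEN C1_wrt_continuous_on]
  obtain g where "(\<forall>i. continuous_on S (g i)) \<and>
      (\<forall>x\<in>S. (f has_derivative (\<lambda>h. \<Sum>i\<in>UNIV. g i x * l i h)) (at x within S))"
    using assms(1) unfolding C1_wrt_def ..
  then have g: "\<And>i. continuous_on S (g i)"
    "\<And>x. x \<in> S \<Longrightarrow> (f has_derivative (\<lambda>h. \<Sum>i\<in>UNIV. g i x * l i h)) (at x within S)"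
    by simp_all
  show ?thesis
    by (rule C1_wrtI[where g = "\<lambda>i x. - (inverse (f x) * g i x * inverse (f x))"])
      (auto intro!: continuous_intros cont g(1) assms(2)
          has_derivative_eq_rhs[OF Deriv.has_derivative_inverse[OF assms(2) g(2)]]
        simp: fun_eq_iff sum_distrib_left sum_distrib_right sum_negf algebra_simps)
qed

lemma C1_wrt_divide:
  assumes "C1_wrt l S f" "C1_wrt l S f'" "\<And>x. x \<in> S \<Longrightarrow> f' x \<noteq> 0"
  shows "C1_wrt l S (\<lambda>x. f x / f' x)"
  using C1_wrt_mult[OF assms(1) C1_wrt_inverse[OF assms(2,3)]] by (simp add: divide_inverse)

lemma C1_wrt_sum:
  "finite A \<Longrightarrow> (\<And>j. j \<in> A \<Longrightarrow> C1_wrt l S (f j)) \<Longrightarrow> C1_wrt l S (\<lambda>x. \<Sum>j\<in>A. f j x)"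
  by (induction A rule: finite_induct) (auto intro: C1_wrt_add C1_wrt_const)

lemma C1_wrt_prod:
  "finite A \<Longrightarrow> (\<And>j. j \<in> A \<Longrightarrow> C1_wrt l S (f j)) \<Longrightarrow> C1_wrt l S (\<lambda>x. \<Prod>j\<in>A. f j x)"
  by (induction A rule: finite_induct) (auto intro: C1_wrt_mult C1_wrt_const)

lemma C1_wrt_det:
  assumes "\<And>i j. C1_wrt l S (\<lambda>x. A x $ i $ j)"
  shows "C1_wrt l S (\<lambda>x. det (A x :: 'k::real_normed_field ^ 'r ^ 'r))"
  unfolding det_def
  by (intro C1_wrt_sum C1_wrt_mult C1_wrt_const C1_wrt_prod assms finite_permutations) auto

lemma C1_wrt_cong:
  assumes "C1_wrt l S f" "\<And>x. x \<in> S \<Longrightarrow> f x = f' x"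
  shows "C1_wrt l S f'"
proof -
  obtain g where "(\<forall>i. continuous_on S (g i)) \<and>
      (\<forall>x\<in>S. (f has_derivative (\<lambda>h. \<Sum>i\<in>UNIV. g i x * l i h)) (at x within S))"
    using assms(1) unfolding C1_wrt_def ..
  then have g: "\<And>i. continuous_on S (g i)"
    "\<And>x. x \<in> S \<Longrightarrow> (f has_derivative (\<lambda>h. \<Sum>i\<in>UNIV. g i x * l i h)) (at x within S)"
    by simp_all
  show ?thesis
    by (rule C1_wrtI[OF g(1)])
      (auto intro: has_derivative_transform[OF _ _ g(2)] simp: assms(2))
qed

text \<open>By Cramer's rule the solution of a linear system depends on the system like a rational function.\<close>

lemma C1_wrt_linear_system:
  fixes A :: "'a::real_normed_vector \<Rightarrow> 'k::real_normed_field ^ 'r ^ 'r"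
  assumes A: "\<And>i j. C1_wrt l S (\<lambda>x. A x $ i $ j)" and b: "\<And>i. C1_wrt l S (\<lambda>x. b x $ i)"
    and inv: "\<And>x. x \<in> S \<Longrightarrow> invertible (A x)" and y: "\<And>x. x \<in> S \<Longrightarrow> A x *v y x = b x"
  shows "C1_wrt l S (\<lambda>x. y x $ k)"
proof (rule C1_wrt_cong)
  let ?B = "\<lambda>x. (\<chi> i j. if j = k then b x $ i else A x $ i $ j) :: 'k ^ 'r ^ 'r"
  have nz: "det (A x) \<noteq> 0" if "x \<in> S" for x
    using inv[OF that] by (simp add: invertible_det_nz)
  have "C1_wrt l S (\<lambda>x. ?B x $ i $ j)" for i j
    by (cases "j = k") (auto intro: A b)
  then show "C1_wrt l S (\<lambda>x. det (?B x) / det (A x))"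
    by (intro C1_wrt_divide C1_wrt_det A nz) auto
  show "det (?B x) / det (A x) = y x $ k" if "x \<in> S" for x
    using y[OF that] unfolding cramer[OF nz[OF that]] by simp
qed

subsection \<open>Maps of class C1\<close>

lemma matrix_mult_component:
  "((A::'k::comm_semiring_1 ^ 'd ^ 'f) *v h) $ i = (\<Sum>j\<in>UNIV. A $ i $ j * h $ j)"
  by (simp add: matrix_vector_mult_def)

text \<open>The entries may be vectors themselves, so applying the rule twice covers matrix-valued
  functions.\<close>

lemma has_derivative_vec:
  fixes f :: "'a::real_normed_vector \<Rightarrow> 'b::euclidean_space ^ 'f"
  assumes "\<And>i. ((\<lambda>x. f x $ i) has_derivative (\<lambda>h. f' h $ i)) (at x within S)"
  shows "(f has_derivative f') (at x within S)"
  unfolding has_derivative_componentwise_within[of f]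
  by (auto simp: Basis_vec_def inner_axis
      intro!: bounded_linear.has_derivative[OF bounded_linear_inner_left assms])

text \<open>Reduces maps between charts to the scalar calculus above. Openness of \<open>S\<close>
  turns derivatives within \<open>S\<close> into full ones, as \<open>C1_on\<close> demands.\<close>

lemma C1_on_componentwise:
  fixes f :: "'k::{real_normed_field,euclidean_space} ^ 'd \<Rightarrow> 'k ^ 'f"
  assumes S: "open S"
  shows "C1_on S f \<longleftrightarrow> (\<forall>i. C1_wrt (\<lambda>j h. h $ j) S (\<lambda>x. f x $ i))"
proof
  assume "C1_on S f"
  then obtain A where "continuous_on S A \<and> (\<forall>x\<in>S. (f has_derivative (\<lambda>h. A x *v h)) (at x))"
    unfolding C1_on_def ..
  then have A: "continuous_on S A" "\<And>x. x \<in> S \<Longrightarrow> (f has_derivative (\<lambda>h. A x *v h)) (at x)"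
    by simp_all
  show "\<forall>i. C1_wrt (\<lambda>j h. h $ j) S (\<lambda>x. f x $ i)"
  proof
    fix i
    show "C1_wrt (\<lambda>j h. h $ j) S (\<lambda>x. f x $ i)"
    proof (rule C1_wrtI[where g = "\<lambda>j x. A x $ i $ j"])
      show "continuous_on S (\<lambda>x. A x $ i $ j)" for j
        by (intro continuous_intros A)
      show "((\<lambda>x. f x $ i) has_derivative (\<lambda>h. \<Sum>j\<in>UNIV. A x $ i $ j * h $ j)) (at x within S)"
        if "x \<in> S" for x
        unfolding matrix_mult_component[symmetric]
        using bounded_linear.has_derivative[OF bounded_linear_vec_nth A(2)[OF that]]
          has_derivative_at_withinI by blast
    qed
  qed
next
  assume "\<forall>i. C1_wrt (\<lambda>j h. h $ j) S (\<lambda>x. f x $ i)"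
  then obtain g where "\<forall>i. (\<forall>j. continuous_on S (g i j)) \<and> (\<forall>x\<in>S. ((\<lambda>x. f x $ i) has_derivative
      (\<lambda>h. \<Sum>j\<in>UNIV. g i j x * h $ j)) (at x within S))"
    unfolding C1_wrt_def choice_iff by blast
  then have g: "\<And>i j. continuous_on S (g i j)"
    "\<And>i x. x \<in> S \<Longrightarrow> ((\<lambda>x. f x $ i) has_derivative (\<lambda>h. \<Sum>j\<in>UNIV. g i j x * h $ j)) (at x within S)"
    by auto
  show "C1_on S f"
    unfolding C1_on_def
  proof (intro exI[where x = "\<lambda>x. \<chi> i j. g i j x"] conjI ballI)
    show "continuous_on S (\<lambda>x. \<chi> i j. g i j x)"
      by (intro continuous_on_vec_lambda g)
    fix x assume x: "x \<in> S"
    have "((\<lambda>x. f x $ i) has_derivative (\<lambda>h. ((\<chi> i j. g i j x) *v h) $ i)) (at x)" for i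
      using g(2)[OF x, of i] at_within_open[OF x S] by (simp add: matrix_mult_component)
    then show "(f has_derivative (\<lambda>h. (\<chi> i j. g i j x) *v h)) (at x)"
      by (rule has_derivative_vec)
  qed
qed

text \<open>The matrix in \<open>C1_on\<close> is only asserted to exist. Writing it through
  \<open>frechet_derivative\<close> makes it canonical, so that witnesses on different open sets
  agree and can be glued in \<open>C1_on_local\<close>.\<close>

lemma C1_on_iff_frechet:
  "C1_on S f \<longleftrightarrow>
     continuous_on S (\<lambda>x. \<chi> i j. frechet_derivative f (at x) (axis j 1) $ i) \<and>
     (\<forall>x\<in>S. (f has_derivative (\<lambda>h. (\<chi> i j. frechet_derivative f (at x) (axis j 1) $ i) *v h)) (at x))"
proof
  assume "C1_on S f"
  then obtain A where "continuous_on S A \<and> (\<forall>x\<in>S. (f has_derivative (\<lambda>h. A x *v h)) (at x))"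
    unfolding C1_on_def ..
  then have A: "continuous_on S A" "\<And>x. x \<in> S \<Longrightarrow> (f has_derivative (\<lambda>h. A x *v h)) (at x)"
    by simp_all
  have eq: "(\<chi> i j. frechet_derivative f (at x) (axis j 1) $ i) = A x" if "x \<in> S" for x
    unfolding frechet_derivative_at[OF A(2)[OF that], symmetric]
    by (simp add: vec_eq_iff matrix_mult_component axis_def if_distrib cong: if_cong)
  show "continuous_on S (\<lambda>x. \<chi> i j. frechet_derivative f (at x) (axis j 1) $ i) \<and>
     (\<forall>x\<in>S. (f has_derivative (\<lambda>h. (\<chi> i j. frechet_derivative f (at x) (axis j 1) $ i) *v h)) (at x))"
    using A eq continuous_on_cong[OF refl eq] by auto
qed (auto simp: C1_on_def)

lemma C1_on_local:
  assumes "\<And>x. x \<in> S \<Longrightarrow> \<exists>T. open T \<and> x \<in> T \<and> C1_on T f"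
  shows "C1_on S f"
  unfolding C1_on_iff_frechet
proof (intro conjI ballI)
  show "continuous_on S (\<lambda>x. \<chi> i j. frechet_derivative f (at x) (axis j 1) $ i)"
    unfolding continuous_on_eq_continuous_within
  proof
    fix x assume "x \<in> S"
    then obtain T where T: "open T" "x \<in> T" "C1_on T f"
      using assms by blast
    then have "isCont (\<lambda>x. \<chi> i j. frechet_derivative f (at x) (axis j 1) $ i) x"
      unfolding C1_on_iff_frechet using continuous_on_eq_continuous_at by blast
    then show "continuous (at x within S) (\<lambda>x. \<chi> i j. frechet_derivative f (at x) (axis j 1) $ i)"
      using continuous_at_imp_continuous_at_within by blast
  qed
  fix x assume "x \<in> S"
  with assms obtain T where "x \<in> T" "C1_on T f"
    by blast
  then show "(f has_derivative (\<lambda>h. (\<chi> i j. frechet_derivative f (at x) (axis j 1) $ i) *v h)) (at x)"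
    unfolding C1_on_iff_frechet by simp
qed

lemma C1_on_subset:
  assumes "C1_on S f" "T \<subseteq> S"
  shows "C1_on T f"
proof -
  obtain A where "continuous_on S A \<and> (\<forall>x\<in>S. (f has_derivative (\<lambda>h. A x *v h)) (at x))"
    using assms(1) unfolding C1_on_def ..
  then have A: "continuous_on S A" "\<And>x. x \<in> S \<Longrightarrow> (f has_derivative (\<lambda>h. A x *v h)) (at x)"
    by simp_all
  show ?thesis
    unfolding C1_on_def using A(2) assms(2) continuous_on_subset[OF A(1) assms(2)] by blast
qed

lemma C1_on_imp_continuous_on:
  assumes "C1_on S f"
  shows "continuous_on S f"
proof -
  obtain A where "continuous_on S A \<and> (\<forall>x\<in>S. (f has_derivative (\<lambda>h. A x *v h)) (at x))"
    using assms unfolding C1_on_def ..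
  then have A: "continuous_on S A" "\<And>x. x \<in> S \<Longrightarrow> (f has_derivative (\<lambda>h. A x *v h)) (at x)"
    by simp_all
  have "\<And>x. x \<in> S \<Longrightarrow> isCont f x"
    using has_derivative_continuous[OF A(2)] .
  then show ?thesis
    by (intro continuous_at_imp_continuous_on) auto
qed

lemma C1_on_cong:
  assumes "C1_on S f" "open S" "\<And>x. x \<in> S \<Longrightarrow> f x = g x"
  shows "C1_on S g"
proof -
  obtain A where "continuous_on S A \<and> (\<forall>x\<in>S. (f has_derivative (\<lambda>h. A x *v h)) (at x))"
    using assms(1) unfolding C1_on_def ..
  then have A: "continuous_on S A" "\<And>x. x \<in> S \<Longrightarrow> (f has_derivative (\<lambda>h. A x *v h)) (at x)"
    by simp_all
  have "(g has_derivative (\<lambda>h. A x *v h)) (at x)" if "x \<in> S" for x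
    using has_derivative_transform_within_open[OF A(2)[OF that] assms(2) that assms(3)] .
  then show ?thesis
    unfolding C1_on_def using A(1) by blast
qed

lemma C1_on_compose:
  assumes f: "C1_on S f" and g: "C1_on T g" and sub: "f ` S \<subseteq> T"
  shows "C1_on S (g \<circ> f)"
proof -
  from f obtain A where "continuous_on S A \<and> (\<forall>x\<in>S. (f has_derivative (\<lambda>h. A x *v h)) (at x))"
    unfolding C1_on_def ..
  then have A: "continuous_on S A" "\<And>x. x \<in> S \<Longrightarrow> (f has_derivative (\<lambda>h. A x *v h)) (at x)"
    by simp_all
  from g obtain B where "continuous_on T B \<and> (\<forall>x\<in>T. (g has_derivative (\<lambda>h. B x *v h)) (at x))"
    unfolding C1_on_def ..
  then have B: "continuous_on T B" "\<And>x. x \<in> T \<Longrightarrow> (g has_derivative (\<lambda>h. B x *v h)) (at x)"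
    by simp_all
  have cB: "continuous_on S (\<lambda>x. B (f x))"
    using continuous_on_compose2[OF B(1) C1_on_imp_continuous_on[OF f] sub] .
  show ?thesis
    unfolding C1_on_def
  proof (intro exI[where x = "\<lambda>x. B (f x) ** A x"] conjI ballI)
    show "continuous_on S (\<lambda>x. B (f x) ** A x)"
      unfolding matrix_matrix_mult_def
      by (intro continuous_on_vec_lambda continuous_intros A cB)
    fix x assume "x \<in> S"
    then show "(g \<circ> f has_derivative (\<lambda>h. (B (f x) ** A x) *v h)) (at x)"
      using diff_chain_at[OF A(2) B(2), of x] sub
      by (auto simp: o_def matrix_vector_mul_assoc)
  qed
qed

text \<open>The derivative is linear over \<open>'k\<close>, and not only over the reals, because it
  is given by a matrix over \<open>'k\<close>. The \<open>'k\<close>-linear structure of tangent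
  spaces rests on this.\<close>

lemma frechet_C1_on:
  assumes "C1_on S f" "x \<in> S"
  shows "(f has_derivative frechet_derivative f (at x)) (at x)"
    and "frechet_derivative f (at x) (v + w) =
      frechet_derivative f (at x) v + frechet_derivative f (at x) w"
    and "frechet_derivative f (at x) (k *s v) = k *s frechet_derivative f (at x) v"
proof -
  from assms obtain A where A: "(f has_derivative (\<lambda>h. A *v h)) (at x)"
    unfolding C1_on_def by auto
  have eq: "frechet_derivative f (at x) = (\<lambda>h. A *v h)"
    using frechet_derivative_at[OF A] by simp
  show "(f has_derivative frechet_derivative f (at x)) (at x)"
    using A eq by simp
  show "frechet_derivative f (at x) (v + w) =
      frechet_derivative f (at x) v + frechet_derivative f (at x) w"
    by (simp add: eq matrix_vector_right_distrib)
  show "frechet_derivative f (at x) (k *s v) = k *s frechet_derivative f (at x) v"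
    by (simp add: eq vector_scalar_commute)
qed

text \<open>Continuity is needed jointly in the point and the vector: reading the velocity of a path
  in another chart applies the derivative of the transition map at a moving point to a moving
  vector.\<close>

lemma C1_on_continuous_frechet:
  assumes "C1_on S f"
  shows "continuous_on (S \<times> UNIV) (\<lambda>z. frechet_derivative f (at (fst z)) (snd z))"
proof -
  from assms obtain A where "continuous_on S A \<and> (\<forall>x\<in>S. (f has_derivative (\<lambda>h. A x *v h)) (at x))"
    unfolding C1_on_def ..
  then have A: "continuous_on S A" "\<And>x. x \<in> S \<Longrightarrow> (f has_derivative (\<lambda>h. A x *v h)) (at x)"
    by simp_all
  have "continuous_on (S \<times> UNIV) (\<lambda>z. A (fst z) *v snd z)"
    unfolding matrix_vector_mult_def
    by (intro continuous_on_vec_lambda continuous_intros continuous_on_compose2[OF A(1)]) auto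
  moreover have "frechet_derivative f (at (fst z)) (snd z) = A (fst z) *v snd z" if "z \<in> S \<times> UNIV" for z
    using frechet_derivative_at[OF A(2), of "fst z"] that by (simp add: mem_Times_iff)
  ultimately show ?thesis
    using continuous_on_cong[OF refl, of "S \<times> UNIV" "\<lambda>z. frechet_derivative f (at (fst z)) (snd z)"
        "\<lambda>z. A (fst z) *v snd z"] by blast
qed

subsection \<open>Derivatives along paths\<close>

text \<open>A connected set with a second point accumulates at each of its points. This is the
  condition under which derivatives within \<open>J\<close> are unique.\<close>

lemma at_within_interval_neq_bot:
  fixes J :: "real set"
  assumes "is_interval J" "s \<in> J" "\<not> J \<subseteq> {s}"
  shows "at s within J \<noteq> bot"
proof -
  have "s islimpt J"
    using assms by (intro connected_imp_perfect) (auto simp: is_interval_connected)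
  then show ?thesis
    by (simp add: trivial_limit_within)
qed

lemma at_within_open_Int: "open N \<Longrightarrow> s \<in> N \<Longrightarrow> at s within (J \<inter> N) = at s within J"
  by (rule at_within_nhd[where S = N]) auto

lemma continuous_on_Int_open_imp_continuous:
  assumes "continuous_on (T \<inter> N) f" "open N" "s \<in> T" "s \<in> N"
  shows "continuous (at s within T) f"
proof -
  have "continuous (at s within T \<inter> N) f"
    using assms by (simp add: continuous_on_eq_continuous_within)
  then show ?thesis
    unfolding at_within_open_Int[OF assms(2,4)] .
qed

text \<open>If \<open>J\<close> has more than one point, all local derivatives coincide with
  \<open>vector_derivative\<close>, which is therefore continuous near every point. If
  \<open>J\<close> has at most one point, derivatives are not unique, but then any choice of them is
  continuous on \<open>T\<close>.\<close>

lemma vector_derivative_glue: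
  fixes f :: "real \<Rightarrow> 'b::real_normed_vector"
  assumes J: "is_interval J" and T: "T \<subseteq> J"
    and loc: "\<And>s. s \<in> T \<Longrightarrow> \<exists>N g. open N \<and> s \<in> N \<and> continuous_on (T \<inter> N) g \<and>
      (\<forall>t\<in>T \<inter> N. (f has_vector_derivative g t) (at t within J))"
  shows "\<exists>g. continuous_on T g \<and> (\<forall>t\<in>T. (f has_vector_derivative g t) (at t within J))"
proof (cases "\<exists>a. J \<subseteq> {a}")
  case True
  then obtain a where a: "J \<subseteq> {a}" ..
  have "\<exists>w. (f has_vector_derivative w) (at t within J)" if "t \<in> T" for t
  proof -
    obtain N g where "open N \<and> t \<in> N \<and> continuous_on (T \<inter> N) g \<and>
      (\<forall>t\<in>T \<inter> N. (f has_vector_derivative g t) (at t within J))"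
      using loc[OF \<open>t \<in> T\<close>] by (elim exE)
    then have "(f has_vector_derivative g t) (at t within J)"
      using that by simp
    then show ?thesis ..
  qed
  then have "\<exists>g. \<forall>t\<in>T. (f has_vector_derivative g t) (at t within J)"
    by (intro bchoice) simp
  then obtain g where g: "\<forall>t\<in>T. (f has_vector_derivative g t) (at t within J)" ..
  have "T = {} \<or> T = {a}"
    using a T by auto
  then have "continuous_on T g"
    by (elim disjE) simp_all
  with g show ?thesis
    by (intro exI[of _ g] conjI)
next
  case False
  then have nb: "at t within J \<noteq> bot" if "t \<in> J" for t
    using at_within_interval_neq_bot[OF J that] by auto
  let ?g = "\<lambda>t. vector_derivative f (at t within J)"
  have loc': "\<exists>N. open N \<and> s \<in> N \<and> continuous_on (T \<inter> N) ?g \<and>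
      (\<forall>t\<in>T \<inter> N. (f has_vector_derivative ?g t) (at t within J))" if s: "s \<in> T" for s
  proof -
    obtain N g where N: "open N \<and> s \<in> N \<and> continuous_on (T \<inter> N) g \<and>
      (\<forall>t\<in>T \<inter> N. (f has_vector_derivative g t) (at t within J))"
      using loc[OF s] by (elim exE)
    then have eq: "?g t = g t" if "t \<in> T \<inter> N" for t
      using that T by (intro vector_derivative_within nb) auto
    have "continuous_on (T \<inter> N) ?g"
      by (rule continuous_on_eq[of _ g]) (use N eq in auto)
    then show ?thesis
      using N eq by (intro exI[of _ N]) simp
  qed
  have "continuous_on T ?g"
    unfolding continuous_on_eq_continuous_within
  proof
    fix s assume s: "s \<in> T"
    then obtain N where "open N \<and> s \<in> N \<and> continuous_on (T \<inter> N) ?g \<and>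
      (\<forall>t\<in>T \<inter> N. (f has_vector_derivative ?g t) (at t within J))"
      using loc'[OF s] by (elim exE)
    then show "continuous (at s within T) ?g"
      using s by (intro continuous_on_Int_open_imp_continuous[of T N]) simp_all
  qed
  moreover have "\<forall>t\<in>T. (f has_vector_derivative ?g t) (at t within J)"
    using loc' by blast
  ultimately show ?thesis
    by (intro exI[of _ ?g] conjI)
qed

subsection \<open>Charts and tangent vectors\<close>

locale C1_mfd =
  fixes X :: "'a::t2_space set"
    and A :: "('a, 'k::{real_normed_field,euclidean_space}, 'd::finite) chart set"
  assumes manifold: "C1_manifold X A"
begin

lemma is_chart: "c \<in> A \<Longrightarrow> is_chart X c"
  using manifold unfolding C1_manifold_def by blast

lemma chart_homeomorphism: "c \<in> A \<Longrightarrow> homeomorphism (fst c) (snd c ` fst c) (snd c) (chart_inv c)"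
  using is_chart unfolding is_chart_def by blast

lemma chart_domain: "c \<in> A \<Longrightarrow> openin (top_of_set X) (fst c)" "c \<in> A \<Longrightarrow> fst c \<subseteq> X"
proof -
  show "openin (top_of_set X) (fst c)" if "c \<in> A"
    using is_chart[OF that] unfolding is_chart_def by simp
  then show "fst c \<subseteq> X" if "c \<in> A"
    using openin_imp_subset that by blast
qed

lemma chart_covers:
  assumes "p \<in> X"
  obtains c where "c \<in> A" "p \<in> fst c"
  using manifold assms unfolding C1_manifold_def by blast

lemma chart_inv [simp]:
  assumes "c \<in> A"
  shows "p \<in> fst c \<Longrightarrow> chart_inv c (snd c p) = p"
    and "y \<in> snd c ` fst c \<Longrightarrow> snd c (chart_inv c y) = y"
    and "y \<in> snd c ` fst c \<Longrightarrow> chart_inv c y \<in> fst c"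
  using chart_homeomorphism[OF assms] unfolding homeomorphism_def
  by (auto simp: inv_into_into f_inv_into_f)

lemma chart_inj:
  assumes "c \<in> A" "p \<in> fst c" "q \<in> fst c" "snd c p = snd c q"
  shows "p = q"
proof -
  have "p = chart_inv c (snd c p)"
    using chart_inv(1)[OF assms(1,2)] by (rule sym)
  also have "\<dots> = q"
    unfolding assms(4) using chart_inv(1)[OF assms(1,3)] .
  finally show ?thesis .
qed

lemma continuous_chart:
  assumes "c \<in> A"
  shows "continuous_on (fst c) (snd c)" "continuous_on (snd c ` fst c) (chart_inv c)"
  using chart_homeomorphism[OF assms] unfolding homeomorphism_def by auto

lemma open_chart_image:
  assumes "c \<in> A" "openin (top_of_set X) U"
  shows "open (snd c ` (fst c \<inter> U))"
proof -
  have "openin (top_of_set (fst c)) (fst c \<inter> U)"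
  proof -
    obtain W where "open W" "U = X \<inter> W"
      using assms(2) unfolding openin_open by auto
    then show ?thesis
      using chart_domain(2)[OF assms(1)] by (intro openin_open[THEN iffD2] exI[of _ W]) auto
  qed
  then have "openin (top_of_set (snd c ` fst c)) (snd c ` (fst c \<inter> U))"
    using homeomorphism_imp_open_map[OF chart_homeomorphism[OF assms(1)]] by blast
  moreover have "open (snd c ` fst c)"
    using is_chart[OF assms(1)] unfolding is_chart_def by blast
  ultimately show ?thesis
    using openin_open_trans by blast
qed

lemma open_chart_image_Int: "c \<in> A \<Longrightarrow> d \<in> A \<Longrightarrow> open (snd c ` (fst c \<inter> fst d))"
  by (intro open_chart_image chart_domain)

lemma transition_C1:
  assumes "c \<in> A" "d \<in> A"
  shows "C1_on (snd c ` (fst c \<inter> fst d)) (snd d \<circ> chart_inv c)"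
  using manifold assms unfolding C1_manifold_def C1_compatible_def by blast

lemma push_components:
  assumes "c \<in> A" "d \<in> A" "p \<in> fst c" "p \<in> fst d"
  shows push_derivative: "(snd d \<circ> chart_inv c has_derivative push_components c d p) (at (snd c p))"
    and push_add: "push_components c d p (v + w) = push_components c d p v + push_components c d p w"
    and push_scale: "push_components c d p (k *s v) = k *s push_components c d p v"
  unfolding push_components_def
  using frechet_C1_on[OF transition_C1[OF assms(1,2)], of "snd c p"] assms(3,4) by simp_all

lemma push_scaleR:
  assumes "c \<in> A" "d \<in> A" "p \<in> fst c" "p \<in> fst d"
  shows "push_components c d p (r *\<^sub>R v) = r *\<^sub>R push_components c d p v"
  using has_derivative_bounded_linear[OF push_derivative[OF assms]]
  by (simp add: bounded_linear.linear linear_scale)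

lemma push_self:
  assumes "c \<in> A" "p \<in> fst c"
  shows "push_components c c p w = w"
proof -
  have "((\<lambda>x. x) has_derivative push_components c c p) (at (snd c p))"
    using has_derivative_transform_within_open[OF push_derivative[OF assms(1,1,2,2)], where s = "snd c ` fst c"]
      open_chart_image_Int[OF assms(1,1)] assms by auto
  then show ?thesis
    using has_derivative_unique[OF has_derivative_ident] by metis
qed

text \<open>The chain rule on the overlap of \<open>c\<close> and \<open>d\<close>, where the
  composite of the two transitions agrees near \<open>p\<close> with the direct one. This cocycle
  rule is what makes \<open>tangent_vec\<close> a consistent family.\<close>

lemma push_push:
  assumes "c \<in> A" "d \<in> A" "e \<in> A" "p \<in> fst c" "p \<in> fst d" "p \<in> fst e"
  shows "push_components d e p (push_components c d p w) = push_components c e p w"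
proof -
  have "((snd e \<circ> chart_inv d) \<circ> (snd d \<circ> chart_inv c) has_derivative
      push_components d e p \<circ> push_components c d p) (at (snd c p))"
    using push_derivative[of c d p] push_derivative[of d e p] assms
    by (intro diff_chain_at) auto
  then have "(snd e \<circ> chart_inv c has_derivative
      push_components d e p \<circ> push_components c d p) (at (snd c p))"
  proof (rule has_derivative_transform_within_open)
    show "open (snd c ` (fst c \<inter> fst d))"
      using assms by (intro open_chart_image_Int)
    show "((snd e \<circ> chart_inv d) \<circ> (snd d \<circ> chart_inv c)) y = (snd e \<circ> chart_inv c) y"
      if "y \<in> snd c ` (fst c \<inter> fst d)" for y
      using that assms by auto
  qed (use assms in auto)
  then have "push_components d e p \<circ> push_components c d p = push_components c e p"
    using has_derivative_unique push_derivative[OF assms(1,3,4,6)] by blast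
  then show ?thesis
    by (metis comp_apply)
qed

text \<open>For an admissible chart \<open>c\<close> around \<open>p\<close> this is inverse to
  evaluation at \<open>c\<close>, so coordinate vectors and tangent vectors at \<open>p\<close> are
  identified. The value 0 at other arguments follows the convention in
  \<open>tangent_space\<close>.\<close>

definition tangent_vec :: "('a, 'k, 'd) chart \<Rightarrow> 'a \<Rightarrow> 'k ^ 'd \<Rightarrow> ('a, 'k, 'd) tvec" where
  "tangent_vec c p w = (\<lambda>d. if d \<in> A \<and> p \<in> fst d then push_components c d p w else 0)"

lemma coord_vector_eq: "coord_vector A c i p = tangent_vec c p (axis i 1)"
  by (simp add: coord_vector_def tangent_vec_def)

lemma tangent_space_push:
  assumes "v \<in> tangent_space A p" "c \<in> A" "d \<in> A" "p \<in> fst c" "p \<in> fst d"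
  shows "v d = push_components c d p (v c)"
  using assms unfolding tangent_space_def by blast

lemma tangent_space_outside:
  assumes "v \<in> tangent_space A p" "\<not> (d \<in> A \<and> p \<in> fst d)"
  shows "v d = 0"
  using assms unfolding tangent_space_def by blast

lemma tangent_vec:
  assumes "c \<in> A" "p \<in> fst c"
  shows tangent_vec_in: "tangent_vec c p w \<in> tangent_space A p"
    and tangent_vec_chart: "tangent_vec c p w c = w"
    and tangent_vec_eq: "v \<in> tangent_space A p \<Longrightarrow> tangent_vec c p (v c) = v"
    and tangent_vec_add: "tangent_vec c p (w + w') = tangent_vec c p w + tangent_vec c p w'"
    and tangent_vec_scale: "tangent_vec c p (k *s w) = tscale k (tangent_vec c p w)"
proof -
  show "tangent_vec c p w \<in> tangent_space A p"
    unfolding tangent_space_def tangent_vec_def mem_Collect_eq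
  proof (intro conjI allI impI ballI)
    fix d e assume "d \<in> A" "e \<in> A" "p \<in> fst d \<and> p \<in> fst e"
    then show "(if e \<in> A \<and> p \<in> fst e then push_components c e p w else 0) =
        push_components d e p (if d \<in> A \<and> p \<in> fst d then push_components c d p w else 0)"
      using push_push[OF assms(1), of d e p w] assms(2) by simp
  qed (simp only: if_False)
  show "tangent_vec c p w c = w"
    using assms by (simp add: tangent_vec_def push_self)
  show "tangent_vec c p (v c) = v" if "v \<in> tangent_space A p"
  proof
    fix d
    show "tangent_vec c p (v c) d = v d"
    proof (cases "d \<in> A \<and> p \<in> fst d")
      case True
      then have "v d = push_components c d p (v c)"
        using tangent_space_push[OF that assms(1)] assms(2) by simp
      with True show ?thesis
        by (simp add: tangent_vec_def)
    next
      case False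
      then have "v d = 0"
        using tangent_space_outside[OF that] by simp
      with False show ?thesis
        unfolding tangent_vec_def by auto
    qed
  qed
  show "tangent_vec c p (w + w') = tangent_vec c p w + tangent_vec c p w'"
  proof
    show "tangent_vec c p (w + w') d = (tangent_vec c p w + tangent_vec c p w') d" for d
      using push_add[OF assms(1) _ assms(2), of d w w'] by (simp add: tangent_vec_def)
  qed
  show "tangent_vec c p (k *s w) = tscale k (tangent_vec c p w)"
  proof
    show "tangent_vec c p (k *s w) d = tscale k (tangent_vec c p w) d" for d
      using push_scale[OF assms(1) _ assms(2), of d k w] by (simp add: tangent_vec_def tscale_def)
  qed
qed

lemma tangent_eqI:
  assumes "c \<in> A" "p \<in> fst c" "v \<in> tangent_space A p" "w \<in> tangent_space A p" "v c = w c"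
  shows "v = w"
proof -
  have "v = tangent_vec c p (v c)"
    using tangent_vec_eq[OF assms(1-3)] by simp
  also have "\<dots> = w"
    unfolding assms(5) using tangent_vec_eq[OF assms(1,2,4)] .
  finally show ?thesis .
qed

lemma subspace_tangent_space:
  assumes "p \<in> X"
  shows "tvec.subspace (tangent_space A p)"
proof -
  obtain c where c: "c \<in> A" "p \<in> fst c"
    using chart_covers[OF assms] .
  have sub: "tangent_space A p = range (tangent_vec c p)"
  proof
    show "tangent_space A p \<subseteq> range (tangent_vec c p)"
      using tangent_vec_eq[OF c, symmetric] by (intro subsetI) (rule range_eqI)
  qed (use tangent_vec_in[OF c] in auto)
  have 0: "tangent_vec c p 0 = 0"
    using tangent_vec_add[OF c, of 0 0] by simp
  show ?thesis
    unfolding sub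
  proof (rule tvec.subspaceI)
    show "0 \<in> range (tangent_vec c p)"
      using rangeI[of "tangent_vec c p" 0] unfolding 0 .
  qed (auto simp flip: tangent_vec_add[OF c] tangent_vec_scale[OF c])
qed

subsection \<open>Paths\<close>

lemma C1_path_preimage:
  assumes "C1_path X A J \<gamma>" "openin (top_of_set X) U"
  obtains N where "open N" "J \<inter> \<gamma> -` U = J \<inter> N"
proof -
  have "openin (top_of_set J) (J \<inter> \<gamma> -` U)"
    using assms unfolding C1_path_def
    by (intro continuous_openin_preimage[where T = X]) auto
  then obtain N where "open N \<and> J \<inter> \<gamma> -` U = J \<inter> N"
    unfolding openin_open by (elim exE)
  then show thesis
    by (intro that[of N]) simp_all
qed

lemma C1_path_chart:
  assumes "C1_path X A J \<gamma>" "c \<in> A"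
  shows "\<exists>g. continuous_on (J \<inter> \<gamma> -` fst c) g \<and>
      (\<forall>s\<in>J \<inter> \<gamma> -` fst c. (snd c \<circ> \<gamma> has_vector_derivative g s) (at s within J))"
  using assms unfolding C1_path_def by simp

lemma C1_path_subset:
  assumes "C1_path X A J \<gamma>" "J' \<subseteq> J" "is_interval J'"
  shows "C1_path X A J' \<gamma>"
  unfolding C1_path_def
proof (intro conjI ballI assms(3))
  have \<gamma>: "\<gamma> ` J \<subseteq> X" "continuous_on J \<gamma>"
    using assms(1) unfolding C1_path_def by simp_all
  show "\<gamma> ` J' \<subseteq> X"
    using \<gamma>(1) assms(2) by blast
  show "continuous_on J' \<gamma>"
    using continuous_on_subset[OF \<gamma>(2) assms(2)] .
  fix c assume c: "c \<in> A"
  obtain g where g: "continuous_on (J \<inter> \<gamma> -` fst c) g \<and>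
      (\<forall>s\<in>J \<inter> \<gamma> -` fst c. (snd c \<circ> \<gamma> has_vector_derivative g s) (at s within J))"
    using C1_path_chart[OF assms(1) c] by (elim exE)
  have "continuous_on (J' \<inter> \<gamma> -` fst c) g"
    by (rule continuous_on_subset[OF conjunct1[OF g]]) (use assms(2) in auto)
  moreover have "(snd c \<circ> \<gamma> has_vector_derivative g s) (at s within J')" if "s \<in> J' \<inter> \<gamma> -` fst c" for s
    by (rule has_vector_derivative_within_subset[OF _ assms(2)]) (use g that assms(2) in auto)
  ultimately show "\<exists>g. continuous_on (J' \<inter> \<gamma> -` fst c) g \<and>
      (\<forall>s\<in>J' \<inter> \<gamma> -` fst c. (snd c \<circ> \<gamma> has_vector_derivative g s) (at s within J'))"
    by (intro exI[of _ g]) simp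
qed

lemma chart_change_derivative:
  assumes c: "c \<in> A" "\<delta> s \<in> fst c" and d: "d \<in> A" "\<delta> s \<in> fst d"
    and \<delta>: "\<delta> ` J \<subseteq> X" "continuous (at s within J) \<delta>" "s \<in> J"
    and der: "(snd c \<circ> \<delta> has_vector_derivative w) (at s within J)"
  shows "(snd d \<circ> \<delta> has_vector_derivative push_components c d (\<delta> s) w) (at s within J)"
proof -
  have "((snd d \<circ> chart_inv c) \<circ> (snd c \<circ> \<delta>) has_derivative
      push_components c d (\<delta> s) \<circ> (\<lambda>h. h *\<^sub>R w)) (at s within J)"
    using der has_derivative_at_withinI[OF push_derivative[OF c(1) d(1) c(2) d(2)]]
    unfolding has_vector_derivative_def by (intro diff_chain_within) simp_all
  then have "(snd d \<circ> \<delta> has_derivative push_components c d (\<delta> s) \<circ> (\<lambda>h. h *\<^sub>R w)) (at s within J)"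
  proof (rule has_derivative_transform_eventually)
    \<comment> \<open>The detour through \<open>c\<close> equals
      \<open>snd d \<circ> \<delta>\<close> only while \<delta> stays in the domain of
      \<open>c\<close>. That domain is relatively open, so continuity of \<delta> ensures this near
      \<open>s\<close>.\<close>
    obtain W where W: "open W" "fst c = X \<inter> W"
      using chart_domain(1)[OF c(1)] unfolding openin_open by (elim exE conjE) (rule that)
    have "\<forall>\<^sub>F t in at s within J. \<delta> t \<in> W"
      using topological_tendstoD[OF \<delta>(2)[unfolded continuous_within] W(1)] c(2) W(2) by simp
    moreover have "\<forall>\<^sub>F t in at s within J. t \<in> J"
      by (simp add: eventually_at_filter)
    ultimately have "\<forall>\<^sub>F t in at s within J. \<delta> t \<in> fst c"
      by eventually_elim (use \<delta>(1) W(2) in auto)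
    then show "\<forall>\<^sub>F t in at s within J. ((snd d \<circ> chart_inv c) \<circ> (snd c \<circ> \<delta>)) t = (snd d \<circ> \<delta>) t"
      by (rule eventually_mono) (simp add: c(1))
  qed (simp_all add: c \<delta>(3))
  moreover have "push_components c d (\<delta> s) \<circ> (\<lambda>h. h *\<^sub>R w) = (\<lambda>h. h *\<^sub>R push_components c d (\<delta> s) w)"
    by (simp add: fun_eq_iff push_scaleR[OF c(1) d(1) c(2) d(2)])
  ultimately show ?thesis
    unfolding has_vector_derivative_def by simp
qed

text \<open>One chart suffices, since the components of a tangent vector change from chart to chart
  by the same rule as derivatives along a path.\<close>

lemma has_velocity_chartI:
  assumes "c \<in> A" "\<delta> s \<in> fst c" "C1_path X A J \<delta>" "s \<in> J" "v \<in> tangent_space A (\<delta> s)"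
    and "(snd c \<circ> \<delta> has_vector_derivative v c) (at s within J)"
  shows "has_velocity A J \<delta> s v"
  unfolding has_velocity_def
proof (intro conjI ballI impI assms(5))
  fix d assume d: "d \<in> A" "\<delta> s \<in> fst d"
  have "v d = push_components c d (\<delta> s) (v c)"
    using tangent_space_push[OF assms(5,1) d(1) assms(2) d(2)] .
  then show "(snd d \<circ> \<delta> has_vector_derivative v d) (at s within J)"
    using assms d chart_change_derivative[of c \<delta> s d J "v c"]
    unfolding C1_path_def by (simp add: continuous_on_eq_continuous_within)
qed

text \<open>\<open>C1_path\<close> quantifies over all admissible charts, whereas paths are
  constructed below in one suitable chart near each parameter. Continuity is obtained through the
  inverse of that chart; the other charts are reached by pushing the derivative forward and
  gluing.\<close>

lemma C1_path_localI:
  assumes J: "is_interval J" and sub: "\<delta> ` J \<subseteq> X"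
    and loc: "\<And>s. s \<in> J \<Longrightarrow> \<exists>c\<in>A. \<exists>N g. open N \<and> s \<in> N \<and> \<delta> ` (J \<inter> N) \<subseteq> fst c \<and>
      continuous_on (J \<inter> N) g \<and>
      (\<forall>t\<in>J \<inter> N. (snd c \<circ> \<delta> has_vector_derivative g t) (at t within J))"
  shows "C1_path X A J \<delta>"
proof -
  have cont: "continuous_on J \<delta>"
    unfolding continuous_on_eq_continuous_within
  proof
    fix s assume s: "s \<in> J"
    obtain c N g where c: "c \<in> A" and N: "open N \<and> s \<in> N \<and> \<delta> ` (J \<inter> N) \<subseteq> fst c \<and>
      continuous_on (J \<inter> N) g \<and>
      (\<forall>t\<in>J \<inter> N. (snd c \<circ> \<delta> has_vector_derivative g t) (at t within J))"
      using loc[OF s] by (elim bexE exE)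
    have "continuous_on (J \<inter> N) (snd c \<circ> \<delta>)"
      unfolding continuous_on_eq_continuous_within
    proof
      fix t assume t: "t \<in> J \<inter> N"
      then have "continuous (at t within J) (snd c \<circ> \<delta>)"
        using N has_vector_derivative_continuous by blast
      then show "continuous (at t within J \<inter> N) (snd c \<circ> \<delta>)"
        by (rule continuous_within_subset) simp
    qed
    from continuous_on_compose2[OF continuous_chart(2)[OF c] this]
    have "continuous_on (J \<inter> N) (\<lambda>t. chart_inv c (snd c (\<delta> t)))"
      using N by auto
    moreover have "chart_inv c (snd c (\<delta> t)) = \<delta> t" if "t \<in> J \<inter> N" for t
      using N c that by auto
    ultimately have "continuous_on (J \<inter> N) \<delta>"
      by (rule continuous_on_eq)
    then show "continuous (at s within J) \<delta>"
      using N s by (intro continuous_on_Int_open_imp_continuous[of J N]) simp_all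
  qed
  show ?thesis
    unfolding C1_path_def
  proof (intro conjI J sub cont ballI)
    fix d assume d: "d \<in> A"
    have "openin (top_of_set J) (J \<inter> \<delta> -` fst d)"
      using cont sub chart_domain(1)[OF d] by (intro continuous_openin_preimage[where T = X]) auto
    then obtain N' where N': "open N'" "J \<inter> \<delta> -` fst d = J \<inter> N'"
      unfolding openin_open by auto
    show "\<exists>g. continuous_on (J \<inter> \<delta> -` fst d) g \<and>
        (\<forall>s\<in>J \<inter> \<delta> -` fst d. (snd d \<circ> \<delta> has_vector_derivative g s) (at s within J))"
    proof (rule vector_derivative_glue[OF J])
      fix s assume s: "s \<in> J \<inter> \<delta> -` fst d"
      then have "s \<in> J" by simp
      obtain c N g where c: "c \<in> A" and N: "open N \<and> s \<in> N \<and> \<delta> ` (J \<inter> N) \<subseteq> fst c \<and>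
        continuous_on (J \<inter> N) g \<and>
        (\<forall>t\<in>J \<inter> N. (snd c \<circ> \<delta> has_vector_derivative g t) (at t within J))"
        using loc[OF \<open>s \<in> J\<close>] by (elim bexE exE)
      let ?T = "J \<inter> \<delta> -` fst d \<inter> N"
      let ?g = "\<lambda>t. push_components c d (\<delta> t) (g t)"
      have T: "?T \<subseteq> J" "?T \<subseteq> J \<inter> N"
        by auto
      have sub: "\<delta> ` ?T \<subseteq> fst c \<inter> fst d"
        using N by auto
      have "continuous_on ?T (\<lambda>t. (snd c (\<delta> t), g t))"
        using N continuous_on_subset[OF cont T(1)] sub
        by (intro continuous_intros continuous_on_compose2[OF continuous_chart(1)[OF c]]
            continuous_on_subset[OF _ T(2), of g]) auto
      from continuous_on_compose2[OF C1_on_continuous_frechet[OF transition_C1[OF c d]] this]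
      have "continuous_on ?T ?g"
        using sub unfolding push_components_def by (simp add: image_subset_iff)
      moreover have "(snd d \<circ> \<delta> has_vector_derivative ?g t) (at t within J)" if "t \<in> ?T" for t
        using N that sub c d cont \<open>\<delta> ` J \<subseteq> X\<close>
        by (intro chart_change_derivative) (auto simp: continuous_on_eq_continuous_within)
      ultimately show "\<exists>N g. open N \<and> s \<in> N \<and> continuous_on (J \<inter> \<delta> -` fst d \<inter> N) g \<and>
          (\<forall>t\<in>J \<inter> \<delta> -` fst d \<inter> N. (snd d \<circ> \<delta> has_vector_derivative g t) (at t within J))"
        using N by (intro exI[of _ N] exI[of _ ?g]) simp
    qed simp
  qed
qed

text \<open>Coordinate lines realize prescribed velocities: below they produce the vertical vectors
  in the total space and arbitrary initial velocities in the base.\<close>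

lemma C1_path_line:
  assumes c: "c \<in> A" and J: "is_interval J" and sub: "\<And>t. t \<in> J \<Longrightarrow> y + t *\<^sub>R w \<in> snd c ` fst c"
  shows "C1_path X A J (\<lambda>t. chart_inv c (y + t *\<^sub>R w))"
    and "\<And>t. t \<in> J \<Longrightarrow>
      (snd c \<circ> (\<lambda>t. chart_inv c (y + t *\<^sub>R w)) has_vector_derivative w) (at t within J)"
proof -
  let ?\<delta> = "\<lambda>t. chart_inv c (y + t *\<^sub>R w)"
  show der: "(snd c \<circ> ?\<delta> has_vector_derivative w) (at t within J)" if "t \<in> J" for t
  proof (rule has_vector_derivative_transform[OF that])
    show "(snd c \<circ> ?\<delta>) t = y + t *\<^sub>R w" if "t \<in> J" for t
      using c sub[OF that] by simp
    show "((\<lambda>t. y + t *\<^sub>R w) has_vector_derivative w) (at t within J)"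
      by (auto intro!: derivative_eq_intros)
  qed
  show "C1_path X A J ?\<delta>"
  proof (rule C1_path_localI[OF J])
    show "?\<delta> ` J \<subseteq> X"
      using chart_inv(3)[OF c sub] chart_domain(2)[OF c] by auto
    show "\<exists>c\<in>A. \<exists>N g. open N \<and> s \<in> N \<and> ?\<delta> ` (J \<inter> N) \<subseteq> fst c \<and> continuous_on (J \<inter> N) g \<and>
        (\<forall>t\<in>J \<inter> N. (snd c \<circ> ?\<delta> has_vector_derivative g t) (at t within J))" for s
      using der chart_inv(3)[OF c sub]
      by (intro bexI[OF _ c] exI[of _ UNIV] exI[of _ "\<lambda>_. w"]) auto
  qed
qed

subsection \<open>Membership in the maximal atlas\<close>

lemma atlas_memI:
  assumes D: "D \<subseteq> X" "inj_on f D"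
    and loc: "\<And>p. p \<in> D \<Longrightarrow> \<exists>d\<in>A. \<exists>V V'. p \<in> fst d \<and>
      open V \<and> snd d p \<in> V \<and> V \<subseteq> snd d ` (D \<inter> fst d) \<and> C1_on V (f \<circ> chart_inv d) \<and>
      open V' \<and> f p \<in> V' \<and> V' \<subseteq> f ` (D \<inter> fst d) \<and> C1_on V' (snd d \<circ> inv_into D f)"
  shows "(D, f) \<in> A"
proof -
  have fi: "inv_into D f (f p) = p" if "p \<in> D" for p
    using D(2) that by simp
  have cover: "\<exists>T. openin (top_of_set X) T \<and> p \<in> T \<and> T \<subseteq> D \<and> continuous_on T f" if p: "p \<in> D" for p
  proof -
    obtain d V V' where d: "d \<in> A" and V: "p \<in> fst d \<and>
      open V \<and> snd d p \<in> V \<and> V \<subseteq> snd d ` (D \<inter> fst d) \<and> C1_on V (f \<circ> chart_inv d) \<and>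
      open V' \<and> f p \<in> V' \<and> V' \<subseteq> f ` (D \<inter> fst d) \<and> C1_on V' (snd d \<circ> inv_into D f)"
      using loc[OF p] by (elim bexE exE)
    \<comment> \<open>This set lies in \<open>D\<close> because every coordinate vector in
      \<open>V\<close> is attained on \<open>D\<close> and \<open>snd d\<close> is
      injective.\<close>
    let ?T = "fst d \<inter> snd d -` V"
    have "openin (top_of_set (fst d)) ?T"
      using continuous_chart(1)[OF d] V by (intro continuous_openin_preimage_gen) auto
    then have "openin (top_of_set X) ?T"
      using chart_domain(1)[OF d] openin_trans by blast
    moreover have "?T \<subseteq> D"
    proof
      fix q assume q: "q \<in> ?T"
      then obtain q' where "q' \<in> D \<inter> fst d" "snd d q = snd d q'"
        using V by auto
      then show "q \<in> D"
        using chart_inv(1)[OF d, of q] chart_inv(1)[OF d, of q'] q by auto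
    qed
    moreover have "continuous_on ?T f"
    proof -
      have "C1_on V (f \<circ> chart_inv d)"
        using V by simp
      from continuous_on_compose2[OF C1_on_imp_continuous_on[OF this]
          continuous_on_subset[OF continuous_chart(1)[OF d], of ?T]]
      have "continuous_on ?T (\<lambda>q. (f \<circ> chart_inv d) (snd d q))"
        by auto
      moreover have "(f \<circ> chart_inv d) (snd d q) = f q" if "q \<in> ?T" for q
        using that d by simp
      ultimately show ?thesis
        by (rule continuous_on_eq)
    qed
    ultimately show ?thesis
      using V by (intro exI[of _ ?T]) simp
  qed
  have openD: "openin (top_of_set X) D"
  proof (subst openin_subopen, intro ballI)
    fix p assume "p \<in> D"
    then show "\<exists>T. openin (top_of_set X) T \<and> p \<in> T \<and> T \<subseteq> D"
      using cover[of p] by auto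
  qed
  have open_im: "open (f ` D)"
  proof (subst open_subopen, intro ballI)
    fix y assume "y \<in> f ` D"
    then obtain p where p: "p \<in> D" "y = f p" by auto
    obtain d V V' where "d \<in> A" and V: "p \<in> fst d \<and>
      open V \<and> snd d p \<in> V \<and> V \<subseteq> snd d ` (D \<inter> fst d) \<and> C1_on V (f \<circ> chart_inv d) \<and>
      open V' \<and> f p \<in> V' \<and> V' \<subseteq> f ` (D \<inter> fst d) \<and> C1_on V' (snd d \<circ> inv_into D f)"
      using loc[OF p(1)] by (elim bexE exE)
    then show "\<exists>T. open T \<and> y \<in> T \<and> T \<subseteq> f ` D"
      unfolding p(2) using V by (intro exI[of _ V']) auto
  qed
  have contf: "continuous_on D f"
    unfolding continuous_on_eq_continuous_within
  proof
    fix p assume p: "p \<in> D"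
    obtain T where T: "openin (top_of_set X) T \<and> p \<in> T \<and> T \<subseteq> D \<and> continuous_on T f"
      using cover[OF p] by (elim exE)
    obtain N where N: "open N" "T = X \<inter> N"
      using T unfolding openin_open by auto
    then have "at p within D = at p within T"
      using T p D(1) by (intro at_within_nhd[where S = N]) auto
    then show "continuous (at p within D) f"
      using T by (auto simp: continuous_on_eq_continuous_within)
  qed
  have conti: "continuous_on (f ` D) (inv_into D f)"
  proof (rule continuous_at_imp_continuous_on, rule ballI)
    fix y assume "y \<in> f ` D"
    then obtain p where p: "p \<in> D" "y = f p" by auto
    obtain d V V' where d: "d \<in> A" and V: "p \<in> fst d \<and>
      open V \<and> snd d p \<in> V \<and> V \<subseteq> snd d ` (D \<inter> fst d) \<and> C1_on V (f \<circ> chart_inv d) \<and>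
      open V' \<and> f p \<in> V' \<and> V' \<subseteq> f ` (D \<inter> fst d) \<and> C1_on V' (snd d \<circ> inv_into D f)"
      using loc[OF p(1)] by (elim bexE exE)
    then have inD: "inv_into D f z \<in> D \<inter> fst d" if "z \<in> V'" for z
      using fi that by auto
    have "C1_on V' (snd d \<circ> inv_into D f)"
      using V by simp
    from continuous_on_compose2[OF continuous_chart(2)[OF d] C1_on_imp_continuous_on[OF this]]
    have "continuous_on V' (\<lambda>z. chart_inv d ((snd d \<circ> inv_into D f) z))"
      using inD by auto
    moreover have "chart_inv d ((snd d \<circ> inv_into D f) z) = inv_into D f z" if "z \<in> V'" for z
      using inD[OF that] d by simp
    ultimately have "continuous_on V' (inv_into D f)"
      by (rule continuous_on_eq)
    then show "isCont (inv_into D f) y"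
      using V p by (simp add: continuous_on_eq_continuous_at)
  qed
  have "is_chart X (D, f)"
    unfolding is_chart_def homeomorphism_def
    using openD open_im contf conti fi inv_into_image_cancel[OF D(2) subset_refl]
    by (simp add: inv_into_into)
  moreover have "C1_compatible (D, f) e" if e: "e \<in> A" for e
    unfolding C1_compatible_def fst_conv snd_conv
  proof
    show "C1_on (f ` (D \<inter> fst e)) (snd e \<circ> inv_into D f)"
    proof (rule C1_on_local)
      fix y assume "y \<in> f ` (D \<inter> fst e)"
      then obtain p where p: "p \<in> D" "p \<in> fst e" "y = f p" by auto
      obtain d V V' where d: "d \<in> A" and V: "p \<in> fst d \<and>
        open V \<and> snd d p \<in> V \<and> V \<subseteq> snd d ` (D \<inter> fst d) \<and> C1_on V (f \<circ> chart_inv d) \<and>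
        open V' \<and> f p \<in> V' \<and> V' \<subseteq> f ` (D \<inter> fst d) \<and> C1_on V' (snd d \<circ> inv_into D f)"
        using loc[OF p(1)] by (elim bexE exE)
      then have inD: "inv_into D f z \<in> D \<inter> fst d" if "z \<in> V'" for z
        using fi that by auto
      \<comment> \<open>On this set the change of coordinates from \<open>f\<close> to
        \<open>e\<close> factors through \<open>d\<close>.\<close>
      let ?T = "V' \<inter> (snd d \<circ> inv_into D f) -` (snd d ` (fst d \<inter> fst e))"
      have oT: "open ?T"
        using V open_chart_image_Int[OF d e] C1_on_imp_continuous_on[of V' "snd d \<circ> inv_into D f"]
        by (intro continuous_open_preimage) auto
      have "C1_on V' (snd d \<circ> inv_into D f)"
        using V by (elim conjE)
      from C1_on_subset[OF this Int_lower1] have "C1_on ?T (snd d \<circ> inv_into D f)" .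
      from C1_on_compose[OF this transition_C1[OF d e]]
      have "C1_on ?T ((snd e \<circ> chart_inv d) \<circ> (snd d \<circ> inv_into D f))"
        by blast
      then have "C1_on ?T (snd e \<circ> inv_into D f)"
      proof (rule C1_on_cong[OF _ oT])
        fix z assume "z \<in> ?T"
        then have "inv_into D f z \<in> fst d"
          using inD by blast
        then show "((snd e \<circ> chart_inv d) \<circ> (snd d \<circ> inv_into D f)) z = (snd e \<circ> inv_into D f) z"
          by (simp add: chart_inv(1)[OF d])
      qed
      moreover have "y \<in> ?T"
        using V p by (simp add: fi)
      ultimately show "\<exists>T. open T \<and> y \<in> T \<and> C1_on T (snd e \<circ> inv_into D f)"
        using oT by (intro exI[of _ ?T] conjI)
    qed
    show "C1_on (snd e ` (D \<inter> fst e)) (f \<circ> chart_inv e)"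
    proof (rule C1_on_local)
      fix y assume "y \<in> snd e ` (D \<inter> fst e)"
      then obtain p where p: "p \<in> D" "p \<in> fst e" "y = snd e p" by auto
      obtain d V V' where d: "d \<in> A" and V: "p \<in> fst d \<and>
        open V \<and> snd d p \<in> V \<and> V \<subseteq> snd d ` (D \<inter> fst d) \<and> C1_on V (f \<circ> chart_inv d) \<and>
        open V' \<and> f p \<in> V' \<and> V' \<subseteq> f ` (D \<inter> fst d) \<and> C1_on V' (snd d \<circ> inv_into D f)"
        using loc[OF p(1)] by (elim bexE exE)
      let ?T = "snd e ` (fst e \<inter> fst d) \<inter> (snd d \<circ> chart_inv e) -` V"
      have oT: "open ?T"
        using V open_chart_image_Int[OF e d] C1_on_imp_continuous_on[OF transition_C1[OF e d]]
        by (intro continuous_open_preimage) auto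
      have "C1_on ?T (snd d \<circ> chart_inv e)"
        by (rule C1_on_subset[OF transition_C1[OF e d] Int_lower1])
      moreover have "C1_on V (f \<circ> chart_inv d)"
        using V by (elim conjE)
      ultimately have "C1_on ?T ((f \<circ> chart_inv d) \<circ> (snd d \<circ> chart_inv e))"
        by (rule C1_on_compose) blast
      then have "C1_on ?T (f \<circ> chart_inv e)"
      proof (rule C1_on_cong[OF _ oT])
        fix z assume "z \<in> ?T"
        then obtain q where q: "q \<in> fst e" "q \<in> fst d" "z = snd e q"
          by blast
        then show "((f \<circ> chart_inv d) \<circ> (snd d \<circ> chart_inv e)) z = (f \<circ> chart_inv e) z"
          by (simp add: chart_inv(1)[OF d] chart_inv(1)[OF e])
      qed
      moreover have "y \<in> ?T"
        using V p e by simp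
      ultimately show "\<exists>T. open T \<and> y \<in> T \<and> C1_on T (f \<circ> chart_inv e)"
        using oT by (intro exI[of _ ?T] conjI)
    qed
  qed
  ultimately show ?thesis
    using manifold unfolding C1_manifold_def by blast
qed

end

subsection \<open>Coordinates on products\<close>

definition lft :: "'k ^ ('n::finite + 'r::finite) \<Rightarrow> 'k ^ 'n" where "lft v = (\<chi> \<mu>. v $ Inl \<mu>)"
definition rgt :: "'k ^ ('n::finite + 'r::finite) \<Rightarrow> 'k ^ 'r" where "rgt v = (\<chi> a. v $ Inr a)"

lemma lft_nth [simp]: "lft v $ i = v $ Inl i" and rgt_nth [simp]: "rgt v $ j = v $ Inr j"
  by (simp_all add: lft_def rgt_def)

lemma join_nth [simp]: "join x y $ Inl i = x $ i" "join x y $ Inr j = y $ j"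
  by (simp_all add: join_def)

lemma lft_join [simp]: "lft (join x y) = x" and rgt_join [simp]: "rgt (join x y) = y"
  by (simp_all add: vec_eq_iff)

lemma vec_sum_eq_iff: "v = w \<longleftrightarrow> (\<forall>i. v $ Inl i = w $ Inl i) \<and> (\<forall>j. v $ Inr j = w $ Inr j)"
  for v w :: "'k ^ ('n::finite + 'r::finite)"
  by (simp add: vec_eq_iff split_sum_all)

lemma eq_join_iff: "v = join x y \<longleftrightarrow> lft v = x \<and> rgt v = y"
  by (auto simp: vec_sum_eq_iff vec_eq_iff)

lemma join_eq_iff [simp]: "join x y = join x' y' \<longleftrightarrow> x = x' \<and> y = y'"
  by (simp add: eq_join_iff)

lemma join_lft_rgt [simp]: "join (lft v) (rgt v) = v"
  using eq_join_iff[of v "lft v" "rgt v"] by simp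

lemma lft_arith [simp]: "lft (v + w) = lft v + lft w" "lft (k *s u) = k *s lft u"
    "lft (v - w) = lft v - lft w" "lft (0 :: 'b::ab_group_add ^ ('n::finite + 'r::finite)) = 0"
  and rgt_arith [simp]: "rgt (v + w) = rgt v + rgt w" "rgt (k *s u) = k *s rgt u"
    "rgt (v - w) = rgt v - rgt w" "rgt (0 :: 'b::ab_group_add ^ ('n::finite + 'r::finite)) = 0"
  for v w :: "'b::ab_group_add ^ ('n::finite + 'r::finite)" and u :: "'c::times ^ ('n::finite + 'r::finite)"
  by (simp_all add: vec_eq_iff)

lemma bounded_linear_lft: "bounded_linear (lft :: 'k::euclidean_space ^ ('n::finite + 'r::finite) \<Rightarrow> _)"
  and bounded_linear_rgt: "bounded_linear (rgt :: 'k::euclidean_space ^ ('n::finite + 'r::finite) \<Rightarrow> _)"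
  by (auto intro!: linearI linear_bounded simp: vec_eq_iff simp flip: linear_conv_bounded_linear)

lemma has_vector_derivative_join:
  fixes f :: "real \<Rightarrow> 'k::euclidean_space ^ 'n::finite" and g :: "real \<Rightarrow> 'k ^ 'r::finite"
  assumes "(f has_vector_derivative f') F" "(g has_vector_derivative g') F"
  shows "((\<lambda>t. join (f t) (g t)) has_vector_derivative join f' g') F"
proof -
  have l: "bounded_linear (\<lambda>x :: 'k ^ 'n. join x (0 :: 'k ^ 'r))"
    "bounded_linear (\<lambda>y :: 'k ^ 'r. join (0 :: 'k ^ 'n) y)"
    by (auto intro!: linearI simp: vec_sum_eq_iff simp flip: linear_conv_bounded_linear)
  have eq: "join x y = join x 0 + join 0 y" for x :: "'k ^ 'n" and y :: "'k ^ 'r"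
    by (simp add: vec_sum_eq_iff)
  show ?thesis
    using has_vector_derivative_add[OF bounded_linear.has_vector_derivative[OF l(1) assms(1)]
        bounded_linear.has_vector_derivative[OF l(2) assms(2)]]
    unfolding eq[symmetric] .
qed

lemma continuous_on_join:
  fixes f :: "'a::topological_space \<Rightarrow> 'k::topological_space ^ 'n::finite" and g :: "'a \<Rightarrow> 'k ^ 'r::finite"
  assumes "continuous_on S f" "continuous_on S g"
  shows "continuous_on S (\<lambda>t. join (f t) (g t))"
  unfolding join_def
proof (rule continuous_on_vec_lambda)
  show "continuous_on S (\<lambda>t. case i of Inl \<mu> \<Rightarrow> f t $ \<mu> | Inr a \<Rightarrow> g t $ a)" for i
    by (cases i) (auto intro!: continuous_intros assms)
qed

lemma C1_wrt_component: "C1_wrt (\<lambda>j h. h $ j) S (\<lambda>v. (v :: 'k::real_normed_field ^ 'd) $ i)"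
proof (rule C1_wrtI)
  show "continuous_on S (\<lambda>v. if j = i then 1 else 0 :: 'k)" for j
    by simp
  have "(\<lambda>h. \<Sum>j\<in>UNIV. (if j = i then 1 else 0) * h $ j) = (\<lambda>h :: 'k ^ 'd. h $ i)"
    by (simp add: if_distrib[of "\<lambda>z. z * _"] cong: if_cong)
  then show "((\<lambda>v. v $ i) has_derivative (\<lambda>h. \<Sum>j\<in>UNIV. (if j = i then 1 else 0) * h $ j)) (at x within S)"
    for x :: "'k ^ 'd"
    by (simp add: bounded_linear_imp_has_derivative bounded_linear_vec_nth)
qed

lemma C1_on_lft: "open S \<Longrightarrow> C1_on S lft"
  by (simp add: C1_on_componentwise C1_wrt_component)

lemma open_lft_vimage:
  fixes T :: "('k::euclidean_space ^ 'n::finite) set"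
  assumes "open T"
  shows "open (lft -` T :: ('k ^ ('n + 'r::finite)) set)"
  using open_vimage[OF assms linear_continuous_on[OF bounded_linear_lft]] .

text \<open>Lets C1 functions of the base coordinates be used as coefficients in formulas on the
  total space.\<close>

lemma C1_wrt_lft_compose:
  assumes "C1_on T h" "open S" "\<And>v. v \<in> S \<Longrightarrow> lft v \<in> T"
  shows "C1_wrt (\<lambda>j w. w $ j) S (\<lambda>v. h (lft v) $ i)"
proof -
  have "C1_on S (h \<circ> lft)"
    using C1_on_compose[OF C1_on_lft[OF assms(2)] assms(1)] assms(3) by auto
  then show ?thesis
    using C1_on_componentwise[OF assms(2), of "h \<circ> lft"] by simp
qed

subsection \<open>Vector bundles\<close>

text \<open>The enumeration chosen in \<open>lincomb\<close> depends on the index type alone. Fixing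
  it once for all coefficients and vectors allows induction along the list.\<close>

lemma lincomb_foldr:
  fixes B :: "('e, 'm, 'k, 'n::finite, 'r::finite) vbundle"
  obtains as where "distinct as" "set as = (UNIV :: 'r set)"
    "\<And>k f. lincomb B x k f = foldr (\<lambda>a q. fadd B (fscale B (k $ a) (f a)) q) as (fzero B x)"
proof -
  let ?as = "SOME as. distinct as \<and> set as = (UNIV :: 'r set)"
  have "\<exists>as. distinct as \<and> set as = (UNIV :: 'r set)"
    using finite_distinct_list[of "UNIV :: 'r set"] by auto
  from someI_ex[OF this] show thesis
    by (intro that[of ?as]) (auto simp: lincomb_def)
qed

locale C1_vbundle =
  fixes B :: "('e::t2_space, 'm::t2_space, 'k::{real_normed_field,euclidean_space},
    'n::finite, 'r::finite) vbundle"
  assumes vector_bundle: "vector_bundle B"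

sublocale C1_vbundle \<subseteq> base: C1_mfd "base_space B" "base_atlas B"
  using vector_bundle unfolding vector_bundle_def by unfold_locales (elim conjE)

sublocale C1_vbundle \<subseteq> total: C1_mfd "total_space B" "total_atlas B"
  using vector_bundle unfolding vector_bundle_def by unfold_locales (elim conjE)

context C1_vbundle
begin

lemma fibre_iff: "p \<in> fibre B x \<longleftrightarrow> p \<in> total_space B \<and> proj B p = x"
  by (auto simp: fibre_def)

lemma proj_base: "p \<in> total_space B \<Longrightarrow> proj B p \<in> base_space B"
  using vector_bundle unfolding vector_bundle_def by blast

lemma fibre_ops:
  assumes "x \<in> base_space B"
  shows "fzero B x \<in> fibre B x"
    and "p \<in> fibre B x \<Longrightarrow> q \<in> fibre B x \<Longrightarrow> fadd B p q \<in> fibre B x"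
    and "p \<in> fibre B x \<Longrightarrow> fscale B k p \<in> fibre B x"
    and "p \<in> fibre B x \<Longrightarrow> fadd B (fzero B x) p = p"
proof -
  have "vector_space_axioms_on (fibre B x) (fadd B) (fzero B x) (fscale B)"
    using assms vector_bundle unfolding vector_bundle_def by blast
  then show "fzero B x \<in> fibre B x"
    and "p \<in> fibre B x \<Longrightarrow> q \<in> fibre B x \<Longrightarrow> fadd B p q \<in> fibre B x"
    and "p \<in> fibre B x \<Longrightarrow> fscale B k p \<in> fibre B x"
    and "p \<in> fibre B x \<Longrightarrow> fadd B (fzero B x) p = p"
    unfolding vector_space_axioms_on_def by blast+
qed

definition triv_chart :: "('m, 'k, 'n) chart \<Rightarrow> ('e \<Rightarrow> 'k ^ 'r) \<Rightarrow> ('e, 'k, 'n + 'r) chart" where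
  "triv_chart c \<psi> =
     ({p \<in> total_space B. proj B p \<in> fst c}, \<lambda>p. join (snd c (proj B p)) (\<psi> p))"

definition trivialization :: "('m, 'k, 'n) chart \<Rightarrow> ('e \<Rightarrow> 'k ^ 'r) \<Rightarrow> bool" where
  "trivialization c \<psi> \<longleftrightarrow> c \<in> base_atlas B \<and> triv_chart c \<psi> \<in> total_atlas B \<and>
     (\<forall>y\<in>fst c. \<forall>p\<in>fibre B y. \<forall>q\<in>fibre B y. \<forall>k.
        \<psi> (fadd B p q) = \<psi> p + \<psi> q \<and> \<psi> (fscale B k p) = k *s \<psi> p) \<and>
     snd (triv_chart c \<psi>) ` fst (triv_chart c \<psi>) = {join y z | y z. y \<in> snd c ` fst c}"

lemma trivialization_exists:
  assumes "x \<in> base_space B"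
  obtains c \<psi> where "trivialization c \<psi>" "x \<in> fst c"
proof -
  have "\<forall>x\<in>base_space B. \<exists>c\<in>base_atlas B. \<exists>\<psi> :: 'e \<Rightarrow> 'k ^ 'r.
        let W = {p \<in> total_space B. proj B p \<in> fst c};
            \<Phi> = (\<lambda>p. join (snd c (proj B p)) (\<psi> p))
        in x \<in> fst c \<and>
           (\<forall>y\<in>fst c. \<forall>p\<in>fibre B y. \<forall>q\<in>fibre B y. \<forall>k.
              \<psi> (fadd B p q) = \<psi> p + \<psi> q \<and> \<psi> (fscale B k p) = k *s \<psi> p) \<and>
           (W, \<Phi>) \<in> total_atlas B \<and>
           \<Phi> ` W = {join y z | y z. y \<in> snd c ` fst c}"
    using vector_bundle unfolding vector_bundle_def by (elim conjE)
  from bspec[OF this assms] obtain c \<psi> where c: "c \<in> base_atlas B" and *: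
      "let W = {p \<in> total_space B. proj B p \<in> fst c};
            \<Phi> = (\<lambda>p. join (snd c (proj B p)) (\<psi> p))
        in x \<in> fst c \<and>
           (\<forall>y\<in>fst c. \<forall>p\<in>fibre B y. \<forall>q\<in>fibre B y. \<forall>k.
              \<psi> (fadd B p q) = \<psi> p + \<psi> q \<and> \<psi> (fscale B k p) = k *s \<psi> p) \<and>
           (W, \<Phi>) \<in> total_atlas B \<and>
           \<Phi> ` W = {join y z | y z. y \<in> snd c ` fst c}"
    by (elim bexE exE)
  show thesis
  proof (rule that[of c \<psi>])
    show "trivialization c \<psi>" "x \<in> fst c"
      using c * unfolding trivialization_def triv_chart_def Let_def fst_conv snd_conv by simp_all
  qed
qed

lemma trivialization:
  assumes "trivialization c \<psi>"
  shows triv_base: "c \<in> base_atlas B"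
    and triv_total: "triv_chart c \<psi> \<in> total_atlas B"
    and triv_add: "y \<in> fst c \<Longrightarrow> p \<in> fibre B y \<Longrightarrow> q \<in> fibre B y \<Longrightarrow> \<psi> (fadd B p q) = \<psi> p + \<psi> q"
    and triv_scale: "y \<in> fst c \<Longrightarrow> p \<in> fibre B y \<Longrightarrow> \<psi> (fscale B k p) = k *s \<psi> p"
    and triv_image: "snd (triv_chart c \<psi>) ` fst (triv_chart c \<psi>) = {join y z | y z. y \<in> snd c ` fst c}"
  using assms unfolding trivialization_def by blast+

lemma fst_triv_chart: "p \<in> fst (triv_chart c \<psi>) \<longleftrightarrow> p \<in> total_space B \<and> proj B p \<in> fst c"
  and snd_triv_chart: "snd (triv_chart c \<psi>) p = join (snd c (proj B p)) (\<psi> p)"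
  by (simp_all add: triv_chart_def)

text \<open>The trivialization chart maps onto a full product, so a point with these coordinates
  exists; injectivity of the base chart puts it in the right fibre.\<close>

lemma triv_point:
  assumes tr: "trivialization c \<psi>" and y: "y \<in> fst c"
  shows "\<exists>p\<in>fibre B y. \<psi> p = z"
proof -
  have "join (snd c y) z \<in> snd (triv_chart c \<psi>) ` fst (triv_chart c \<psi>)"
    unfolding triv_image[OF tr] using y by auto
  then obtain p where p: "p \<in> fst (triv_chart c \<psi>)" "join (snd c (proj B p)) (\<psi> p) = join (snd c y) z"
    unfolding snd_triv_chart by (metis (no_types, lifting) imageE snd_triv_chart)
  have "snd c (proj B p) = snd c y \<and> \<psi> p = z"
    using p(2)[symmetric] unfolding eq_join_iff by simp
  moreover from this have "proj B p = y"
    using base.chart_inj[OF triv_base[OF tr]] p(1) y unfolding fst_triv_chart by blast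
  ultimately show ?thesis
    using p(1) by (auto simp: fst_triv_chart fibre_iff)
qed

lemma triv_inj:
  assumes tr: "trivialization c \<psi>" and y: "y \<in> fst c" and p: "p \<in> fibre B y" "q \<in> fibre B y" "\<psi> p = \<psi> q"
  shows "p = q"
proof -
  have "p \<in> fst (triv_chart c \<psi>)" "q \<in> fst (triv_chart c \<psi>)"
    "snd (triv_chart c \<psi>) p = snd (triv_chart c \<psi>) q"
    using p y by (auto simp: fst_triv_chart snd_triv_chart fibre_iff)
  then show ?thesis
    by (rule total.chart_inj[OF triv_total[OF tr]])
qed

lemma triv_zero:
  assumes tr: "trivialization c \<psi>" and y: "y \<in> fst c"
  shows "\<psi> (fzero B y) = 0"
proof -
  have yb: "y \<in> base_space B"
    using base.chart_domain(2)[OF triv_base[OF tr]] y by blast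
  have "\<psi> (fzero B y) = \<psi> (fadd B (fzero B y) (fzero B y))"
    using fibre_ops(4)[OF yb fibre_ops(1)[OF yb]] by simp
  also have "\<dots> = \<psi> (fzero B y) + \<psi> (fzero B y)"
    using triv_add[OF tr y] fibre_ops(1)[OF yb] by blast
  finally show ?thesis
    by simp
qed

text \<open>Under a trivialization the iterated addition becomes a sum in \<open>'k ^ 'r\<close>,
  where the order of the enumeration disappears.\<close>

lemma lincomb:
  assumes x: "x \<in> base_space B" and f: "\<And>a. f a \<in> fibre B x"
  shows lincomb_in_fibre: "lincomb B x k f \<in> fibre B x"
    and triv_lincomb: "trivialization c \<psi> \<Longrightarrow> x \<in> fst c \<Longrightarrow>
      \<psi> (lincomb B x k f) = (\<chi> b a. \<psi> (f a) $ b) *v k"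
proof -
  obtain as where as: "distinct as" "set as = (UNIV :: 'r set)" and lc: "\<And>k f. lincomb B x k f =
      foldr (\<lambda>a q. fadd B (fscale B (k $ a) (f a)) q) as (fzero B x)"
    using lincomb_foldr[of B x] by blast
  let ?F = "\<lambda>as. foldr (\<lambda>a q. fadd B (fscale B (k $ a) (f a)) q) as (fzero B x)"
  have lin: "lincomb B x k f = ?F as"
    by (rule lc)
  have F: "?F bs \<in> fibre B x" for bs
    by (induction bs) (auto intro!: fibre_ops[OF x] f)
  then show "lincomb B x k f \<in> fibre B x"
    unfolding lin .
  assume tr: "trivialization c \<psi>" "x \<in> fst c"
  have "\<psi> (?F bs) = (\<Sum>a\<leftarrow>bs. k $ a *s \<psi> (f a))" for bs
    by (induction bs)
      (simp_all add: triv_zero[OF tr] triv_add[OF tr] triv_scale[OF tr] F f fibre_ops[OF x])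
  then have "\<psi> (lincomb B x k f) = (\<Sum>a\<in>UNIV. k $ a *s \<psi> (f a))"
    unfolding lin using as by (simp add: sum_list_distinct_conv_sum_set)
  then show "\<psi> (lincomb B x k f) = (\<chi> b a. \<psi> (f a) $ b) *v k"
    by (simp add: vec_eq_iff matrix_mult_component mult.commute)
qed

end

subsection \<open>Frames\<close>

locale C1_frame = C1_vbundle B
  for B :: "('e::t2_space, 'm::t2_space, 'k::{real_normed_field,euclidean_space},
    'n::finite, 'r::finite) vbundle" +
  fixes U :: "'m set" and e :: "'r \<Rightarrow> 'm \<Rightarrow> 'e"
  assumes frame: "frame B U e"
begin

lemma openin_frame: "openin (top_of_set (base_space B)) U"
  using frame unfolding frame_def by (elim conjE)

lemma frame_base: "x \<in> U \<Longrightarrow> x \<in> base_space B"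
  using openin_imp_subset[OF openin_frame] by blast

lemma frame_basis: "x \<in> U \<Longrightarrow> fibre_basis B x (\<lambda>a. e a x)"
  using frame unfolding frame_def by blast

lemma frame_fibre: "x \<in> U \<Longrightarrow> e a x \<in> fibre B x"
  using frame_basis unfolding fibre_basis_def by blast

abbreviation fc :: "'e \<Rightarrow> 'k ^ 'r" where "fc \<equiv> frame_components B e"

lemma frame_expansion_unique:
  assumes "x \<in> U" "p \<in> fibre B x"
  shows "\<exists>!k. p = lincomb B x k (\<lambda>a. e a x)"
  using frame_basis[OF assms(1)] assms(2) unfolding fibre_basis_def by blast

lemma frame_expansion:
  assumes "x \<in> U" "p \<in> fibre B x"
  shows "p = lincomb B x (fc p) (\<lambda>a. e a x)"
proof -
  have "proj B p = x"
    using assms(2) by (simp add: fibre_iff)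
  then show ?thesis
    using theI'[OF frame_expansion_unique[OF assms]] unfolding frame_components_def by simp
qed

lemma frame_components_lincomb:
  assumes "x \<in> U"
  shows "fc (lincomb B x k (\<lambda>a. e a x)) = k"
proof -
  have "lincomb B x k (\<lambda>a. e a x) \<in> fibre B x"
    using assms by (intro lincomb_in_fibre frame_base frame_fibre)
  from frame_expansion_unique[OF assms this] frame_expansion[OF assms this] show ?thesis
    by auto
qed

lemma frame_components_surj:
  assumes "x \<in> U"
  shows "\<exists>p\<in>fibre B x. fc p = k"
  using frame_components_lincomb[OF assms, of k] assms
  by (intro bexI[of _ "lincomb B x k (\<lambda>a. e a x)"] lincomb_in_fibre frame_base frame_fibre)

lemma frame_components_inj:
  assumes "x \<in> U" "p \<in> fibre B x" "q \<in> fibre B x" "fc p = fc q"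
  shows "p = q"
proof -
  have "p = lincomb B x (fc p) (\<lambda>a. e a x)"
    using frame_expansion[OF assms(1,2)] .
  also have "\<dots> = q"
    unfolding assms(4) using frame_expansion[OF assms(1,3)] by (rule sym)
  finally show ?thesis .
qed

text \<open>The change of basis from frame components to the fibre coordinates of a trivialization.
  Regularity of a frame is expressed in charts of the total space; this matrix carries it over to
  frame components.\<close>

definition triv_matrix :: "('e \<Rightarrow> 'k ^ 'r) \<Rightarrow> 'm \<Rightarrow> 'k ^ 'r ^ 'r" where
  "triv_matrix \<psi> x = (\<chi> b a. \<psi> (e a x) $ b)"

text \<open>Invertibility expresses the uniqueness of frame expansions: it makes multiplication by
  the matrix injective, which suffices as the matrix is square.\<close>

lemma triv_matrix:
  assumes tr: "trivialization c \<psi>" and x: "x \<in> U" "x \<in> fst c"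
  shows triv_matrix_mult: "p \<in> fibre B x \<Longrightarrow> triv_matrix \<psi> x *v fc p = \<psi> p"
    and invertible_triv_matrix: "invertible (triv_matrix \<psi> x)"
proof -
  have lc: "\<psi> (lincomb B x k (\<lambda>a. e a x)) = triv_matrix \<psi> x *v k" for k
    unfolding triv_matrix_def
    by (rule triv_lincomb[OF frame_base[OF x(1)] frame_fibre[OF x(1)] tr x(2)])
  show "triv_matrix \<psi> x *v fc p = \<psi> p" if "p \<in> fibre B x" for p
    using lc[of "fc p"] frame_expansion[OF x(1) that] by simp
  have "inj ((*v) (triv_matrix \<psi> x))"
  proof (rule injI)
    fix k l assume "triv_matrix \<psi> x *v k = triv_matrix \<psi> x *v l"
    then have "\<psi> (lincomb B x k (\<lambda>a. e a x)) = \<psi> (lincomb B x l (\<lambda>a. e a x))"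
      by (simp add: lc)
    then have "lincomb B x k (\<lambda>a. e a x) = lincomb B x l (\<lambda>a. e a x)"
      using x by (intro triv_inj[OF tr x(2)] lincomb_in_fibre frame_base frame_fibre)
    then show "k = l"
      using frame_components_lincomb[OF x(1)] by metis
  qed
  then show "invertible (triv_matrix \<psi> x)"
    by (simp add: invertible_left_inverse matrix_left_invertible_injective)
qed

lemma frame_components_eqI:
  assumes "trivialization c \<psi>" "x \<in> U" "x \<in> fst c" "p \<in> fibre B x" "triv_matrix \<psi> x *v k = \<psi> p"
  shows "fc p = k"
  using inj_matrix_vector_mult[OF invertible_triv_matrix[OF assms(1-3)]]
    triv_matrix_mult[OF assms(1-4)] assms(5) unfolding inj_def by metis

text \<open>Frame components are given by a definite description; their linearity is read off in a
  trivialization, whose fibre part is linear and related to them by an invertible matrix.\<close>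

lemma frame_components_linear:
  assumes x: "x \<in> U"
  shows fc_add: "p \<in> fibre B x \<Longrightarrow> q \<in> fibre B x \<Longrightarrow> fc (fadd B p q) = fc p + fc q"
    and fc_scale: "p \<in> fibre B x \<Longrightarrow> fc (fscale B k p) = k *s fc p"
proof -
  obtain c \<psi> where tr: "trivialization c \<psi>" "x \<in> fst c"
    using trivialization_exists[OF frame_base[OF x]] .
  note fcI = frame_components_eqI[OF tr(1) x tr(2)]
  note mult = triv_matrix_mult[OF tr(1) x tr(2)]
  show "fc (fadd B p q) = fc p + fc q" if "p \<in> fibre B x" "q \<in> fibre B x"
    using that
    by (intro fcI fibre_ops frame_base[OF x])
      (simp_all add: matrix_vector_right_distrib mult triv_add[OF tr])
  show "fc (fscale B k p) = k *s fc p" if "p \<in> fibre B x"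
    using that
    by (intro fcI fibre_ops frame_base[OF x]) (simp_all add: vector_scalar_commute mult triv_scale[OF tr])
qed

lemma fibre_linear_matrix:
  assumes T: "fibre_linear B x y T" and x: "x \<in> U" and y: "y \<in> U" and p: "p \<in> fibre B x"
  shows "fc (T p) = (\<chi> b a. fc (T (e a x)) $ b) *v fc p"
proof -
  have Tf: "T q \<in> fibre B y" if "q \<in> fibre B x" for q
    using T that unfolding fibre_linear_def by blast
  have Ta: "T (fadd B q q') = fadd B (T q) (T q')" if "q \<in> fibre B x" "q' \<in> fibre B x" for q q'
    using T that unfolding fibre_linear_def by blast
  have Ts: "T (fscale B k q) = fscale B k (T q)" if "q \<in> fibre B x" for q k
    using T that unfolding fibre_linear_def by blast
  obtain as where as: "distinct as" "set as = (UNIV :: 'r set)" and lc: "\<And>k f. lincomb B x k f =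
      foldr (\<lambda>a q. fadd B (fscale B (k $ a) (f a)) q) as (fzero B x)"
    using lincomb_foldr[of B x] by blast
  let ?F = "\<lambda>as. foldr (\<lambda>a q. fadd B (fscale B (fc p $ a) (e a x)) q) as (fzero B x)"
  have lin: "p = ?F as"
    using frame_expansion[OF x p] unfolding lc .
  note ops = fibre_ops[OF frame_base[OF x]]
  have F: "?F bs \<in> fibre B x" for bs
    by (induction bs) (auto intro!: ops frame_fibre[OF x])
  \<comment> \<open>\<open>fibre_linear\<close> speaks only of sums and multiples. The zero vector
    is the start of the iterated sum, so its image has to be found first; additivity gives
    it.\<close>
  have z: "fc (T (fzero B x)) = 0"
  proof -
    have "fc (T (fzero B x)) = fc (T (fadd B (fzero B x) (fzero B x)))"
      using ops(4)[OF ops(1)] by simp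
    also have "\<dots> = fc (T (fzero B x)) + fc (T (fzero B x))"
      using Ta[OF ops(1) ops(1)] fc_add[OF y Tf[OF ops(1)] Tf[OF ops(1)]] by simp
    finally show ?thesis by simp
  qed
  have "fc (T (?F bs)) = (\<Sum>a\<leftarrow>bs. fc p $ a *s fc (T (e a x)))" for bs
    by (induction bs) (simp_all add: z Ta Ts F ops frame_fibre[OF x] Tf fc_add[OF y] fc_scale[OF y]
      fibre_ops[OF frame_base[OF y]])
  from this[of as] have "fc (T p) = (\<Sum>a\<in>UNIV. fc p $ a *s fc (T (e a x)))"
    unfolding lin[symmetric] sum_list_distinct_conv_sum_set[OF as(1)] as(2) .
  then show ?thesis
    by (simp add: vec_eq_iff matrix_mult_component mult.commute)
qed

lemma C1_frame_in_chart:
  assumes tr: "trivialization c \<psi>" and d: "d \<in> base_atlas B"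
  shows "C1_on (snd d ` (U \<inter> fst d \<inter> fst c)) (snd (triv_chart c \<psi>) \<circ> e a \<circ> chart_inv d)"
proof -
  have "C1_map (base_atlas B) U (total_space B) (total_atlas B) (e a)"
    using frame unfolding frame_def by blast
  then have "C1_on (snd d ` (U \<inter> fst d \<inter> e a -` fst (triv_chart c \<psi>)))
      (snd (triv_chart c \<psi>) \<circ> e a \<circ> chart_inv d)"
    using d triv_total[OF tr] unfolding C1_map_def by blast
  moreover have "U \<inter> fst d \<inter> e a -` fst (triv_chart c \<psi>) = U \<inter> fst d \<inter> fst c"
    using frame_fibre[of _ a] by (auto simp: fst_triv_chart fibre_iff)
  ultimately show ?thesis
    by simp
qed

end

subsection \<open>Vector bundle coordinates\<close>

locale C1_coords = C1_frame B U e
  for B :: "('e::t2_space, 'm::t2_space, 'k::{real_normed_field,euclidean_space},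
    'n::finite, 'r::finite) vbundle" and U e +
  fixes c :: "('m, 'k, 'n) chart"
  assumes chart_c: "c \<in> base_atlas B"
begin

abbreviation u :: "('e, 'k, 'n + 'r) chart" where "u \<equiv> vb_coordinates B U e c"

lemma fst_u: "p \<in> fst u \<longleftrightarrow> p \<in> total_space B \<and> proj B p \<in> U \<and> proj B p \<in> fst c"
  and snd_u: "snd u p = join (snd c (proj B p)) (fc p)"
  by (simp_all add: vb_coordinates_def)

lemma fibre_u: "p \<in> fibre B x \<Longrightarrow> p \<in> fst u \<longleftrightarrow> x \<in> U \<and> x \<in> fst c"
  by (auto simp: fst_u fibre_iff)

text \<open>The image is a full cylinder over the base coordinates, because frame components take
  all values on each fibre. Lines in fibre directions therefore never leave it.\<close>

lemma u_image_iff: "v \<in> snd u ` fst u \<longleftrightarrow> lft v \<in> snd c ` (U \<inter> fst c)"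
proof
  assume "lft v \<in> snd c ` (U \<inter> fst c)"
  then obtain x where x: "x \<in> U" "x \<in> fst c" "lft v = snd c x"
    by blast
  obtain p where p: "p \<in> fibre B x" "fc p = rgt v"
    using frame_components_surj[OF x(1)] by blast
  then have "p \<in> fst u" "v = snd u p"
    using x p by (auto simp: fibre_u snd_u fibre_iff eq_join_iff)
  then show "v \<in> snd u ` fst u"
    by blast
qed (auto simp: fst_u snd_u)

lemma inj_on_u: "inj_on (snd u) (fst u)"
proof (rule inj_onI)
  fix p q assume p: "p \<in> fst u" "q \<in> fst u" "snd u p = snd u q"
  then have *: "snd c (proj B p) = snd c (proj B q)" "fc p = fc q"
    by (simp_all add: snd_u)
  then have "proj B p = proj B q"
    using p base.chart_inj[OF chart_c] unfolding fst_u by blast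
  then show "p = q"
    using p * by (intro frame_components_inj[of "proj B p"]) (auto simp: fst_u fibre_iff)
qed

text \<open>Near a point, the coordinates are compared with the chart of a trivialization. The base
  part of the change of coordinates is a transition map of the base. The fibre part is
  multiplication by \<open>triv_matrix\<close> in one direction and the solution of the
  corresponding linear system in the other.\<close>

lemma u_in_atlas: "u \<in> total_atlas B"
proof -
  have "(fst u, snd u) \<in> total_atlas B"
  proof (rule total.atlas_memI[OF _ inj_on_u])
    show "fst u \<subseteq> total_space B"
      by (auto simp: fst_u)
    fix p assume p: "p \<in> fst u"
    let ?x = "proj B p"
    have x: "?x \<in> U" "?x \<in> fst c" "p \<in> total_space B" "p \<in> fibre B ?x"
      using p by (auto simp: fst_u fibre_iff)
    obtain c' \<psi> where tr: "trivialization c' \<psi>" and xc': "?x \<in> fst c'"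
      using trivialization_exists[OF frame_base[OF x(1)]] .
    note c' = triv_base[OF tr]
    let ?d = "triv_chart c' \<psi>"
    \<comment> \<open>The common domain in the base of the frame, the chart and the trivialization.
      The sets \<open>?V\<close> and \<open>?V'\<close> are the cylinders over its images in the two
      charts of the base.\<close>
    let ?O = "U \<inter> fst c \<inter> fst c'"
    let ?V = "lft -` (snd c' ` ?O) :: ('k ^ ('n + 'r)) set"
    let ?V' = "lft -` (snd c ` ?O) :: ('k ^ ('n + 'r)) set"
    have opO: "open (snd d ` ?O)" if "d \<in> base_atlas B" "?O \<subseteq> fst d" for d
    proof -
      have "openin (top_of_set (base_space B)) ?O"
        by (intro openin_Int openin_frame base.chart_domain chart_c c')
      from base.open_chart_image[OF that(1) this] show ?thesis
        using that(2) by (simp add: Int_absorb1)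
    qed
    have op: "open ?V" "open ?V'"
      using opO[OF c'] opO[OF chart_c] by (auto intro!: open_lft_vimage)
    have sub: "?V \<subseteq> snd ?d ` (fst u \<inter> fst ?d)"
    proof
      fix v assume "v \<in> ?V"
      then obtain y where y: "y \<in> U" "y \<in> fst c" "y \<in> fst c'" "lft v = snd c' y"
        by auto
      obtain q where "q \<in> fibre B y" "\<psi> q = rgt v"
        using triv_point[OF tr y(3)] by blast
      then have "q \<in> fst u \<inter> fst ?d" "v = snd ?d q"
        using y by (auto simp: fst_u fibre_iff fst_triv_chart snd_triv_chart eq_join_iff)
      then show "v \<in> snd ?d ` (fst u \<inter> fst ?d)"
        by blast
    qed
    have sub': "?V' \<subseteq> snd u ` (fst u \<inter> fst ?d)"
    proof
      fix v assume "v \<in> ?V'"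
      then obtain y where y: "y \<in> U" "y \<in> fst c" "y \<in> fst c'" "lft v = snd c y"
        by auto
      obtain q where "q \<in> fibre B y" "fc q = rgt v"
        using frame_components_surj[OF y(1)] by blast
      then have "q \<in> fst u \<inter> fst ?d" "v = snd u q"
        using y by (auto simp: fst_u snd_u fibre_iff fst_triv_chart eq_join_iff)
      then show "v \<in> snd u ` (fst u \<inter> fst ?d)"
        by blast
    qed
    have entry: "C1_wrt (\<lambda>j h. h $ j) S (\<lambda>v. triv_matrix \<psi> (chart_inv d (lft v)) $ b $ a)"
      if d: "d \<in> base_atlas B" "?O \<subseteq> fst d" and S: "open S" "\<And>v. v \<in> S \<Longrightarrow> lft v \<in> snd d ` ?O"
      for d b a and S :: "('k ^ ('n + 'r)) set"
    proof -
      have "snd d ` ?O \<subseteq> snd d ` (U \<inter> fst d \<inter> fst c')"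
        using d(2) by blast
      from C1_on_subset[OF C1_frame_in_chart[OF tr d(1)] this]
      have "C1_wrt (\<lambda>j h. h $ j) S (\<lambda>v. (snd ?d \<circ> e a \<circ> chart_inv d) (lft v) $ Inr b)"
        by (rule C1_wrt_lft_compose) (use S in auto)
      then show ?thesis
        by (simp add: snd_triv_chart triv_matrix_def)
    qed
    have trans: "C1_wrt (\<lambda>j h. h $ j) S (\<lambda>v. (snd d' \<circ> chart_inv d) (lft v) $ i)"
      if d: "d \<in> base_atlas B" "d' \<in> base_atlas B" "?O \<subseteq> fst d" "?O \<subseteq> fst d'"
        and S: "open S" "\<And>v. v \<in> S \<Longrightarrow> lft v \<in> snd d ` ?O"
      for d d' i and S :: "('k ^ ('n + 'r)) set"
      by (rule C1_wrt_lft_compose[OF base.transition_C1[OF d(1,2)] S(1)]) (use S(2) d(3,4) in blast)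
    have inv_d: "chart_inv ?d v \<in> fst u \<inter> fst ?d" "snd ?d (chart_inv ?d v) = v"
      "proj B (chart_inv ?d v) = chart_inv c' (lft v)" "chart_inv c' (lft v) \<in> ?O"
      if v: "v \<in> ?V" for v
    proof -
      obtain q where q: "q \<in> fst u" "q \<in> fst ?d" "v = snd ?d q"
        using sub v by blast
      then have "chart_inv ?d v = q"
        using total.chart_inv(1)[OF triv_total[OF tr]] by simp
      then show "chart_inv ?d v \<in> fst u \<inter> fst ?d" "snd ?d (chart_inv ?d v) = v"
        "proj B (chart_inv ?d v) = chart_inv c' (lft v)" "chart_inv c' (lft v) \<in> ?O"
        using q base.chart_inv(1)[OF c'] by (auto simp: fst_triv_chart snd_triv_chart fst_u)
    qed
    have inv_u: "chart_inv u v \<in> fst u \<inter> fst ?d" "snd u (chart_inv u v) = v"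
      "proj B (chart_inv u v) = chart_inv c (lft v)" "chart_inv c (lft v) \<in> ?O"
      if v: "v \<in> ?V'" for v
    proof -
      obtain q where q: "q \<in> fst u" "q \<in> fst ?d" "v = snd u q"
        using sub' v by blast
      then have "chart_inv u v = q"
        using inj_on_u by simp
      then show "chart_inv u v \<in> fst u \<inter> fst ?d" "snd u (chart_inv u v) = v"
        "proj B (chart_inv u v) = chart_inv c (lft v)" "chart_inv c (lft v) \<in> ?O"
        using q base.chart_inv(1)[OF chart_c] by (auto simp: fst_triv_chart snd_u fst_u)
    qed
    have "C1_on ?V (snd u \<circ> chart_inv ?d)"
      unfolding C1_on_componentwise[OF op(1)]
    proof
      fix i :: "'n + 'r"
      show "C1_wrt (\<lambda>j h. h $ j) ?V (\<lambda>v. (snd u \<circ> chart_inv ?d) v $ i)"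
      proof (cases i)
        case (Inl \<mu>)
        have "C1_wrt (\<lambda>j h. h $ j) ?V (\<lambda>v. (snd c \<circ> chart_inv c') (lft v) $ \<mu>)"
          by (rule trans[OF c' chart_c _ _ op(1)]) auto
        then show ?thesis
          by (rule C1_wrt_cong) (simp add: Inl snd_u inv_d(3))
      next
        case (Inr a)
        \<comment> \<open>Frame components solve a linear system whose matrix is C1 and invertible
          and whose right-hand side is the fibre coordinate; Cramer's rule makes them C1.\<close>
        have "C1_wrt (\<lambda>j h. h $ j) ?V (\<lambda>v. fc (chart_inv ?d v) $ a)"
        proof (rule C1_wrt_linear_system)
          show "C1_wrt (\<lambda>j h. h $ j) ?V (\<lambda>v. triv_matrix \<psi> (chart_inv c' (lft v)) $ b $ a)" for b a
            by (rule entry[OF c' _ op(1)]) auto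
          show "C1_wrt (\<lambda>j h. h $ j) ?V (\<lambda>v. rgt v $ b)" for b
            by (simp add: C1_wrt_component)
          fix v assume v: "v \<in> ?V"
          show "invertible (triv_matrix \<psi> (chart_inv c' (lft v)))"
            using inv_d(4)[OF v] by (intro invertible_triv_matrix[OF tr]) auto
          have "triv_matrix \<psi> (chart_inv c' (lft v)) *v fc (chart_inv ?d v) = \<psi> (chart_inv ?d v)"
            using inv_d[OF v] by (intro triv_matrix_mult[OF tr]) (auto simp: fst_u fibre_iff)
          also have "\<dots> = rgt (snd ?d (chart_inv ?d v))"
            by (simp add: snd_triv_chart)
          finally show "triv_matrix \<psi> (chart_inv c' (lft v)) *v fc (chart_inv ?d v) = rgt v"
            unfolding inv_d(2)[OF v] .
        qed
        then show ?thesis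
          by (rule C1_wrt_cong) (simp add: Inr snd_u)
      qed
    qed
    moreover have "C1_on ?V' (snd ?d \<circ> chart_inv u)"
      unfolding C1_on_componentwise[OF op(2)]
    proof
      fix i :: "'n + 'r"
      show "C1_wrt (\<lambda>j h. h $ j) ?V' (\<lambda>v. (snd ?d \<circ> chart_inv u) v $ i)"
      proof (cases i)
        case (Inl \<mu>)
        have "C1_wrt (\<lambda>j h. h $ j) ?V' (\<lambda>v. (snd c' \<circ> chart_inv c) (lft v) $ \<mu>)"
          by (rule trans[OF chart_c c' _ _ op(2)]) auto
        then show ?thesis
          by (rule C1_wrt_cong) (simp add: Inl snd_triv_chart inv_u(3))
      next
        case (Inr b)
        \<comment> \<open>In this direction the fibre coordinates are a matrix times the frame
          components, so sums and products suffice.\<close>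
        have "C1_wrt (\<lambda>j h. h $ j) ?V'
            (\<lambda>v. \<Sum>a\<in>UNIV. triv_matrix \<psi> (chart_inv c (lft v)) $ b $ a * v $ Inr a)"
          by (intro C1_wrt_sum C1_wrt_mult C1_wrt_component entry[OF chart_c _ op(2)]) auto
        then show ?thesis
        proof (rule C1_wrt_cong)
          fix v assume v: "v \<in> ?V'"
          have "triv_matrix \<psi> (chart_inv c (lft v)) *v fc (chart_inv u v) = \<psi> (chart_inv u v)"
            using inv_u[OF v] by (intro triv_matrix_mult[OF tr]) (auto simp: fst_u fibre_iff)
          moreover have "fc (chart_inv u v) = rgt v"
            using arg_cong[OF inv_u(2)[OF v], of rgt] by (simp add: snd_u)
          ultimately have "\<psi> (chart_inv u v) = triv_matrix \<psi> (chart_inv c (lft v)) *v rgt v"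
            by simp
          then show "(\<Sum>a\<in>UNIV. triv_matrix \<psi> (chart_inv c (lft v)) $ b $ a * v $ Inr a) =
              (snd ?d \<circ> chart_inv u) v $ i"
            by (simp add: Inr snd_triv_chart matrix_mult_component)
        qed
      qed
    qed
    ultimately show "\<exists>d\<in>total_atlas B. \<exists>V V'. p \<in> fst d \<and>
      open V \<and> snd d p \<in> V \<and> V \<subseteq> snd d ` (fst u \<inter> fst d) \<and> C1_on V (snd u \<circ> chart_inv d) \<and>
      open V' \<and> snd u p \<in> V' \<and> V' \<subseteq> snd u ` (fst u \<inter> fst d) \<and> C1_on V' (snd d \<circ> chart_inv u)"
      using op sub sub' x xc'
      by (intro bexI[OF _ triv_total[OF tr]] exI[of _ ?V] exI[of _ ?V'] conjI)
        (simp_all add: fst_triv_chart snd_triv_chart snd_u)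
  qed
  then show ?thesis
    by simp
qed

text \<open>Along a path in a fibre the base coordinates are constant, so the base part of its
  velocity vanishes. Conversely, a coordinate line whose direction has zero base part stays in the
  fibre.\<close>

lemma vertical_space_eq:
  assumes p: "p \<in> fst u"
  shows "vertical_space B p = {v \<in> tangent_space (total_atlas B) p. lft (v u) = 0}"
proof (intro set_eqI iffI)
  fix v assume "v \<in> vertical_space B p"
  then obtain \<epsilon> \<delta> where *: "\<epsilon> > 0" "C1_path (total_space B) (total_atlas B) {-\<epsilon><..<\<epsilon>} \<delta>" "\<delta> 0 = p"
    "\<delta> ` {-\<epsilon><..<\<epsilon>} \<subseteq> fibre B (proj B p)" "has_velocity (total_atlas B) {-\<epsilon><..<\<epsilon>} \<delta> 0 v"
    unfolding vertical_space_def by blast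
  have v: "v \<in> tangent_space (total_atlas B) p"
    and der: "(snd u \<circ> \<delta> has_vector_derivative v u) (at 0 within {-\<epsilon><..<\<epsilon>})"
    using *(3,5) u_in_atlas p unfolding has_velocity_def by auto
  have d1: "((\<lambda>t. lft ((snd u \<circ> \<delta>) t)) has_vector_derivative lft (v u)) (at 0 within {-\<epsilon><..<\<epsilon>})"
    by (rule bounded_linear.has_vector_derivative[OF bounded_linear_lft der])
  have d2: "((\<lambda>t. lft ((snd u \<circ> \<delta>) t)) has_vector_derivative 0) (at 0 within {-\<epsilon><..<\<epsilon>})"
  proof (rule has_vector_derivative_transform)
    show "lft ((snd u \<circ> \<delta>) t) = snd c (proj B p)" if "t \<in> {-\<epsilon><..<\<epsilon>}" for t
    proof -
      have "\<delta> t \<in> fibre B (proj B p)"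
        using *(4) that by blast
      then show ?thesis
        by (simp add: snd_u fibre_iff)
    qed
  qed (use *(1) in auto)
  have "at 0 within {-\<epsilon><..<\<epsilon>} = at 0"
    using *(1) by (intro at_within_open) auto
  then have "at 0 within {-\<epsilon><..<\<epsilon>} \<noteq> bot"
    by simp
  from vector_derivative_unique_within[OF this d1 d2] have "lft (v u) = 0" .
  with v show "v \<in> {v \<in> tangent_space (total_atlas B) p. lft (v u) = 0}"
    by simp
next
  fix v assume "v \<in> {v \<in> tangent_space (total_atlas B) p. lft (v u) = 0}"
  then have v: "v \<in> tangent_space (total_atlas B) p" "lft (v u) = 0"
    by auto
  \<comment> \<open>The line can run for all times since the chart image is a cylinder, so the
    radius 1 serves every \<open>v\<close>.\<close>
  let ?J = "{-1<..<1} :: real set"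
  let ?\<delta> = "\<lambda>t::real. chart_inv u (snd u p + t *\<^sub>R v u)"
  have J: "is_interval ?J"
    by (simp add: is_interval_oo)
  have lft: "lft (snd u p + t *\<^sub>R v u) = snd c (proj B p)" for t :: real
    using v(2) by (simp add: vec_eq_iff snd_u)
  have im: "snd u p + t *\<^sub>R v u \<in> snd u ` fst u" for t :: real
    unfolding u_image_iff lft using p by (simp add: fst_u)
  note path = total.C1_path_line[OF u_in_atlas J, of "snd u p" "v u", OF im]
  have fib: "?\<delta> t \<in> fibre B (proj B p)" for t
  proof -
    have m: "?\<delta> t \<in> fst u" "snd u (?\<delta> t) = snd u p + t *\<^sub>R v u"
      using total.chart_inv(2,3)[OF u_in_atlas im] by auto
    have "snd c (proj B (?\<delta> t)) = snd c (proj B p)"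
      using arg_cong[OF m(2), of lft] unfolding lft by (simp add: snd_u)
    then have "proj B (?\<delta> t) = proj B p"
      using base.chart_inj[OF chart_c] m(1) p unfolding fst_u by blast
    then show ?thesis
      using m(1) by (simp add: fst_u fibre_iff)
  qed
  have \<delta>0: "?\<delta> 0 = p"
    using total.chart_inv(1)[OF u_in_atlas p] by simp
  have "has_velocity (total_atlas B) ?J ?\<delta> 0 v"
  proof (rule total.has_velocity_chartI[OF u_in_atlas _ path(1)])
    show "(snd u \<circ> ?\<delta> has_vector_derivative v u) (at 0 within ?J)"
      by (rule path(2)) simp
  qed (simp_all only: \<delta>0 p v, simp)
  then show "v \<in> vertical_space B p"
    unfolding vertical_space_def mem_Collect_eq using path(1) \<delta>0 fib
    by (intro exI[of _ 1] conjI exI[of _ ?\<delta>]) auto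
qed

end

section \<open>Matrix-valued functions of one and two real parameters\<close>

lemma matrix_mult_axis: "(A :: 'k::comm_semiring_1 ^ 'n ^ 'm) *v axis j 1 = column j A"
  by (simp add: vec_eq_iff matrix_mult_component axis_def column_def if_distrib cong: if_cong)

lemma bounded_bilinear_matrix_vector_mult:
  "bounded_bilinear (\<lambda>(A :: 'k::{real_normed_field,euclidean_space} ^ 'n ^ 'm) x. A *v x)"
  unfolding bilinear_conv_bounded_bilinear[symmetric] bilinear_def
  by (auto intro!: linearI simp: vec_eq_iff matrix_mult_component algebra_simps sum.distrib
      scaleR_sum_right)

lemma has_vector_derivative_matrix_vector_mult:
  fixes A :: "real \<Rightarrow> 'k::{real_normed_field,euclidean_space} ^ 'n ^ 'm"
  assumes "(A has_vector_derivative A') (at t within J)" "(x has_vector_derivative x') (at t within J)"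
  shows "((\<lambda>t. A t *v x t) has_vector_derivative A t *v x' + A' *v x t) (at t within J)"
  by (rule bounded_bilinear.has_vector_derivative[OF bounded_bilinear_matrix_vector_mult assms])

lemma has_vector_derivative_matrix_vector_mult_const:
  fixes A :: "real \<Rightarrow> 'k::{real_normed_field,euclidean_space} ^ 'n ^ 'm"
  assumes "(A has_vector_derivative A') (at t within J)"
  shows "((\<lambda>t. A t *v x) has_vector_derivative A' *v x) (at t within J)"
  using has_vector_derivative_matrix_vector_mult[OF assms has_vector_derivative_const[of x]] by simp

text \<open>The filter \<open>at s within {s}\<close> is trivial. On one-point intervals the
  statements about coefficients therefore hold for every candidate.\<close>

lemma has_vector_derivative_singleton:
  assumes "J \<subseteq> {s}"
  shows "(f has_vector_derivative w) (at s within J)"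
proof -
  have "(f has_vector_derivative w) (at s within {s})"
    unfolding has_vector_derivative_def
    by (simp add: has_derivative_def at_within_def bounded_linear_scaleR_left)
  then show ?thesis
    using assms has_vector_derivative_within_subset by blast
qed

text \<open>With these functionals \<open>C1_wrt\<close> means C1 in two real parameters; they are
  embedded in \<open>'k\<close> because \<open>C1_wrt\<close> expects functionals with scalar
  values.\<close>

definition real_coords :: "bool \<Rightarrow> real \<times> real \<Rightarrow> 'k::real_normed_field" where
  "real_coords i h = of_real (if i then fst h else snd h)"

lemma C1_wrt_real_coords:
  fixes y :: "real \<Rightarrow> 'k::real_normed_field"
  assumes g: "continuous_on T g" and y: "\<And>t. t \<in> T \<Longrightarrow> (y has_vector_derivative g t) (at t within T)"
  shows "C1_wrt real_coords (T \<times> T) (\<lambda>z. y (fst z))" "C1_wrt real_coords (T \<times> T) (\<lambda>z. y (snd z))"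
proof -
  have 1: "continuous_on (T \<times> T) (\<lambda>z. g (fst z))"
    by (rule continuous_on_compose2[OF g]) (auto intro!: continuous_intros)
  have 2: "continuous_on (T \<times> T) (\<lambda>z. g (snd z))"
    by (rule continuous_on_compose2[OF g]) (auto intro!: continuous_intros)
  have y': "(y has_derivative (\<lambda>h. h *\<^sub>R g t)) (at t within T')" if "t \<in> T" "T' \<subseteq> T" for t T'
    using has_derivative_subset[OF y[OF that(1), unfolded has_vector_derivative_def] that(2)] .
  show "C1_wrt real_coords (T \<times> T) (\<lambda>z. y (fst z))"
  proof (rule C1_wrtI[where g = "\<lambda>i z. if i then g (fst z) else 0"])
    show "continuous_on (T \<times> T) (\<lambda>z. if i then g (fst z) else 0)" for i
      using 1 by (cases i) simp_all
    fix z assume "z \<in> T \<times> T"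
    then have "((\<lambda>z. y (fst z)) has_derivative (\<lambda>h. fst h *\<^sub>R g (fst z))) (at z within T \<times> T)"
      by (intro has_derivative_in_compose[OF has_derivative_fst[OF has_derivative_ident] y']) auto
    then show "((\<lambda>z. y (fst z)) has_derivative
        (\<lambda>h. \<Sum>i\<in>UNIV. (if i then g (fst z) else 0) * real_coords i h)) (at z within T \<times> T)"
      by (simp add: UNIV_bool real_coords_def scaleR_conv_of_real mult.commute)
  qed
  show "C1_wrt real_coords (T \<times> T) (\<lambda>z. y (snd z))"
  proof (rule C1_wrtI[where g = "\<lambda>i z. if i then 0 else g (snd z)"])
    show "continuous_on (T \<times> T) (\<lambda>z. if i then 0 else g (snd z))" for i
      using 2 by (cases i) simp_all
    fix z assume "z \<in> T \<times> T"
    then have "((\<lambda>z. y (snd z)) has_derivative (\<lambda>h. snd h *\<^sub>R g (snd z))) (at z within T \<times> T)"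
      by (intro has_derivative_in_compose[OF has_derivative_snd[OF has_derivative_ident] y']) auto
    then show "((\<lambda>z. y (snd z)) has_derivative
        (\<lambda>h. \<Sum>i\<in>UNIV. (if i then 0 else g (snd z)) * real_coords i h)) (at z within T \<times> T)"
      by (simp add: UNIV_bool real_coords_def scaleR_conv_of_real mult.commute)
  qed
qed

lemma C1_wrt_real_coords_matrix:
  fixes f :: "real \<times> real \<Rightarrow> 'k::{real_normed_field,euclidean_space} ^ 'n ^ 'm"
  assumes "\<And>i j. C1_wrt real_coords S (\<lambda>z. f z $ i $ j)"
  shows "\<exists>F G. continuous_on S F \<and> continuous_on S G \<and>
    (\<forall>z\<in>S. (f has_derivative (\<lambda>h. fst h *\<^sub>R F z + snd h *\<^sub>R G z)) (at z within S))"
proof -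
  have "\<forall>i j. \<exists>g. (\<forall>b. continuous_on S (g b)) \<and> (\<forall>z\<in>S. ((\<lambda>z. f z $ i $ j) has_derivative
      (\<lambda>h. \<Sum>b\<in>UNIV. g b z * real_coords b h)) (at z within S))"
    using assms unfolding C1_wrt_def by simp
  then obtain g where g: "\<forall>i j. (\<forall>b. continuous_on S (g i j b)) \<and> (\<forall>z\<in>S. ((\<lambda>z. f z $ i $ j) has_derivative
      (\<lambda>h. \<Sum>b\<in>UNIV. g i j b z * real_coords b h)) (at z within S))"
    unfolding choice_iff by (elim exE)
  let ?F = "\<lambda>b z. (\<chi> i j. g i j b z)"
  have "continuous_on S (?F b)" for b
    by (intro continuous_on_vec_lambda) (simp add: g)
  moreover have "(f has_derivative (\<lambda>h. fst h *\<^sub>R ?F True z + snd h *\<^sub>R ?F False z)) (at z within S)"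
    if "z \<in> S" for z
  proof (intro has_derivative_vec)
    fix i j
    have eq: "(\<lambda>h. \<Sum>b\<in>UNIV. g i j b z * real_coords b h) =
        (\<lambda>h. fst h *\<^sub>R g i j True z + snd h *\<^sub>R g i j False z)"
      by (simp add: UNIV_bool real_coords_def scaleR_conv_of_real mult.commute add.commute)
    have "((\<lambda>z. f z $ i $ j) has_derivative
        (\<lambda>h. fst h *\<^sub>R g i j True z + snd h *\<^sub>R g i j False z)) (at z within S)"
      unfolding eq[symmetric] using g that by simp
    then show "((\<lambda>z. f z $ i $ j) has_derivative
        (\<lambda>h. (fst h *\<^sub>R ?F True z + snd h *\<^sub>R ?F False z) $ i $ j)) (at z within S)"
      by simp
  qed
  ultimately show ?thesis
    by (intro exI[of _ "?F True"] exI[of _ "?F False"]) simp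
qed

subsection \<open>Linear transports\<close>

context C1_vbundle
begin

lemma transport:
  assumes I: "transport_along_paths B I" and \<gamma>: "base_path B J \<gamma>" and st: "s \<in> J" "t \<in> J"
    and p: "p \<in> fibre B (\<gamma> s)"
  shows transport_in_fibre: "I J \<gamma> s t p \<in> fibre B (\<gamma> t)"
    and transport_comp: "r \<in> J \<Longrightarrow> I J \<gamma> t r (I J \<gamma> s t p) = I J \<gamma> s r p"
    and transport_refl: "I J \<gamma> s s p = p"
proof -
  have *: "(\<forall>s\<in>J. \<forall>t\<in>J. I J \<gamma> s t ` fibre B (\<gamma> s) \<subseteq> fibre B (\<gamma> t)) \<and>
        (\<forall>r\<in>J. \<forall>s\<in>J. \<forall>t\<in>J. \<forall>p\<in>fibre B (\<gamma> r). I J \<gamma> s t (I J \<gamma> r s p) = I J \<gamma> r t p) \<and>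
        (\<forall>s\<in>J. \<forall>p\<in>fibre B (\<gamma> s). I J \<gamma> s s p = p)"
    using I \<gamma> unfolding transport_along_paths_def by blast
  then show "I J \<gamma> s t p \<in> fibre B (\<gamma> t)"
    using st p by blast
  show "I J \<gamma> t r (I J \<gamma> s t p) = I J \<gamma> s r p" if "r \<in> J"
    using * st p that by blast
  show "I J \<gamma> s s p = p"
    using * st p by blast
qed

lemma base_path_in: "base_path B J \<gamma> \<Longrightarrow> s \<in> J \<Longrightarrow> \<gamma> s \<in> base_space B"
  unfolding C1_path_def by blast

end

context C1_frame
begin

text \<open>Near each parameter the frame components are the fibre part of the path in vector bundle
  coordinates over some chart of the base. They do not depend on that chart, so the local
  derivatives can be glued.\<close>

lemma C1_path_frame_components:
  assumes \<delta>: "C1_path (total_space B) (total_atlas B) J \<delta>"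
  shows "\<exists>g. continuous_on (J \<inter> (proj B \<circ> \<delta>) -` U) g \<and>
    (\<forall>t\<in>J \<inter> (proj B \<circ> \<delta>) -` U. (fc \<circ> \<delta> has_vector_derivative g t) (at t within J))"
proof (rule vector_derivative_glue)
  show "is_interval J"
    using \<delta> unfolding C1_path_def by blast
  fix s assume s: "s \<in> J \<inter> (proj B \<circ> \<delta>) -` U"
  then have sU: "proj B (\<delta> s) \<in> U"
    by simp
  obtain c where c: "c \<in> base_atlas B" "proj B (\<delta> s) \<in> fst c"
    using base.chart_covers[OF frame_base[OF sU]] .
  interpret C1_coords B U e c
    by unfold_locales (rule c(1))
  have su: "\<delta> s \<in> fst u"
    using \<delta> s c(2) unfolding fst_u C1_path_def by auto
  obtain N where N: "open N" "J \<inter> \<delta> -` fst u = J \<inter> N"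
    using total.C1_path_preimage[OF \<delta> total.chart_domain(1)[OF u_in_atlas]] .
  obtain g where g: "continuous_on (J \<inter> \<delta> -` fst u) g \<and>
      (\<forall>s\<in>J \<inter> \<delta> -` fst u. (snd u \<circ> \<delta> has_vector_derivative g s) (at s within J))"
    using total.C1_path_chart[OF \<delta> u_in_atlas] by (elim exE)
  have "continuous_on (J \<inter> (proj B \<circ> \<delta>) -` U \<inter> N) g"
    by (rule continuous_on_subset[OF conjunct1[OF g]]) (use N in auto)
  from continuous_on_compose2[OF linear_continuous_on[OF bounded_linear_rgt] this]
  have "continuous_on (J \<inter> (proj B \<circ> \<delta>) -` U \<inter> N) (\<lambda>t. rgt (g t))"
    by blast
  moreover have "(fc \<circ> \<delta> has_vector_derivative rgt (g t)) (at t within J)"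
    if "t \<in> J \<inter> (proj B \<circ> \<delta>) -` U \<inter> N" for t
  proof -
    have "t \<in> J \<inter> \<delta> -` fst u"
      using that N by blast
    then have "(snd u \<circ> \<delta> has_vector_derivative g t) (at t within J)"
      using g by blast
    from bounded_linear.has_vector_derivative[OF bounded_linear_rgt this] show ?thesis
      by (simp add: snd_u o_def)
  qed
  ultimately show "\<exists>N g. open N \<and> s \<in> N \<and> continuous_on (J \<inter> (proj B \<circ> \<delta>) -` U \<inter> N) g \<and>
      (\<forall>t\<in>J \<inter> (proj B \<circ> \<delta>) -` U \<inter> N. (fc \<circ> \<delta> has_vector_derivative g t) (at t within J))"
    using N su s by (intro exI[of _ N] exI[of _ "\<lambda>t. rgt (g t)"]) auto
qed simp

end

locale frame_transport = C1_frame B U e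
  for B :: "('e::t2_space, 'm::t2_space, 'k::{real_normed_field,euclidean_space},
    'n::finite, 'r::finite) vbundle" and U e +
  fixes I :: "('e, 'm) transport" and J :: "real set" and \<gamma> :: "real \<Rightarrow> 'm"
  assumes lin: "linear_transport B I" and path: "base_path B J \<gamma>"
begin

abbreviation S :: "real set" where "S \<equiv> J \<inter> \<gamma> -` U"
abbreviation L :: "real \<Rightarrow> real \<Rightarrow> 'k ^ 'r ^ 'r" where "L \<equiv> transport_matrix B e I J \<gamma>"

lemma transport: "transport_along_paths B I"
  using lin unfolding linear_transport_def by blast

text \<open>\<open>S\<close> is relatively open in \<open>J\<close>. Matrix identities hold only on
  \<open>S\<close>, while the coefficients are derivatives within \<open>J\<close>; this passes
  between the two.\<close>

lemma at_within_S:
  assumes "s \<in> S"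
  shows "at s within S = at s within J"
proof -
  obtain N where N: "open N" "S = J \<inter> N"
    using base.C1_path_preimage[OF path openin_frame] .
  then show ?thesis
    using at_within_open_Int[of N s J] assms by auto
qed

lemma L_apply:
  assumes "s \<in> S" "t \<in> S" "p \<in> fibre B (\<gamma> s)"
  shows "fc (I J \<gamma> s t p) = L t s *v fc p"
proof -
  have "fibre_linear B (\<gamma> s) (\<gamma> t) (I J \<gamma> s t)"
    using lin path assms(1,2) unfolding linear_transport_def by blast
  from fibre_linear_matrix[OF this _ _ assms(3)] show ?thesis
    using assms(1,2) unfolding transport_matrix_def by blast
qed

lemma L_comp:
  assumes "r \<in> S" "s \<in> S" "t \<in> S"
  shows "L t s ** L s r = L t r"
  unfolding matrix_eq matrix_vector_mul_assoc[symmetric]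
proof
  fix k
  obtain p where p: "p \<in> fibre B (\<gamma> r)" "fc p = k"
    using frame_components_surj[of "\<gamma> r" k] assms(1) by blast
  have "L t s *v (L s r *v k) = fc (I J \<gamma> s t (I J \<gamma> r s p))"
    using assms p transport_in_fibre[OF transport path, of r s p] by (simp add: L_apply)
  also have "\<dots> = L t r *v k"
    using assms p transport_comp[OF transport path, of r s p t] by (simp add: L_apply)
  finally show "L t s *v (L s r *v k) = L t r *v k" .
qed

lemma L_refl:
  assumes "s \<in> S"
  shows "L s s = mat 1"
  unfolding matrix_eq matrix_vector_mul_lid
proof
  fix k
  obtain p where p: "p \<in> fibre B (\<gamma> s)" "fc p = k"
    using frame_components_surj[of "\<gamma> s" k] assms(1) by blast
  have "s \<in> J"
    using assms by simp
  have "L s s *v k = fc (I J \<gamma> s s p)"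
    using L_apply[OF assms assms p(1)] p(2) by simp
  also have "\<dots> = k"
    using transport_refl[OF transport path \<open>s \<in> J\<close> \<open>s \<in> J\<close> p(1)] p(2) by simp
  finally show "L s s *v k = k" .
qed

lemma invertible_L:
  assumes "s \<in> S" "t \<in> S"
  shows "invertible (L t s)"
proof -
  have "L t s ** L s t = mat 1" "L s t ** L t s = mat 1"
    using L_comp[OF assms(2,1,2)] L_comp[OF assms(1,2,1)] by (simp_all add: L_refl assms del: Int_iff)
  then show ?thesis
    unfolding invertible_def by blast
qed

text \<open>All of the matrix is controlled by its first argument, since
  \<open>L t s = L t s\<^sub>0 ** L s\<^sub>0 s\<close> and \<open>L s\<^sub>0 s\<close> is the inverse of \<open>L s s\<^sub>0\<close>.\<close>

lemma C1_transport_matrix: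
  assumes lifts: "\<And>s p. s \<in> J \<Longrightarrow> p \<in> fibre B (\<gamma> s) \<Longrightarrow>
    C1_path (total_space B) (total_atlas B) J (\<lambda>t. I J \<gamma> s t p)"
  shows "\<exists>F G. continuous_on (S \<times> S) F \<and> continuous_on (S \<times> S) G \<and>
    (\<forall>z\<in>S \<times> S. ((\<lambda>w. L (fst w) (snd w)) has_derivative
       (\<lambda>h. fst h *\<^sub>R F z + snd h *\<^sub>R G z)) (at z within S \<times> S))"
proof (cases "S = {}")
  case True
  then show ?thesis
    by simp
next
  case False
  then obtain s\<^sub>0 where s\<^sub>0: "s\<^sub>0 \<in> S"
    by blast
  have "\<exists>g. continuous_on S g \<and> (\<forall>t\<in>S. ((\<lambda>t. L t s\<^sub>0 $ i $ j) has_vector_derivative g t) (at t within S))" for i j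
  proof -
    have ej: "e j (\<gamma> s\<^sub>0) \<in> fibre B (\<gamma> s\<^sub>0)"
      using s\<^sub>0 by (intro frame_fibre) simp
    let ?\<delta> = "\<lambda>t. I J \<gamma> s\<^sub>0 t (e j (\<gamma> s\<^sub>0))"
    have S: "J \<inter> (proj B \<circ> ?\<delta>) -` U = S"
      using transport_in_fibre[OF transport path _ _ ej] s\<^sub>0 by (auto simp: fibre_iff)
    have "\<exists>g. continuous_on S g \<and> (\<forall>t\<in>S. (fc \<circ> ?\<delta> has_vector_derivative g t) (at t within J))"
      using C1_path_frame_components[OF lifts[OF _ ej]] s\<^sub>0 unfolding S by blast
    then obtain g where g: "continuous_on S g \<and> (\<forall>t\<in>S. (fc \<circ> ?\<delta> has_vector_derivative g t) (at t within J))"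
      by (elim exE)
    have "continuous_on S (\<lambda>t. g t $ i)"
      by (intro continuous_on_component conjunct1[OF g])
    moreover have "((\<lambda>t. L t s\<^sub>0 $ i $ j) has_vector_derivative g t $ i) (at t within S)" if "t \<in> S" for t
    proof -
      have "(fc \<circ> ?\<delta> has_vector_derivative g t) (at t within S)"
        using g that at_within_S by simp
      from bounded_linear.has_vector_derivative[OF bounded_linear_vec_nth this] show ?thesis
        by (simp add: transport_matrix_def o_def)
    qed
    ultimately show ?thesis
      by (intro exI[of _ "\<lambda>t. g t $ i"]) simp
  qed
  then have 1: "C1_wrt real_coords (S \<times> S) (\<lambda>z. L (fst z) s\<^sub>0 $ i $ j)"
    and 2: "C1_wrt real_coords (S \<times> S) (\<lambda>z. L (snd z) s\<^sub>0 $ i $ j)" for i j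
    using C1_wrt_real_coords[of S _ "\<lambda>t. L t s\<^sub>0 $ i $ j"] by blast+
  \<comment> \<open>Each column of the inverse matrix is the solution of a linear system with a
    basis vector on the right.\<close>
  have 3: "C1_wrt real_coords (S \<times> S) (\<lambda>z. column j (L s\<^sub>0 (snd z)) $ i)" for i j
  proof (rule C1_wrt_linear_system[where b = "\<lambda>_. axis j 1"])
    show "C1_wrt real_coords (S \<times> S) (\<lambda>z. L (snd z) s\<^sub>0 $ i $ j)" for i j
      by (rule 2)
    show "C1_wrt real_coords (S \<times> S) (\<lambda>z. axis j 1 $ i)" for i
      by (rule C1_wrt_const)
    fix z assume z: "z \<in> S \<times> S"
    then have "snd z \<in> S"
      by auto
    with s\<^sub>0 show "invertible (L (snd z) s\<^sub>0)"
      by (rule invertible_L)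
    have "L (snd z) s\<^sub>0 *v (L s\<^sub>0 (snd z) *v axis j 1) = axis j 1"
      using L_comp[OF \<open>snd z \<in> S\<close> s\<^sub>0 \<open>snd z \<in> S\<close>] L_refl[OF \<open>snd z \<in> S\<close>]
      by (simp add: matrix_vector_mul_assoc)
    then show "L (snd z) s\<^sub>0 *v column j (L s\<^sub>0 (snd z)) = axis j 1"
      by (simp add: matrix_mult_axis)
  qed
  have "C1_wrt real_coords (S \<times> S) (\<lambda>z. \<Sum>k\<in>UNIV. L (fst z) s\<^sub>0 $ i $ k * column j (L s\<^sub>0 (snd z)) $ k)" for i j
    by (intro C1_wrt_sum C1_wrt_mult 1 3) simp
  then have "C1_wrt real_coords (S \<times> S) (\<lambda>z. L (fst z) (snd z) $ i $ j)" for i j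
  proof (rule C1_wrt_cong)
    fix z assume "z \<in> S \<times> S"
    then have "L (fst z) s\<^sub>0 ** L s\<^sub>0 (snd z) = L (fst z) (snd z)"
      using s\<^sub>0 by (intro L_comp) auto
    then show "(\<Sum>k\<in>UNIV. L (fst z) s\<^sub>0 $ i $ k * column j (L s\<^sub>0 (snd z)) $ k) = L (fst z) (snd z) $ i $ j"
      by (auto simp: matrix_matrix_mult_def column_def vec_eq_iff)
  qed
  then show ?thesis
    by (rule C1_wrt_real_coords_matrix)
qed

lemma transport_matrix_derivatives:
  assumes I: "C1_linear_transport B I" and s: "s \<in> S"
  shows "\<exists>F. continuous_on S F \<and> (\<forall>t\<in>S. ((\<lambda>t. L t s) has_vector_derivative F t) (at t within J))"
    and "\<exists>F G. ((\<lambda>t. L t s) has_vector_derivative F) (at s within J) \<and>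
      ((\<lambda>t. L s t) has_vector_derivative G) (at s within J) \<and> (\<not> J \<subseteq> {s} \<longrightarrow> F + G = 0)"
proof -
  have "\<exists>F G. continuous_on (S \<times> S) F \<and> continuous_on (S \<times> S) G \<and>
    (\<forall>z\<in>S \<times> S. ((\<lambda>w. L (fst w) (snd w)) has_derivative
       (\<lambda>h. fst h *\<^sub>R F z + snd h *\<^sub>R G z)) (at z within S \<times> S))"
    using I frame path unfolding C1_linear_transport_def Let_def by blast
  then obtain F G where FG: "continuous_on (S \<times> S) F \<and> continuous_on (S \<times> S) G \<and>
    (\<forall>z\<in>S \<times> S. ((\<lambda>w. L (fst w) (snd w)) has_derivative
       (\<lambda>h. fst h *\<^sub>R F z + snd h *\<^sub>R G z)) (at z within S \<times> S))"
    by (elim exE)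
  \<comment> \<open>Restricts the two-parameter matrix function to a curve in
    \<open>S \<times> S\<close>. It is applied to the two coordinate lines through
    \<open>(s, s)\<close> and to the diagonal, where the matrix is the identity.\<close>
  have chain: "((\<lambda>t. L (a t) (b t)) has_vector_derivative a' *\<^sub>R F (a t, b t) + b' *\<^sub>R G (a t, b t)) (at t within J)"
    if ab: "(a has_vector_derivative a') (at t within S)" "(b has_vector_derivative b') (at t within S)"
      "a ` S \<subseteq> S" "b ` S \<subseteq> S" and t: "t \<in> S" for a b a' b' t
  proof -
    have "((\<lambda>t. (a t, b t)) has_derivative (\<lambda>h. (h *\<^sub>R a', h *\<^sub>R b'))) (at t within S)"
      using ab unfolding has_vector_derivative_def by (intro has_derivative_Pair)
    moreover have "((\<lambda>w. L (fst w) (snd w)) has_derivative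
       (\<lambda>h. fst h *\<^sub>R F (a t, b t) + snd h *\<^sub>R G (a t, b t))) (at (a t, b t) within (\<lambda>t. (a t, b t)) ` S)"
    proof (rule has_derivative_subset)
      show "((\<lambda>w. L (fst w) (snd w)) has_derivative
         (\<lambda>h. fst h *\<^sub>R F (a t, b t) + snd h *\<^sub>R G (a t, b t))) (at (a t, b t) within S \<times> S)"
        using FG ab t by blast
    qed (use ab in auto)
    ultimately have "((\<lambda>t. L (fst (a t, b t)) (snd (a t, b t))) has_derivative
        (\<lambda>h. fst (h *\<^sub>R a', h *\<^sub>R b') *\<^sub>R F (a t, b t) + snd (h *\<^sub>R a', h *\<^sub>R b') *\<^sub>R G (a t, b t))) (at t within S)"
      by (rule has_derivative_in_compose)
    then show ?thesis
      unfolding has_vector_derivative_def at_within_S[OF t] by (simp add: scaleR_add_right)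
  qed
  have id: "((\<lambda>t. t) has_vector_derivative 1) (at t within S)" for t :: real
    by (rule has_vector_derivative_id)
  have cn: "((\<lambda>t. s) has_vector_derivative 0) (at t within S)" for t :: real
    by (rule has_vector_derivative_const)
  have d1: "((\<lambda>t. L t s) has_vector_derivative F (t, s)) (at t within J)" if "t \<in> S" for t
    using chain[OF id cn _ _ that] s by auto
  have d2: "((\<lambda>t. L s t) has_vector_derivative G (s, s)) (at s within J)"
    using chain[OF cn id _ _ s] s by auto
  have "continuous_on S (\<lambda>t. F (t, s))"
    by (rule continuous_on_compose2[OF conjunct1[OF FG]]) (use s in \<open>auto intro!: continuous_intros\<close>)
  with d1 show "\<exists>F. continuous_on S F \<and> (\<forall>t\<in>S. ((\<lambda>t. L t s) has_vector_derivative F t) (at t within J))"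
    by (intro exI[of _ "\<lambda>t. F (t, s)"]) simp
  have "F (s, s) + G (s, s) = 0" if "\<not> J \<subseteq> {s}"
  proof (rule vector_derivative_unique_within)
    have "s \<in> J"
      using s by simp
    then show "at s within J \<noteq> bot"
      using path that unfolding C1_path_def by (intro at_within_interval_neq_bot) simp_all
    show "((\<lambda>t. L t t) has_vector_derivative F (s, s) + G (s, s)) (at s within J)"
      using chain[OF id id _ _ s] by simp
    have "((\<lambda>t. L t t) has_vector_derivative 0) (at s within S)"
      by (rule has_vector_derivative_transform[OF s L_refl has_vector_derivative_const])
    then show "((\<lambda>t. L t t) has_vector_derivative 0) (at s within J)"
      unfolding at_within_S[OF s] .
  qed
  with d1[OF s] d2 show "\<exists>F G. ((\<lambda>t. L t s) has_vector_derivative F) (at s within J) \<and>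
      ((\<lambda>t. L s t) has_vector_derivative G) (at s within J) \<and> (\<not> J \<subseteq> {s} \<longrightarrow> F + G = 0)"
    by blast
qed

text \<open>Differentiating \<open>L t t = 1\<close> relates the two partial derivatives on the diagonal.\<close>

lemma has_transport_coefficients_iff:
  assumes I: "C1_linear_transport B I" and s: "s \<in> S"
  shows "has_transport_coefficients B e I J \<gamma> s C \<longleftrightarrow>
    (\<forall>p\<in>fibre B (\<gamma> s). ((\<lambda>t. fc (I J \<gamma> s t p)) has_vector_derivative - (C *v fc p)) (at s within J))"
\<comment> \<open>On a one-point interval both sides hold for every \<open>C\<close>.\<close>
proof (cases "J \<subseteq> {s}")
  case True
  then show ?thesis
    unfolding has_transport_coefficients_def by (simp add: has_vector_derivative_singleton)
next
  case False
  have "s \<in> J"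
    using s by simp
  then have nb: "at s within J \<noteq> bot"
    using path False unfolding C1_path_def by (intro at_within_interval_neq_bot) simp_all
  obtain F G where F: "((\<lambda>t. L t s) has_vector_derivative F) (at s within J)"
    and G: "((\<lambda>t. L s t) has_vector_derivative G) (at s within J)" and "F + G = 0"
    using transport_matrix_derivatives(2)[OF I s] False by blast
  then have FG: "F = - G"
    by (simp add: add_eq_0_iff2)
  have lift: "((\<lambda>t. fc (I J \<gamma> s t p)) has_vector_derivative F *v fc p) (at s within J)"
    if "p \<in> fibre B (\<gamma> s)" for p
  proof -
    have "((\<lambda>t. fc (I J \<gamma> s t p)) has_vector_derivative F *v fc p) (at s within S)"
    proof (rule has_vector_derivative_transform[OF s])
      show "((\<lambda>t. L t s *v fc p) has_vector_derivative F *v fc p) (at s within S)"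
        unfolding at_within_S[OF s] by (rule has_vector_derivative_matrix_vector_mult_const[OF F])
    qed (rule L_apply[OF s _ that])
    then show ?thesis
      unfolding at_within_S[OF s] .
  qed
  show ?thesis
  proof
    assume "has_transport_coefficients B e I J \<gamma> s C"
    then have "C = G"
      unfolding has_transport_coefficients_def using vector_derivative_unique_within[OF nb _ G] by blast
    then have "F *v k = - (C *v k)" for k
      using FG by (simp add: vec_eq_iff matrix_mult_component sum_negf)
    then show "\<forall>p\<in>fibre B (\<gamma> s). ((\<lambda>t. fc (I J \<gamma> s t p)) has_vector_derivative - (C *v fc p)) (at s within J)"
      using lift by simp
  next
    assume *: "\<forall>p\<in>fibre B (\<gamma> s). ((\<lambda>t. fc (I J \<gamma> s t p)) has_vector_derivative - (C *v fc p)) (at s within J)"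
    have "G *v k = C *v k" for k
    proof -
      obtain p where p: "p \<in> fibre B (\<gamma> s)" "fc p = k"
        using frame_components_surj[of "\<gamma> s" k] s by blast
      then have "F *v k = - (C *v k)"
        using vector_derivative_unique_within[OF nb lift[OF p(1)] bspec[OF * p(1)]] by simp
      then show ?thesis
        using FG by (simp add: vec_eq_iff matrix_mult_component sum_negf)
    qed
    then have "C = G"
      by (simp add: matrix_eq)
    with G show "has_transport_coefficients B e I J \<gamma> s C"
      unfolding has_transport_coefficients_def by simp
  qed
qed

end

context C1_vbundle
begin

text \<open>Being C1 in both parameters is reduced to the regularity of single orbits, which is what
  horizontal lifts provide.\<close>

lemma C1_linear_transportI:
  assumes lin: "linear_transport B I"
    and lifts: "\<And>J \<gamma> s p. base_path B J \<gamma> \<Longrightarrow> s \<in> J \<Longrightarrow> p \<in> fibre B (\<gamma> s) \<Longrightarrow>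
      C1_path (total_space B) (total_atlas B) J (\<lambda>t. I J \<gamma> s t p)"
  shows "C1_linear_transport B I"
  unfolding C1_linear_transport_def Let_def
proof (intro conjI lin allI impI)
  fix U e J \<gamma> assume *: "frame B U e \<and> base_path B J \<gamma>"
  interpret frame_transport B U e I J \<gamma>
    by unfold_locales (use * lin in auto)
  show "\<exists>F G. continuous_on (S \<times> S) F \<and> continuous_on (S \<times> S) G \<and>
    (\<forall>z\<in>S \<times> S. ((\<lambda>w. L (fst w) (snd w)) has_derivative
       (\<lambda>h. fst h *\<^sub>R F z + snd h *\<^sub>R G z)) (at z within S \<times> S))"
    by (rule C1_transport_matrix[OF lifts[OF path]])
qed

end

subsection \<open>Horizontal vectors\<close>

lemma (in C1_mfd) tangent_vec_sum:
  assumes "c \<in> A" "p \<in> fst c" "finite M"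
  shows "tangent_vec c p (\<Sum>i\<in>M. f i) = (\<Sum>i\<in>M. tangent_vec c p (f i))"
  using assms(3)
proof (induction M)
  case empty
  show ?case
    using tangent_vec_add[OF assms(1,2), of 0 0] by simp
qed (simp add: tangent_vec_add[OF assms(1,2)])

lemma (in C1_mfd) C1_path_cong:
  assumes \<gamma>: "C1_path X A J \<gamma>" and eq: "\<And>s. s \<in> J \<Longrightarrow> \<gamma>' s = \<gamma> s"
  shows "C1_path X A J \<gamma>'"
  unfolding C1_path_def
proof (intro conjI ballI)
  show "is_interval J"
    using \<gamma> unfolding C1_path_def by (elim conjE)
  have *: "\<gamma> ` J \<subseteq> X" "continuous_on J \<gamma>"
    using \<gamma> unfolding C1_path_def by simp_all
  show "\<gamma>' ` J \<subseteq> X"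
    using *(1) eq by auto
  show "continuous_on J \<gamma>'"
    by (rule continuous_on_eq[OF *(2)]) (simp add: eq)
  fix c assume c: "c \<in> A"
  obtain g where g: "continuous_on (J \<inter> \<gamma> -` fst c) g \<and>
      (\<forall>s\<in>J \<inter> \<gamma> -` fst c. (snd c \<circ> \<gamma> has_vector_derivative g s) (at s within J))"
    using C1_path_chart[OF \<gamma> c] by (elim exE)
  have S: "J \<inter> \<gamma>' -` fst c = J \<inter> \<gamma> -` fst c"
    using eq by auto
  have "(snd c \<circ> \<gamma>' has_vector_derivative g s) (at s within J)" if "s \<in> J \<inter> \<gamma> -` fst c" for s
    by (rule has_vector_derivative_transform[of s J _ "snd c \<circ> \<gamma>"]) (use g that eq in auto)
  with g show "\<exists>g. continuous_on (J \<inter> \<gamma>' -` fst c) g \<and>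
      (\<forall>s\<in>J \<inter> \<gamma>' -` fst c. (snd c \<circ> \<gamma>' has_vector_derivative g s) (at s within J))"
    unfolding S by (intro exI[of _ g]) simp
qed

context C1_coords
begin

text \<open>For \<open>w\<close> the velocity components of a path, the right-hand side of the
  representation of its transport coefficients.\<close>

definition coeff_matrix :: "('r \<Rightarrow> 'r \<Rightarrow> 'n \<Rightarrow> 'm \<Rightarrow> 'k) \<Rightarrow> 'm \<Rightarrow> 'k ^ 'n \<Rightarrow> 'k ^ 'r ^ 'r" where
  "coeff_matrix \<Gamma> x w = (\<chi> a b. \<Sum>\<mu>\<in>UNIV. \<Gamma> a b \<mu> x * w $ \<mu>)"

text \<open>The horizontal vector at \<open>p\<close> over the base vector with components \<open>w\<close>, for the connection
  with 3-index coefficients \<open>\<Gamma>\<close>.\<close>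

definition hvec :: "('r \<Rightarrow> 'r \<Rightarrow> 'n \<Rightarrow> 'm \<Rightarrow> 'k) \<Rightarrow> 'e \<Rightarrow> 'k ^ 'n \<Rightarrow> ('e, 'k, 'n + 'r) tvec" where
  "hvec \<Gamma> p w = total.tangent_vec u p (join w (- (coeff_matrix \<Gamma> (proj B p) w *v fc p)))"

lemma coeff_matrix_linear:
  "coeff_matrix \<Gamma> x (w + w') *v k = coeff_matrix \<Gamma> x w *v k + coeff_matrix \<Gamma> x w' *v k"
  "coeff_matrix \<Gamma> x (l *s w) *v k = l *s (coeff_matrix \<Gamma> x w *v k)"
  by (simp_all add: coeff_matrix_def vec_eq_iff matrix_mult_component algebra_simps sum.distrib
      sum_distrib_left)

lemma hvec:
  assumes p: "p \<in> fst u"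
  shows hvec_tangent: "hvec \<Gamma> p w \<in> tangent_space (total_atlas B) p"
    and hvec_u: "hvec \<Gamma> p w u = join w (- (coeff_matrix \<Gamma> (proj B p) w *v fc p))"
    and hvec_add: "hvec \<Gamma> p (w + w') = hvec \<Gamma> p w + hvec \<Gamma> p w'"
    and hvec_scale: "hvec \<Gamma> p (k *s w) = tscale k (hvec \<Gamma> p w)"
proof -
  note tv = total.tangent_vec_in[OF u_in_atlas p] total.tangent_vec_chart[OF u_in_atlas p]
    total.tangent_vec_add[OF u_in_atlas p, symmetric] total.tangent_vec_scale[OF u_in_atlas p, symmetric]
  show "hvec \<Gamma> p w \<in> tangent_space (total_atlas B) p"
    and "hvec \<Gamma> p w u = join w (- (coeff_matrix \<Gamma> (proj B p) w *v fc p))"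
    unfolding hvec_def by (rule tv)+
  show "hvec \<Gamma> p (w + w') = hvec \<Gamma> p w + hvec \<Gamma> p w'"
    unfolding hvec_def tv coeff_matrix_linear
    by (rule arg_cong[where f = "total.tangent_vec u p"]) (simp add: vec_sum_eq_iff)
  show "hvec \<Gamma> p (k *s w) = tscale k (hvec \<Gamma> p w)"
    unfolding hvec_def tv coeff_matrix_linear
    by (rule arg_cong[where f = "total.tangent_vec u p"]) (simp add: vec_sum_eq_iff)
qed

lemma hvec_0:
  assumes "p \<in> fst u"
  shows "hvec \<Gamma> p 0 = 0"
  using hvec_add[OF assms, of \<Gamma> 0 0] by simp

lemma adapted_vector_eq:
  assumes p: "p \<in> fst u"
  shows "coord_vector (total_atlas B) u (Inl \<mu>) p
    + (\<Sum>a\<in>UNIV. tscale (- (\<Sum>b\<in>UNIV. \<Gamma> a b \<mu> (proj B p) * fc p $ b))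
         (coord_vector (total_atlas B) u (Inr a) p)) = hvec \<Gamma> p (axis \<mu> 1)"
proof -
  let ?k = "\<lambda>a. - (\<Sum>b\<in>UNIV. \<Gamma> a b \<mu> (proj B p) * fc p $ b)"
  have "join (axis \<mu> 1) (- (coeff_matrix \<Gamma> (proj B p) (axis \<mu> 1) *v fc p)) =
      axis (Inl \<mu>) 1 + (\<Sum>a\<in>UNIV. ?k a *s axis (Inr a) 1)"
    by (simp add: vec_sum_eq_iff coeff_matrix_def matrix_mult_component axis_def sum_negf
        if_distrib[where f = "\<lambda>z. _ * z"] cong: if_cong)
  then show ?thesis
    unfolding hvec_def total.coord_vector_eq
    by (simp only: total.tangent_vec_add[OF u_in_atlas p] total.tangent_vec_sum[OF u_in_atlas p finite]
        total.tangent_vec_scale[OF u_in_atlas p])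
qed

text \<open>From here on the frame adapted to the coordinates appears only through the values of
  \<open>hvec\<close> on the standard basis.\<close>

lemma three_index_coefficients_iff:
  "three_index_coefficients B H U e c \<Gamma> \<longleftrightarrow> (\<forall>p\<in>fst u. \<forall>\<mu>. hvec \<Gamma> p (axis \<mu> 1) \<in> H p)"
  unfolding three_index_coefficients_def two_index_coefficients_def Let_def
  by (rule ball_cong[OF refl]) (simp only: adapted_vector_eq)

lemma hvec_in_subspace:
  assumes p: "p \<in> fst u" and H: "tvec.subspace (H p)"
    and \<Gamma>: "three_index_coefficients B H U e c \<Gamma>"
  shows "hvec \<Gamma> p w \<in> H p"
proof -
  have sum: "hvec \<Gamma> p (\<Sum>i\<in>M. f i) = (\<Sum>i\<in>M. hvec \<Gamma> p (f i))" if "finite M" for M :: "'n set" and f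
    using that by (induction M) (simp_all add: hvec_add[OF p] hvec_0[OF p])
  have "w = (\<Sum>\<mu>\<in>UNIV. w $ \<mu> *s axis \<mu> 1)"
    by (simp add: vec_eq_iff axis_def if_distrib[where f = "\<lambda>z. _ * z"] cong: if_cong)
  then have "hvec \<Gamma> p w = (\<Sum>\<mu>\<in>UNIV. tscale (w $ \<mu>) (hvec \<Gamma> p (axis \<mu> 1)))"
    using sum[of UNIV "\<lambda>\<mu>. w $ \<mu> *s axis \<mu> 1"] by (simp add: hvec_scale[OF p])
  also have "\<dots> \<in> H p"
    using \<Gamma> p unfolding three_index_coefficients_iff
    by (intro tvec.subspace_sum[OF H] tvec.subspace_scale[OF H]) blast
  finally show ?thesis .
qed

end

subsection \<open>Horizontal lifts\<close>

context C1_vbundle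
begin

lemma connection_at:
  assumes "connection B H" "p \<in> total_space B"
  shows connection_subspace: "tvec.subspace (H p)"
    and connection_Int: "H p \<inter> vertical_space B p = {0}"
    and connection_tangent: "H p \<subseteq> tangent_space (total_atlas B) p"
proof -
  note H = bspec[OF conjunct1[OF assms(1)[unfolded connection_def]] assms(2)]
  show 1: "tvec.subspace (H p)"
    using H by (elim conjE)
  show 2: "H p \<inter> vertical_space B p = {0}"
    using H by (elim conjE)
  have 3: "{v + h | v h. v \<in> vertical_space B p \<and> h \<in> H p} = tangent_space (total_atlas B) p"
    using H by (elim conjE)
  \<comment> \<open>Vertical vectors are defined as velocities of paths; that 0 is one of them is
    read off from the intersection condition.\<close>
  have 0: "0 \<in> vertical_space B p"
    using 2 by blast
  show "H p \<subseteq> tangent_space (total_atlas B) p"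
    unfolding 3[symmetric]
  proof
    fix h assume "h \<in> H p"
    with 0 show "h \<in> {v + h | v h. v \<in> vertical_space B p \<and> h \<in> H p}"
      by (intro CollectI exI[of _ 0] exI[of _ h] conjI add_0_left[symmetric])
  qed
qed

text \<open>The difference of two horizontal vectors with the same base part is also vertical, hence
  zero. So the 3-index coefficients determine the horizontal vectors.\<close>

lemma (in C1_coords) horizontal_eq_hvec:
  assumes H: "connection B H" and \<Gamma>: "three_index_coefficients B H U e c \<Gamma>"
    and p: "p \<in> fst u" and v: "v \<in> H p"
  shows "v = hvec \<Gamma> p (lft (v u))"
proof -
  have pt: "p \<in> total_space B"
    using p by (simp add: fst_u)
  note H' = connection_at[OF H pt]
  let ?h = "hvec \<Gamma> p (lft (v u))"
  have "v - ?h \<in> H p"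
    by (intro tvec.subspace_diff[OF H'(1) v] hvec_in_subspace[OF p H'(1) \<Gamma>])
  moreover have "v - ?h \<in> vertical_space B p"
    unfolding vertical_space_eq[OF p]
    using H'(3) v tvec.subspace_diff[OF total.subspace_tangent_space[OF pt] _ hvec_tangent[OF p]]
    by (auto simp: hvec_u[OF p])
  ultimately have "v - ?h = 0"
    using H'(2) by blast
  then show ?thesis
    by simp
qed

lemma horizontal_lift_fibre: "horizontal_lift B H J \<gamma> \<delta> \<Longrightarrow> s \<in> J \<Longrightarrow> \<delta> s \<in> fibre B (\<gamma> s)"
  unfolding horizontal_lift_def C1_path_def fibre_iff by blast

lemma connection_lift:
  assumes "connection B H" "base_path B J \<gamma>" "s \<in> J" "p \<in> fibre B (\<gamma> s)"
  obtains \<delta> where "horizontal_lift B H J \<gamma> \<delta>" "\<delta> s = p"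
  using assms unfolding connection_def by blast

lemma connection_lift_unique:
  assumes "connection B H" "base_path B J \<gamma>" "horizontal_lift B H J \<gamma> \<delta>" "horizontal_lift B H J \<gamma> \<delta>'"
    and "s \<in> J" "\<delta> s = \<delta>' s" "t \<in> J"
  shows "\<delta> t = \<delta>' t"
proof -
  obtain \<eta> where \<eta>: "\<forall>\<delta>'. horizontal_lift B H J \<gamma> \<delta>' \<and> \<delta>' s = \<delta> s \<longrightarrow> (\<forall>t\<in>J. \<delta>' t = \<eta> t)"
    using assms(1,2,5) horizontal_lift_fibre[OF assms(3,5)] unfolding connection_def by blast
  have "\<delta> t = \<eta> t"
    using \<eta> assms(3,7) by blast
  moreover have "\<delta>' t = \<eta> t"
    using \<eta> assms(4,7) assms(6)[symmetric] by blast
  ultimately show ?thesis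
    by simp
qed

lemma has_velocity_subset:
  assumes "has_velocity A J \<delta> s v" "J' \<subseteq> J"
  shows "has_velocity A J' \<delta> s v"
  using assms unfolding has_velocity_def by (blast intro: has_vector_derivative_within_subset)

lemma horizontal_lift_subset:
  assumes "horizontal_lift B H J \<gamma> \<delta>" "J' \<subseteq> J" "is_interval J'"
  shows "horizontal_lift B H J' \<gamma> \<delta>"
  using assms total.C1_path_subset[OF _ assms(2,3)] has_velocity_subset[OF _ assms(2)]
  unfolding horizontal_lift_def by (meson subsetD)

lemma interval_Icc_subset: "is_interval J \<Longrightarrow> s \<in> J \<Longrightarrow> t \<in> J \<Longrightarrow> {s..t} \<subseteq> J" for s t :: real
  unfolding is_interval_1 subset_iff atLeastAtMost_iff by blast

text \<open>The restriction of a lift over \<open>J\<close> to \<open>{s..t}\<close> is a lift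
  there, and by uniqueness it is the one that defines parallel transport.\<close>

lemma parallel_transport_lift:
  assumes H: "connection B H" and \<gamma>: "base_path B J \<gamma>" and \<delta>: "horizontal_lift B H J \<gamma> \<delta>"
    and st: "s \<in> J" "t \<in> J" "s \<le> t"
  shows "parallel_transport B H s t \<gamma> (\<delta> s) = \<delta> t"
proof -
  have sub: "{s..t} \<subseteq> J"
    using \<gamma> st unfolding C1_path_def by (intro interval_Icc_subset) blast+
  have int: "is_interval {s..t}"
    by (rule is_interval_cc)
  have \<gamma>': "base_path B {s..t} \<gamma>"
    by (rule base.C1_path_subset[OF \<gamma> sub int])
  have \<delta>': "horizontal_lift B H {s..t} \<gamma> \<delta>"
    by (rule horizontal_lift_subset[OF \<delta> sub int])
  show ?thesis
    unfolding parallel_transport_def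
  proof (rule the_equality)
    show "\<exists>\<eta>. horizontal_lift B H {s..t} \<gamma> \<eta> \<and> \<eta> s = \<delta> s \<and> \<eta> t = \<delta> t"
      using \<delta>' by blast
    fix q assume "\<exists>\<eta>. horizontal_lift B H {s..t} \<gamma> \<eta> \<and> \<eta> s = \<delta> s \<and> \<eta> t = q"
    then obtain \<eta> where \<eta>: "horizontal_lift B H {s..t} \<gamma> \<eta>" "\<eta> s = \<delta> s" "\<eta> t = q"
      by blast
    then show "q = \<delta> t"
      using connection_lift_unique[OF H \<gamma>' \<eta>(1) \<delta>', of s t] st(3) by simp
  qed
qed

text \<open>All properties of parallel transport along paths are obtained by evaluating lifts in
  this way. For \<open>t < s\<close> the definition uses \<open>inv_into\<close>, which is a genuine
  inverse at \<open>\<delta> s\<close> since two lifts that agree at \<open>s\<close> agree at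
  \<open>t\<close>.\<close>

lemma parallel_transport_along_lift:
  assumes H: "connection B H" and \<gamma>: "base_path B J \<gamma>" and \<delta>: "horizontal_lift B H J \<gamma> \<delta>"
    and st: "s \<in> J" "t \<in> J"
  shows "parallel_transport_along B H J \<gamma> s t (\<delta> s) = \<delta> t"
proof (cases "s \<le> t")
  case True
  then show ?thesis
    using parallel_transport_lift[OF assms] by (simp add: parallel_transport_along_def)
next
  case False
  have "inv_into (fibre B (\<gamma> t)) (parallel_transport B H t s \<gamma>) (\<delta> s) = \<delta> t"
  proof (rule inv_into_f_eq)
    show "inj_on (parallel_transport B H t s \<gamma>) (fibre B (\<gamma> t))"
    proof (rule inj_onI)
      fix p q assume p: "p \<in> fibre B (\<gamma> t)" and q: "q \<in> fibre B (\<gamma> t)"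
        and eq: "parallel_transport B H t s \<gamma> p = parallel_transport B H t s \<gamma> q"
      obtain \<eta> where \<eta>: "horizontal_lift B H J \<gamma> \<eta>" "\<eta> t = p"
        using connection_lift[OF H \<gamma> st(2) p] .
      obtain \<theta> where \<theta>: "horizontal_lift B H J \<gamma> \<theta>" "\<theta> t = q"
        using connection_lift[OF H \<gamma> st(2) q] .
      have "\<eta> s = \<theta> s"
        using parallel_transport_lift[OF H \<gamma> \<eta>(1) st(2,1)] parallel_transport_lift[OF H \<gamma> \<theta>(1) st(2,1)]
          eq \<eta>(2) \<theta>(2) False by simp
      from connection_lift_unique[OF H \<gamma> \<eta>(1) \<theta>(1) st(1) this st(2)] show "p = q"
        using \<eta>(2) \<theta>(2) by simp
    qed
    show "\<delta> t \<in> fibre B (\<gamma> t)"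
      by (rule horizontal_lift_fibre[OF \<delta> st(2)])
    show "parallel_transport B H t s \<gamma> (\<delta> t) = \<delta> s"
      using parallel_transport_lift[OF H \<gamma> \<delta> st(2,1)] False by simp
  qed
  with False show ?thesis
    by (simp add: parallel_transport_along_def)
qed

section \<open>Parallel transport as a linear transport of class C1\<close>

lemma parallel_transport_along_paths:
  assumes H: "connection B H"
  shows "transport_along_paths B (parallel_transport_along B H)" (is "transport_along_paths B ?P")
  unfolding transport_along_paths_def
proof (intro allI impI conjI ballI)
  fix J \<gamma> assume \<gamma>: "base_path B J \<gamma>"
  \<comment> \<open>An orbit of \<open>?P\<close> is one horizontal lift over all of
    \<open>J\<close>, which turns the transport laws into statements about values of a single
    function.\<close>
  have lift: "\<exists>\<delta>. horizontal_lift B H J \<gamma> \<delta> \<and> (\<forall>t\<in>J. ?P J \<gamma> s t p = \<delta> t) \<and> \<delta> s = p"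
    if sp: "s \<in> J" "p \<in> fibre B (\<gamma> s)" for s p
  proof -
    obtain \<delta> where \<delta>: "horizontal_lift B H J \<gamma> \<delta>" "\<delta> s = p"
      using connection_lift[OF H \<gamma> sp] .
    then show ?thesis
      using parallel_transport_along_lift[OF H \<gamma> \<delta>(1) sp(1)] by auto
  qed
  {
    fix \<gamma>' s t p assume eq: "\<forall>s\<in>J. \<gamma>' s = \<gamma> s" and st: "s \<in> J" "t \<in> J" and p: "p \<in> fibre B (\<gamma> s)"
    obtain \<delta> where \<delta>: "horizontal_lift B H J \<gamma> \<delta>" "\<forall>t\<in>J. ?P J \<gamma> s t p = \<delta> t" "\<delta> s = p"
      using lift[OF st(1) p] by blast
    have \<gamma>': "base_path B J \<gamma>'"
      using base.C1_path_cong[OF \<gamma>] eq by blast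
    \<comment> \<open>A horizontal lift refers to the path only through its values on
      \<open>J\<close>, so the same \<delta> serves both paths.\<close>
    have "horizontal_lift B H J \<gamma>' \<delta>"
      using \<delta>(1) eq unfolding horizontal_lift_def by simp
    from parallel_transport_along_lift[OF H \<gamma>' this st] show "?P J \<gamma>' s t p = ?P J \<gamma> s t p"
      using \<delta>(2,3) st by simp
  }
  {
    fix s t assume st: "s \<in> J" "t \<in> J"
    show "?P J \<gamma> s t ` fibre B (\<gamma> s) \<subseteq> fibre B (\<gamma> t)"
    proof
      fix q assume "q \<in> ?P J \<gamma> s t ` fibre B (\<gamma> s)"
      then obtain p where p: "p \<in> fibre B (\<gamma> s)" "q = ?P J \<gamma> s t p"
        by blast
      obtain \<delta> where "horizontal_lift B H J \<gamma> \<delta>" "\<forall>t\<in>J. ?P J \<gamma> s t p = \<delta> t" "\<delta> s = p"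
        using lift[OF st(1) p(1)] by blast
      then show "q \<in> fibre B (\<gamma> t)"
        using p(2) st(2) horizontal_lift_fibre by metis
    qed
  }
  {
    fix r s t p assume rst: "r \<in> J" "s \<in> J" "t \<in> J" and p: "p \<in> fibre B (\<gamma> r)"
    obtain \<delta> where \<delta>: "horizontal_lift B H J \<gamma> \<delta>" "\<forall>t\<in>J. ?P J \<gamma> r t p = \<delta> t" "\<delta> r = p"
      using lift[OF rst(1) p(1)] by blast
    then show "?P J \<gamma> s t (?P J \<gamma> r s p) = ?P J \<gamma> r t p"
      using parallel_transport_along_lift[OF H \<gamma> \<delta>(1) rst(2,3)] rst by simp
  }
  {
    fix s p assume s: "s \<in> J" and p: "p \<in> fibre B (\<gamma> s)"
    then show "?P J \<gamma> s s p = p"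
      using lift[OF s p] by auto
  }
qed

lemma parallel_transport_linear:
  assumes H: "linear_connection B H"
  shows "linear_transport B (parallel_transport_along B H)" (is "linear_transport B ?P")
  unfolding linear_transport_def
proof (intro conjI allI impI ballI)
  have H': "connection B H"
    using H unfolding linear_connection_def by blast
  show P: "transport_along_paths B ?P"
    by (rule parallel_transport_along_paths[OF H'])
  fix J \<gamma> s t assume \<gamma>: "base_path B J \<gamma>" and st: "s \<in> J" "t \<in> J"
  have int: "is_interval J"
    using \<gamma> unfolding C1_path_def by blast
  have forward: "fibre_linear B (\<gamma> s) (\<gamma> t) (?P J \<gamma> s t)" if st: "s \<in> J" "t \<in> J" "s \<le> t" for s t
  proof -
    have "base_path B {s..t} \<gamma>"
      by (rule base.C1_path_subset[OF \<gamma> interval_Icc_subset[OF int st(1,2)] is_interval_cc])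
    then have "fibre_linear B (\<gamma> s) (\<gamma> t) (parallel_transport B H s t \<gamma>)"
      using H st(3) unfolding linear_connection_def by blast
    then show ?thesis
      using st(3) by (simp add: parallel_transport_along_def)
  qed
  show "fibre_linear B (\<gamma> s) (\<gamma> t) (?P J \<gamma> s t)"
  proof (cases "s \<le> t")
    case True
    with forward[OF st] show ?thesis .
  next
    case False
    then have bwd: "fibre_linear B (\<gamma> t) (\<gamma> s) (?P J \<gamma> t s)"
      by (intro forward st) simp
    \<comment> \<open>Backward transport inherits linearity: the forward one, being linear, sends
      the sum of the transported vectors to the sum of the original ones, and transporting back
      gives the claim. Multiples are treated alike.\<close>
    have inv: "?P J \<gamma> s t (?P J \<gamma> t s p) = p" if "p \<in> fibre B (\<gamma> t)" for p
      using transport_comp[OF P \<gamma> st(2,1) that st(2)] transport_refl[OF P \<gamma> st(2,2) that] by simp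
    have inv': "?P J \<gamma> t s (?P J \<gamma> s t p) = p" if "p \<in> fibre B (\<gamma> s)" for p
      using transport_comp[OF P \<gamma> st that st(1)] transport_refl[OF P \<gamma> st(1,1) that] by simp
    have in_fib: "?P J \<gamma> s t p \<in> fibre B (\<gamma> t)" if "p \<in> fibre B (\<gamma> s)" for p
      by (rule transport_in_fibre[OF P \<gamma> st that])
    note ops = fibre_ops[OF base_path_in[OF \<gamma> st(2)]]
    show ?thesis
      unfolding fibre_linear_def
    proof (intro conjI ballI allI)
      show "?P J \<gamma> s t ` fibre B (\<gamma> s) \<subseteq> fibre B (\<gamma> t)"
        using in_fib by blast
      fix p assume p: "p \<in> fibre B (\<gamma> s)"
      {
        fix q assume q: "q \<in> fibre B (\<gamma> s)"
        have "?P J \<gamma> t s (fadd B (?P J \<gamma> s t p) (?P J \<gamma> s t q)) = fadd B p q"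
          using bwd in_fib[OF p] in_fib[OF q] unfolding fibre_linear_def
          by (metis inv'[OF p] inv'[OF q])
        then show "?P J \<gamma> s t (fadd B p q) = fadd B (?P J \<gamma> s t p) (?P J \<gamma> s t q)"
          using inv[OF ops(2)[OF in_fib[OF p] in_fib[OF q]]] by simp
      }
      fix k
      have "?P J \<gamma> t s (fscale B k (?P J \<gamma> s t p)) = fscale B k p"
        using bwd in_fib[OF p] unfolding fibre_linear_def by (metis inv'[OF p])
      then show "?P J \<gamma> s t (fscale B k p) = fscale B k (?P J \<gamma> s t p)"
        using inv[OF ops(3)[OF in_fib[OF p]], of k] by simp
    qed
  qed
qed

lemma parallel_transport_C1:
  assumes H: "linear_connection B H"
  shows "C1_linear_transport B (parallel_transport_along B H)"
proof (rule C1_linear_transportI[OF parallel_transport_linear[OF H]])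
  have H': "connection B H"
    using H unfolding linear_connection_def by blast
  fix J \<gamma> s p assume \<gamma>: "base_path B J \<gamma>" and s: "s \<in> J" and p: "p \<in> fibre B (\<gamma> s)"
  obtain \<delta> where \<delta>: "horizontal_lift B H J \<gamma> \<delta>" "\<delta> s = p"
    using connection_lift[OF H' \<gamma> s p] .
  show "C1_path (total_space B) (total_atlas B) J (\<lambda>t. parallel_transport_along B H J \<gamma> s t p)"
  proof (rule total.C1_path_cong[of J \<delta>])
    show "C1_path (total_space B) (total_atlas B) J \<delta>"
      using \<delta>(1) unfolding horizontal_lift_def by blast
    show "parallel_transport_along B H J \<gamma> s t p = \<delta> t" if "t \<in> J" for t
      using parallel_transport_along_lift[OF H' \<gamma> \<delta>(1) s that] \<delta>(2) by simp
  qed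
qed

section \<open>The coefficients of a parallel transport\<close>

lemma (in C1_coords) u_derivative:
  assumes "(snd u \<circ> \<delta> has_vector_derivative v) (at s within J)"
  shows "((\<lambda>t. fc (\<delta> t)) has_vector_derivative rgt v) (at s within J)"
    and "s \<in> J \<Longrightarrow> (\<And>t. t \<in> J \<Longrightarrow> proj B (\<delta> t) = \<gamma> t) \<Longrightarrow>
      (snd c \<circ> \<gamma> has_vector_derivative lft v) (at s within J)"
proof -
  show "((\<lambda>t. fc (\<delta> t)) has_vector_derivative rgt v) (at s within J)"
    using bounded_linear.has_vector_derivative[OF bounded_linear_rgt assms] by (simp add: snd_u)
  assume s: "s \<in> J" and eq: "\<And>t. t \<in> J \<Longrightarrow> proj B (\<delta> t) = \<gamma> t"
  show "(snd c \<circ> \<gamma> has_vector_derivative lft v) (at s within J)"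
    by (rule has_vector_derivative_transform[OF s _
          bounded_linear.has_vector_derivative[OF bounded_linear_lft assms]]) (simp add: snd_u eq)
qed

text \<open>The velocity of the lift through \<open>p\<close> is horizontal and lies over the
  velocity of \<gamma>, hence is the corresponding \<open>hvec\<close>. Its fibre part is the
  derivative of the frame components that characterizes the coefficients.\<close>

lemma (in C1_coords) parallel_transport_coefficients:
  assumes H: "linear_connection B H" and \<Gamma>: "three_index_coefficients B H U e c \<Gamma>"
  shows "coefficients_representation B U e c (parallel_transport_along B H) \<Gamma>"
  unfolding coefficients_representation_def
proof (intro allI impI ballI)
  have H': "connection B H"
    using H unfolding linear_connection_def by blast
  fix J \<gamma> s assume \<gamma>: "base_path B J \<gamma>" and s: "s \<in> J" "\<gamma> s \<in> U \<inter> fst c"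
  let ?P = "parallel_transport_along B H"
  let ?w = "vector_derivative (snd c \<circ> \<gamma>) (at s within J)"
  interpret frame_transport B U e ?P J \<gamma>
    by unfold_locales (rule parallel_transport_linear[OF H], rule \<gamma>)
  have "has_transport_coefficients B e ?P J \<gamma> s (coeff_matrix \<Gamma> (\<gamma> s) ?w)"
  proof (cases "J \<subseteq> {s}")
    case True
    then show ?thesis
      unfolding has_transport_coefficients_def by (rule has_vector_derivative_singleton)
  next
    case False
    then have nb: "at s within J \<noteq> bot"
      using \<gamma> s(1) unfolding C1_path_def by (intro at_within_interval_neq_bot) simp_all
    have sS: "s \<in> S"
      using s by simp
    show ?thesis
      unfolding has_transport_coefficients_iff[OF parallel_transport_C1[OF H] sS]
    proof
      fix p assume p: "p \<in> fibre B (\<gamma> s)"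
      then have pu: "p \<in> fst u"
        using s fibre_u by blast
      obtain \<delta> where \<delta>: "horizontal_lift B H J \<gamma> \<delta>" "\<delta> s = p"
        using connection_lift[OF H' \<gamma> s(1) p] .
      obtain v where v: "v \<in> H p" "has_velocity (total_atlas B) J \<delta> s v"
        using \<delta> s(1) unfolding horizontal_lift_def by metis
      have der: "(snd u \<circ> \<delta> has_vector_derivative v u) (at s within J)"
        using v(2) u_in_atlas pu \<delta>(2) unfolding has_velocity_def by blast
      have "lft (v u) = ?w"
      proof (rule vector_derivative_within[OF nb, symmetric])
        show "(snd c \<circ> \<gamma> has_vector_derivative lft (v u)) (at s within J)"
          using \<delta>(1) unfolding horizontal_lift_def by (intro u_derivative(2)[OF der s(1)]) blast
      qed
      with horizontal_eq_hvec[OF H' \<Gamma> pu v(1)] have "v = hvec \<Gamma> p ?w"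
        by simp
      then have "rgt (v u) = - (coeff_matrix \<Gamma> (\<gamma> s) ?w *v fc p)"
        using p by (simp add: hvec_u[OF pu] fibre_iff)
      then have "((\<lambda>t. fc (\<delta> t)) has_vector_derivative - (coeff_matrix \<Gamma> (\<gamma> s) ?w *v fc p)) (at s within J)"
        using u_derivative(1)[OF der] by simp
      then show "((\<lambda>t. fc (?P J \<gamma> s t p)) has_vector_derivative - (coeff_matrix \<Gamma> (\<gamma> s) ?w *v fc p)) (at s within J)"
      proof (rule has_vector_derivative_transform[OF s(1), rotated])
        show "fc (?P J \<gamma> s t p) = fc (\<delta> t)" if "t \<in> J" for t
          using parallel_transport_along_lift[OF H' \<gamma> \<delta>(1) s(1) that] \<delta>(2) by simp
      qed
    qed
  qed
  then show "has_transport_coefficients B e ?P J \<gamma> s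
      (\<chi> a b. \<Sum>\<mu>\<in>UNIV. \<Gamma> a b \<mu> (\<gamma> s) * ?w $ \<mu>)"
    unfolding coeff_matrix_def .
qed

end

subsection \<open>The connection generated by a transport\<close>

text \<open>Defined without coordinates, so that it makes sense on the whole total space at once.
  The paths start at parameter 0 of an interval of positive length, where the one-sided velocity is
  unique.\<close>

definition transport_horizontal ::
  "('e::t2_space, 'm::t2_space, 'k::{real_normed_field,euclidean_space}, 'n::finite, 'r::finite)
    vbundle \<Rightarrow> ('e, 'm) transport \<Rightarrow> ('e, 'k, 'n + 'r) distribution" where
  "transport_horizontal B I p =
     {v. \<exists>\<epsilon>>0. \<exists>\<gamma>. base_path B {0..\<epsilon>} \<gamma> \<and> p \<in> fibre B (\<gamma> 0) \<and>
           has_velocity (total_atlas B) {0..\<epsilon>} (\<lambda>t. I {0..\<epsilon>} \<gamma> 0 t p) 0 v}"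

text \<open>A frame or a chart on the whole base need not exist; the representation is therefore
  given on a family of domains that cover it, with separate functions on each.\<close>

locale transport_cover = C1_vbundle B
  for B :: "('e::t2_space, 'm::t2_space, 'k::{real_normed_field,euclidean_space},
    'n::finite, 'r::finite) vbundle" +
  fixes I :: "('e, 'm) transport" and M :: "'i set" and UU :: "'i \<Rightarrow> 'm set"
    and ee :: "'i \<Rightarrow> 'r \<Rightarrow> 'm \<Rightarrow> 'e" and cc :: "'i \<Rightarrow> ('m, 'k, 'n) chart"
    and GG :: "'i \<Rightarrow> 'r \<Rightarrow> 'r \<Rightarrow> 'n \<Rightarrow> 'm \<Rightarrow> 'k"
  assumes I: "C1_linear_transport B I"
    and coords: "i \<in> M \<Longrightarrow> C1_coords B (UU i) (ee i) (cc i)"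
    and repr: "i \<in> M \<Longrightarrow> coefficients_representation B (UU i) (ee i) (cc i) I (GG i)"
    and covers: "base_space B \<subseteq> (\<Union>i\<in>M. UU i \<inter> fst (cc i))"
begin

lemma I_linear: "linear_transport B I"
  using I unfolding C1_linear_transport_def by (elim conjE)

lemma I_transport: "transport_along_paths B I"
  using I_linear unfolding linear_transport_def by (elim conjE)

lemma cover_point:
  assumes "x \<in> base_space B"
  obtains i where "i \<in> M" "x \<in> UU i" "x \<in> fst (cc i)"
  using covers assms by blast

text \<open>Near a parameter \<open>r\<close> the orbit has base part \<gamma> and frame components
  \<open>L t r\<close> applied to a constant vector, so it inherits regularity from the path and the
  matrix.\<close>

lemma lift_C1:
  assumes \<gamma>: "base_path B J \<gamma>" and s: "s \<in> J" and p: "p \<in> fibre B (\<gamma> s)"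
  shows "C1_path (total_space B) (total_atlas B) J (\<lambda>t. I J \<gamma> s t p)" (is "C1_path _ _ _ ?\<delta>")
proof (rule total.C1_path_localI)
  show "is_interval J"
    using \<gamma> unfolding C1_path_def by (elim conjE)
  have fib: "?\<delta> t \<in> fibre B (\<gamma> t)" if "t \<in> J" for t
    by (rule transport_in_fibre[OF I_transport \<gamma> s that p])
  show "?\<delta> ` J \<subseteq> total_space B"
    using fib by (auto simp: fibre_iff)
  fix r assume r: "r \<in> J"
  obtain i where i: "i \<in> M" "\<gamma> r \<in> UU i" "\<gamma> r \<in> fst (cc i)"
    using cover_point[OF base_path_in[OF \<gamma> r]] .
  interpret C1_coords B "UU i" "ee i" "cc i"
    by (rule coords[OF i(1)])
  interpret frame_transport B "UU i" "ee i" I J \<gamma>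
    by unfold_locales (rule I_linear, rule \<gamma>)
  have rS: "r \<in> S"
    using r i by simp
  obtain F where F: "continuous_on S F \<and> (\<forall>t\<in>S. ((\<lambda>t. L t r) has_vector_derivative F t) (at t within J))"
    using transport_matrix_derivatives(1)[OF I rS] by (elim exE)
  obtain g where g: "continuous_on (J \<inter> \<gamma> -` fst (cc i)) g \<and>
      (\<forall>s\<in>J \<inter> \<gamma> -` fst (cc i). (snd (cc i) \<circ> \<gamma> has_vector_derivative g s) (at s within J))"
    using base.C1_path_chart[OF \<gamma> chart_c] by (elim exE)
  have op: "openin (top_of_set (base_space B)) (UU i \<inter> fst (cc i))"
    by (intro openin_Int openin_frame base.chart_domain chart_c)
  obtain N where N: "open N" "J \<inter> \<gamma> -` (UU i \<inter> fst (cc i)) = J \<inter> N"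
    using base.C1_path_preimage[OF \<gamma> op] .
  have JN: "J \<inter> N \<subseteq> S" "J \<inter> N \<subseteq> J \<inter> \<gamma> -` fst (cc i)"
    using N(2) by blast+
  let ?y = "fc (?\<delta> r)"
  let ?g = "\<lambda>t. join (g t) (F t *v ?y)"
  have fcL: "fc (?\<delta> t) = L t r *v ?y" if "t \<in> S" for t
  proof -
    \<comment> \<open>The orbit is restarted at \<open>r\<close>, since \<open>\<gamma> s\<close>
      may lie outside the domain of the frame used near \<open>r\<close>.\<close>
    have "?\<delta> t = I J \<gamma> r t (?\<delta> r)"
      using transport_comp[OF I_transport \<gamma> s r p, of t] that by simp
    then show ?thesis
      using L_apply[OF rS that fib[OF r]] by simp
  qed
  have "continuous_on (J \<inter> N) F"
    by (rule continuous_on_subset[OF conjunct1[OF F] JN(1)])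
  then have "continuous_on (J \<inter> N) (\<lambda>t. F t *v ?y)"
    unfolding matrix_vector_mult_def by (intro continuous_on_vec_lambda continuous_intros)
  from continuous_on_join[OF continuous_on_subset[OF conjunct1[OF g] JN(2)] this]
  have contg: "continuous_on (J \<inter> N) ?g" .
  have der: "(snd u \<circ> ?\<delta> has_vector_derivative ?g t) (at t within J)" if t: "t \<in> J \<inter> N" for t
  proof -
    have tS: "t \<in> S"
      using JN(1) t by (rule subsetD)
    have "(snd (cc i) \<circ> \<gamma> has_vector_derivative g t) (at t within J)"
      using g JN(2) t by blast
    moreover have "((\<lambda>t. L t r *v ?y) has_vector_derivative F t *v ?y) (at t within J)"
      by (rule has_vector_derivative_matrix_vector_mult_const) (use F tS in blast)
    ultimately have "((\<lambda>t. join ((snd (cc i) \<circ> \<gamma>) t) (L t r *v ?y)) has_vector_derivative ?g t) (at t within J)"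
      by (rule has_vector_derivative_join)
    then have "((\<lambda>t. join ((snd (cc i) \<circ> \<gamma>) t) (L t r *v ?y)) has_vector_derivative ?g t) (at t within S)"
      unfolding at_within_S[OF tS] .
    then have "(snd u \<circ> ?\<delta> has_vector_derivative ?g t) (at t within S)"
    proof (rule has_vector_derivative_transform[OF tS, rotated])
      fix t' assume t': "t' \<in> S"
      have "proj B (?\<delta> t') = \<gamma> t'"
        using fib[of t'] t' by (simp add: fibre_iff)
      then show "(snd u \<circ> ?\<delta>) t' = join ((snd (cc i) \<circ> \<gamma>) t') (L t' r *v ?y)"
        using fcL[OF t'] by (simp add: snd_u)
    qed
    then show ?thesis
      unfolding at_within_S[OF tS] .
  qed
  have sub: "?\<delta> ` (J \<inter> N) \<subseteq> fst u"
  proof (rule image_subsetI)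
    fix t assume t: "t \<in> J \<inter> N"
    then have "t \<in> J" "\<gamma> t \<in> UU i" "\<gamma> t \<in> fst (cc i)"
      using N(2) by blast+
    then show "?\<delta> t \<in> fst u"
      using fibre_u[OF fib] by simp
  qed
  have rN: "r \<in> N"
    using N(2) r i by blast
  show "\<exists>c\<in>total_atlas B. \<exists>N g. open N \<and> r \<in> N \<and> ?\<delta> ` (J \<inter> N) \<subseteq> fst c \<and>
      continuous_on (J \<inter> N) g \<and>
      (\<forall>t\<in>J \<inter> N. (snd c \<circ> ?\<delta> has_vector_derivative g t) (at t within J))"
    using N(1) rN sub contg der
    by (intro bexI[OF _ u_in_atlas] exI[of _ N] exI[of _ ?g] conjI ballI)
qed

text \<open>The representation enters here. It makes the velocity at parameter \<open>t\<close>
  depend only on the point of the orbit and on the velocity of \<gamma> there, whatever the interval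
  \<open>J\<close> and the starting parameter \<open>s\<close> are.\<close>

lemma lift_velocity:
  assumes \<gamma>: "base_path B J \<gamma>" and s: "s \<in> J" and p: "p \<in> fibre B (\<gamma> s)" and t: "t \<in> J"
    and i: "i \<in> M" "\<gamma> t \<in> UU i" "\<gamma> t \<in> fst (cc i)"
  shows "has_velocity (total_atlas B) J (\<lambda>t. I J \<gamma> s t p) t
    (C1_coords.hvec B (UU i) (ee i) (cc i) (GG i) (I J \<gamma> s t p)
      (vector_derivative (snd (cc i) \<circ> \<gamma>) (at t within J)))"
proof -
  interpret C1_coords B "UU i" "ee i" "cc i"
    by (rule coords[OF i(1)])
  interpret frame_transport B "UU i" "ee i" I J \<gamma>
    by unfold_locales (rule I_linear, rule \<gamma>)
  let ?\<delta> = "\<lambda>t. I J \<gamma> s t p"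
  let ?w = "vector_derivative (snd (cc i) \<circ> \<gamma>) (at t within J)"
  let ?C = "coeff_matrix (GG i) (\<gamma> t) ?w"
  have tS: "t \<in> S"
    using t i by simp
  have fib: "?\<delta> t \<in> fibre B (\<gamma> t)" if "t \<in> J" for t
    by (rule transport_in_fibre[OF I_transport \<gamma> s that p])
  have pu: "?\<delta> t \<in> fst u"
    using fibre_u[OF fib[OF t]] i by simp
  have "has_transport_coefficients B (ee i) I J \<gamma> t ?C"
    using repr[OF i(1)] \<gamma> t i(2,3) unfolding coefficients_representation_def coeff_matrix_def by blast
  then have "((\<lambda>t'. fc (I J \<gamma> t t' (?\<delta> t))) has_vector_derivative - (?C *v fc (?\<delta> t))) (at t within J)"
    unfolding has_transport_coefficients_iff[OF I tS] using fib[OF t] by blast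
  then have "((\<lambda>t'. fc (?\<delta> t')) has_vector_derivative - (?C *v fc (?\<delta> t))) (at t within J)"
  proof (rule has_vector_derivative_transform[OF t, rotated])
    show "fc (?\<delta> t') = fc (I J \<gamma> t t' (?\<delta> t))" if "t' \<in> J" for t'
      using transport_comp[OF I_transport \<gamma> s t p that] by simp
  qed
  moreover have "(snd (cc i) \<circ> \<gamma> has_vector_derivative ?w) (at t within J)"
  proof -
    obtain g where g: "continuous_on (J \<inter> \<gamma> -` fst (cc i)) g \<and>
        (\<forall>s\<in>J \<inter> \<gamma> -` fst (cc i). (snd (cc i) \<circ> \<gamma> has_vector_derivative g s) (at s within J))"
      using base.C1_path_chart[OF \<gamma> chart_c] by (elim exE)
    then have "(snd (cc i) \<circ> \<gamma> has_vector_derivative g t) (at t within J)"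
      using t i by blast
    then have "snd (cc i) \<circ> \<gamma> differentiable at t within J"
      using differentiableI_vector by blast
    then show ?thesis
      by (simp add: vector_derivative_works)
  qed
  ultimately have "((\<lambda>t'. join ((snd (cc i) \<circ> \<gamma>) t') (fc (?\<delta> t'))) has_vector_derivative
      join ?w (- (?C *v fc (?\<delta> t)))) (at t within J)"
    by (intro has_vector_derivative_join)
  then have "(snd u \<circ> ?\<delta> has_vector_derivative join ?w (- (?C *v fc (?\<delta> t)))) (at t within J)"
  proof (rule has_vector_derivative_transform[OF t, rotated])
    show "(snd u \<circ> ?\<delta>) t' = join ((snd (cc i) \<circ> \<gamma>) t') (fc (?\<delta> t'))" if "t' \<in> J" for t'
      using fib[OF that] by (simp add: snd_u fibre_iff)
  qed
  then have "(snd u \<circ> ?\<delta> has_vector_derivative hvec (GG i) (?\<delta> t) ?w u) (at t within J)"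
    using fib[OF t] by (simp add: hvec_u[OF pu] fibre_iff)
  then show ?thesis
    by (rule total.has_velocity_chartI[where s = t, OF u_in_atlas pu lift_C1[OF \<gamma> s p] t hvec_tangent[OF pu]])
qed

lemma velocity_unique:
  assumes "p \<in> total_space B" "0 < \<epsilon>" "\<delta> 0 = p"
    and "has_velocity (total_atlas B) {0..\<epsilon>} \<delta> 0 v" "has_velocity (total_atlas B) {0..\<epsilon>} \<delta> 0 w"
  shows "v = w"
proof -
  obtain c where c: "c \<in> total_atlas B" "p \<in> fst c"
    using total.chart_covers[OF assms(1)] .
  have nb: "at 0 within {0..\<epsilon>} \<noteq> bot"
    using assms(2) by (intro at_within_interval_neq_bot is_interval_cc) (auto simp: subset_singleton_iff)
  have "(snd c \<circ> \<delta> has_vector_derivative v c) (at 0 within {0..\<epsilon>})"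
    "(snd c \<circ> \<delta> has_vector_derivative w c) (at 0 within {0..\<epsilon>})"
    using assms(3-5) c unfolding has_velocity_def by blast+
  from vector_derivative_unique_within[OF nb this] have "v c = w c" .
  moreover have "v \<in> tangent_space (total_atlas B) p" "w \<in> tangent_space (total_atlas B) p"
    using assms(3-5) unfolding has_velocity_def by blast+
  ultimately show ?thesis
    by (intro total.tangent_eqI[OF c])
qed

text \<open>Every vector \<open>hvec (GG i) p w\<close> is realized by transporting \<open>p\<close> along a coordinate line, so
  that the span of these vectors does not depend on \<open>i\<close>.\<close>

lemma transport_horizontal_eq:
  assumes i: "i \<in> M" and p: "p \<in> fst (vb_coordinates B (UU i) (ee i) (cc i))"
  shows "transport_horizontal B I p = range (C1_coords.hvec B (UU i) (ee i) (cc i) (GG i) p)"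
proof -
  interpret C1_coords B "UU i" "ee i" "cc i"
    by (rule coords[OF i])
  let ?c = "cc i"
  have pp: "p \<in> total_space B" "proj B p \<in> UU i" "proj B p \<in> fst ?c"
    using p by (simp_all add: fst_u)
  have vel: "has_velocity (total_atlas B) {0..\<epsilon>} (\<lambda>t. I {0..\<epsilon>} \<gamma> 0 t p) 0
      (hvec (GG i) p (vector_derivative (snd ?c \<circ> \<gamma>) (at 0 within {0..\<epsilon>})))"
    and refl: "I {0..\<epsilon>} \<gamma> 0 0 p = p"
    if "0 < \<epsilon>" "base_path B {0..\<epsilon>} \<gamma>" "p \<in> fibre B (\<gamma> 0)" for \<epsilon> \<gamma>
  proof -
    have 0: "0 \<in> {0..\<epsilon>}"
      using that(1) by simp
    have g: "\<gamma> 0 \<in> UU i" "\<gamma> 0 \<in> fst ?c"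
      using that(3) pp by (simp_all add: fibre_iff)
    show r: "I {0..\<epsilon>} \<gamma> 0 0 p = p"
      by (rule transport_refl[OF I_transport that(2) 0 0 that(3)])
    show "has_velocity (total_atlas B) {0..\<epsilon>} (\<lambda>t. I {0..\<epsilon>} \<gamma> 0 t p) 0
      (hvec (GG i) p (vector_derivative (snd ?c \<circ> \<gamma>) (at 0 within {0..\<epsilon>})))"
      using lift_velocity[OF that(2) 0 that(3) 0 i g] unfolding r .
  qed
  show ?thesis
  proof (intro set_eqI iffI)
    fix v assume "v \<in> transport_horizontal B I p"
    then obtain \<epsilon> \<gamma> where \<gamma>: "0 < \<epsilon>" "base_path B {0..\<epsilon>} \<gamma>" "p \<in> fibre B (\<gamma> 0)"
      "has_velocity (total_atlas B) {0..\<epsilon>} (\<lambda>t. I {0..\<epsilon>} \<gamma> 0 t p) 0 v"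
      unfolding transport_horizontal_def by blast
    have "v = hvec (GG i) p (vector_derivative (snd ?c \<circ> \<gamma>) (at 0 within {0..\<epsilon>}))"
      by (rule velocity_unique[OF pp(1) \<gamma>(1) refl[OF \<gamma>(1-3)] \<gamma>(4) vel[OF \<gamma>(1-3)]])
    then show "v \<in> range (hvec (GG i) p)"
      by (rule range_eqI)
  next
    fix v assume "v \<in> range (hvec (GG i) p)"
    then obtain w where w: "v = hvec (GG i) p w"
      by blast
    let ?y = "snd ?c (proj B p)"
    have op: "open (snd ?c ` fst ?c)"
      using base.is_chart[OF chart_c] unfolding is_chart_def by (elim conjE)
    have "open ((\<lambda>t::real. ?y + t *\<^sub>R w) -` (snd ?c ` fst ?c))"
      by (rule open_vimage[OF op]) (intro continuous_intros)
    moreover have "0 \<in> (\<lambda>t::real. ?y + t *\<^sub>R w) -` (snd ?c ` fst ?c)"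
      using pp(3) by simp
    ultimately obtain d where d: "d > 0" "ball 0 d \<subseteq> (\<lambda>t::real. ?y + t *\<^sub>R w) -` (snd ?c ` fst ?c)"
      using openE by blast
    \<comment> \<open>Half the radius, because the closed interval has to fit into the open
      ball.\<close>
    define \<epsilon> where "\<epsilon> = d / 2"
    have \<epsilon>: "\<epsilon> > 0" "\<epsilon> < d"
      using d(1) by (simp_all add: \<epsilon>_def)
    have im: "?y + t *\<^sub>R w \<in> snd ?c ` fst ?c" if "t \<in> {0..\<epsilon>}" for t
    proof -
      have "t \<in> ball 0 d"
        using that \<epsilon> by simp
      then show ?thesis
        using d(2) by blast
    qed
    let ?\<gamma> = "\<lambda>t. chart_inv ?c (?y + t *\<^sub>R w)"
    note line = base.C1_path_line[OF chart_c is_interval_cc im]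
    have "?\<gamma> 0 = proj B p"
      using base.chart_inv(1)[OF chart_c pp(3)] by simp
    then have fib: "p \<in> fibre B (?\<gamma> 0)"
      using pp(1) by (simp add: fibre_iff)
    have 0: "0 \<in> {0..\<epsilon>}"
      using \<epsilon> by simp
    have nb: "at 0 within {0..\<epsilon>} \<noteq> bot"
      using \<epsilon> by (intro at_within_interval_neq_bot is_interval_cc) (auto simp: subset_singleton_iff)
    have "vector_derivative (snd ?c \<circ> ?\<gamma>) (at 0 within {0..\<epsilon>}) = w"
      by (rule vector_derivative_within[OF nb line(2)[OF _ 0]])
    then have "has_velocity (total_atlas B) {0..\<epsilon>} (\<lambda>t. I {0..\<epsilon>} ?\<gamma> 0 t p) 0 v"
      using vel[OF \<epsilon>(1) line(1) fib] w by simp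
    then show "v \<in> transport_horizontal B I p"
      unfolding transport_horizontal_def mem_Collect_eq using \<epsilon>(1) line(1) fib
      by (intro exI[of _ \<epsilon>] exI[of _ ?\<gamma>] conjI)
  qed
qed

section \<open>The distribution generated by the transport\<close>

abbreviation H :: "('e, 'k, 'n + 'r) distribution" where "H \<equiv> transport_horizontal B I"

text \<open>\<open>?h\<close> is a linear right inverse of the map that takes a tangent vector to
  its base part, and the kernel of that map is the vertical space. Its range is thus a complement of
  the vertical space, of the dimension of the base.\<close>

lemma transport_horizontal_complement:
  assumes p: "p \<in> total_space B"
  shows "tvec.subspace (H p)" "tvec.dim (H p) = CARD('n)" "H p \<inter> vertical_space B p = {0}"
    "{v + h | v h. v \<in> vertical_space B p \<and> h \<in> H p} = tangent_space (total_atlas B) p"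
proof -
  obtain i where i: "i \<in> M" "proj B p \<in> UU i" "proj B p \<in> fst (cc i)"
    using cover_point[OF proj_base[OF p]] .
  interpret C1_coords B "UU i" "ee i" "cc i"
    by (rule coords[OF i(1)])
  have pu: "p \<in> fst u"
    using p i by (simp add: fst_u)
  let ?h = "hvec (GG i) p"
  have H: "H p = range ?h"
    by (rule transport_horizontal_eq[OF i(1) pu])
  have lft: "lft (?h w u) = w" for w
    by (simp add: hvec_u[OF pu])
  show sub: "tvec.subspace (H p)"
    unfolding H
  proof (rule tvec.subspaceI)
    show "0 \<in> range ?h"
      using rangeI[of ?h 0] unfolding hvec_0[OF pu] .
    show "v + w \<in> range ?h" if vw: "v \<in> range ?h" "w \<in> range ?h" for v w
    proof -
      obtain v' w' where "v = ?h v'" "w = ?h w'"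
        using vw by blast
      then show ?thesis
        by (intro range_eqI[of _ _ "v' + w'"]) (simp only: hvec_add[OF pu])
    qed
    show "tscale k v \<in> range ?h" if v: "v \<in> range ?h" for k v
    proof -
      obtain v' where "v = ?h v'"
        using v by blast
      then show ?thesis
        by (intro range_eqI[of _ _ "k *s v'"]) (simp only: hvec_scale[OF pu])
    qed
  qed
  \<comment> \<open>The dimension is carried over from \<open>'k ^ 'n\<close> along
    \<open>?h\<close>, which is injective because the base part recovers its argument.\<close>
  interpret pair: finite_dimensional_vector_space_pair_1 "(*s)" "cart_basis :: ('k ^ 'n) set"
    "tscale :: 'k \<Rightarrow> ('e, 'k, 'n + 'r) tvec \<Rightarrow> _"
    by unfold_locales
  have "Vector_Spaces.linear (*s) tscale ?h"
    by unfold_locales (simp_all only: hvec_add[OF pu] hvec_scale[OF pu])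
  moreover have "inj ?h"
    by (rule inj_on_inverseI[of _ "\<lambda>v. lft (v u)"]) (rule lft)
  ultimately have "tvec.dim (range ?h) = vec.dim (UNIV :: ('k ^ 'n) set)"
    using inj_on_subset by (intro pair.dim_image_eq) blast+
  then show "tvec.dim (H p) = CARD('n)"
    unfolding H vec_dim_card .
  have tan: "H p \<subseteq> tangent_space (total_atlas B) p"
    unfolding H using hvec_tangent[OF pu] by blast
  note T = total.subspace_tangent_space[OF p]
  show "H p \<inter> vertical_space B p = {0}"
  proof (intro equalityI subsetI)
    fix v assume v: "v \<in> H p \<inter> vertical_space B p"
    then obtain w where w: "v = ?h w"
      unfolding H by blast
    have "lft (v u) = 0"
      using v unfolding vertical_space_eq[OF pu] by blast
    then have "w = 0"
      unfolding w lft .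
    then show "v \<in> {0}"
      unfolding w using hvec_0[OF pu] by blast
  next
    fix v :: "('e, 'k, 'n + 'r) tvec" assume "v \<in> {0}"
    then have v: "v = 0"
      by blast
    show "v \<in> H p \<inter> vertical_space B p"
      unfolding v vertical_space_eq[OF pu]
      using tvec.subspace_0[OF sub] tvec.subspace_0[OF T] by simp
  qed
  show "{v + h | v h. v \<in> vertical_space B p \<and> h \<in> H p} = tangent_space (total_atlas B) p"
  proof (intro equalityI subsetI)
    fix x assume "x \<in> {v + h | v h. v \<in> vertical_space B p \<and> h \<in> H p}"
    then obtain v h where "x = v + h" "v \<in> vertical_space B p" "h \<in> H p"
      by blast
    then show "x \<in> tangent_space (total_atlas B) p"
      unfolding vertical_space_eq[OF pu] using tan by (auto intro: tvec.subspace_add[OF T])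
  next
    fix x assume x: "x \<in> tangent_space (total_atlas B) p"
    let ?k = "?h (lft (x u))"
    have "x - ?k \<in> vertical_space B p"
      unfolding vertical_space_eq[OF pu]
      using tvec.subspace_diff[OF T x hvec_tangent[OF pu]] by (simp add: lft)
    moreover have "?k \<in> H p"
      unfolding H by blast
    ultimately show "x \<in> {v + h | v h. v \<in> vertical_space B p \<and> h \<in> H p}"
      by (intro CollectI exI[of _ "x - ?k"] exI[of _ ?k] conjI diff_add_cancel[symmetric])
  qed
qed

text \<open>\<open>H\<close> is built from transports along paths on \<open>{0..\<epsilon>}\<close>,
  which are unrelated a priori to the transport on \<open>J\<close>. The orbit is horizontal all the
  same, since its velocity is again a value of \<open>hvec\<close>, and these values fill
  \<open>H\<close>.\<close>

lemma lift_horizontal: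
  assumes \<gamma>: "base_path B J \<gamma>" and s: "s \<in> J" and p: "p \<in> fibre B (\<gamma> s)"
  shows "horizontal_lift B H J \<gamma> (\<lambda>t. I J \<gamma> s t p)"
  unfolding horizontal_lift_def
proof (intro conjI ballI)
  show "C1_path (total_space B) (total_atlas B) J (\<lambda>t. I J \<gamma> s t p)"
    by (rule lift_C1[OF assms])
  fix t assume t: "t \<in> J"
  have fib: "I J \<gamma> s t p \<in> fibre B (\<gamma> t)"
    by (rule transport_in_fibre[OF I_transport \<gamma> s t p])
  then show "proj B (I J \<gamma> s t p) = \<gamma> t"
    by (simp add: fibre_iff)
  obtain i where i: "i \<in> M" "\<gamma> t \<in> UU i" "\<gamma> t \<in> fst (cc i)"
    using cover_point[OF base_path_in[OF \<gamma> t]] .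
  interpret C1_coords B "UU i" "ee i" "cc i"
    by (rule coords[OF i(1)])
  have pu: "I J \<gamma> s t p \<in> fst u"
    using fibre_u[OF fib] i by simp
  show "\<exists>v\<in>H (I J \<gamma> s t p). has_velocity (total_atlas B) J (\<lambda>t. I J \<gamma> s t p) t v"
    unfolding transport_horizontal_eq[OF i(1) pu]
    using lift_velocity[OF \<gamma> s p t i] by blast
qed

text \<open>Uniqueness of horizontal lifts: transporting a horizontal lift back to a fixed fibre
  gives a locally constant function.\<close>

lemma horizontal_lift_locally_transported:
  assumes \<gamma>: "base_path B J \<gamma>" and \<delta>: "horizontal_lift B H J \<gamma> \<delta>" and r: "r \<in> J"
    and J: "\<not> J \<subseteq> {r}"
  shows "\<exists>d>0. \<forall>t\<in>J \<inter> ball r d. I J \<gamma> t r (\<delta> t) = \<delta> r"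
proof -
  obtain i where i: "i \<in> M" "\<gamma> r \<in> UU i" "\<gamma> r \<in> fst (cc i)"
    using cover_point[OF base_path_in[OF \<gamma> r]] .
  interpret C1_coords B "UU i" "ee i" "cc i"
    by (rule coords[OF i(1)])
  interpret frame_transport B "UU i" "ee i" I J \<gamma>
    by unfold_locales (rule I_linear, rule \<gamma>)
  have int: "is_interval J"
    using \<gamma> unfolding C1_path_def by (elim conjE)
  have proj: "proj B (\<delta> t) = \<gamma> t" if "t \<in> J" for t
    using horizontal_lift_fibre[OF \<delta> that] by (simp add: fibre_iff)
  have op: "openin (top_of_set (base_space B)) (UU i \<inter> fst (cc i))"
    by (intro openin_Int openin_frame base.chart_domain chart_c)
  obtain N where N: "open N" "J \<inter> \<gamma> -` (UU i \<inter> fst (cc i)) = J \<inter> N"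
    using base.C1_path_preimage[OF \<gamma> op] .
  have "r \<in> N"
    using N(2) r i by blast
  then obtain d where d: "d > 0" "ball r d \<subseteq> N"
    using openE[OF N(1)] by blast
  \<comment> \<open>A ball makes this set convex, so that a zero derivative implies
    constancy.\<close>
  let ?T = "J \<inter> ball r d"
  have T: "t \<in> S" "\<gamma> t \<in> fst (cc i)" if "t \<in> ?T" for t
  proof -
    have "t \<in> J \<inter> N"
      using that d(2) by blast
    then have "t \<in> J \<inter> \<gamma> -` (UU i \<inter> fst (cc i))"
      unfolding N(2) .
    then show "t \<in> S" "\<gamma> t \<in> fst (cc i)"
      by blast+
  qed
  have rT: "r \<in> ?T"
    using r d(1) by simp
  have rS: "r \<in> S"
    by (rule T(1)[OF rT])
  \<comment> \<open>The coefficients give the derivative of the matrix in its second argument only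
    at coinciding parameters. Writing \<open>L r t' = L r t ** L t t'\<close> with \<open>t\<close>
    fixed moves the question there: as \<open>L t t\<close> is the identity, the product rule yields
    \<open>?C\<close> applied to the components of \<delta>, minus the same vector.\<close>
  have der: "((\<lambda>t'. L r t' *v fc (\<delta> t')) has_derivative (\<lambda>h. 0)) (at t within ?T)" if t: "t \<in> ?T" for t
  proof -
    have tJ: "t \<in> J" and tS: "t \<in> S"
      using t T by blast+
    have "\<not> J \<subseteq> {t}"
      using J r by blast
    then have nb: "at t within J \<noteq> bot"
      by (rule at_within_interval_neq_bot[OF int tJ])
    have pu: "\<delta> t \<in> fst u"
      using fibre_u[OF horizontal_lift_fibre[OF \<delta> tJ]] tS T(2)[OF t] by simp
    obtain v where v: "v \<in> H (\<delta> t)" "has_velocity (total_atlas B) J \<delta> t v"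
      using \<delta> tJ unfolding horizontal_lift_def by blast
    obtain w where w: "v = hvec (GG i) (\<delta> t) w"
      using v(1) unfolding transport_horizontal_eq[OF i(1) pu] by blast
    let ?C = "coeff_matrix (GG i) (\<gamma> t) w"
    have dv: "(snd u \<circ> \<delta> has_vector_derivative v u) (at t within J)"
      using v(2) u_in_atlas pu unfolding has_velocity_def by blast
    have vu: "v u = join w (- (?C *v fc (\<delta> t)))"
      unfolding w hvec_u[OF pu] proj[OF tJ] ..
    have y: "((\<lambda>t. fc (\<delta> t)) has_vector_derivative - (?C *v fc (\<delta> t))) (at t within J)"
      using u_derivative(1)[OF dv] unfolding vu by simp
    \<comment> \<open>Being horizontal gave only some base vector \<open>w\<close>; projecting the
      lift identifies it with the velocity of \<gamma>, at which the representation can be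
      used.\<close>
    have "(snd (cc i) \<circ> \<gamma> has_vector_derivative w) (at t within J)"
      using u_derivative(2)[OF dv tJ proj] unfolding vu by simp
    then have "vector_derivative (snd (cc i) \<circ> \<gamma>) (at t within J) = w"
      by (rule vector_derivative_within[OF nb])
    then have "has_transport_coefficients B (ee i) I J \<gamma> t ?C"
      using repr[OF i(1)] \<gamma> tJ tS T(2)[OF t]
      unfolding coefficients_representation_def coeff_matrix_def by blast
    then have "((\<lambda>t'. L t t') has_vector_derivative ?C) (at t within J)"
      unfolding has_transport_coefficients_def .
    from has_vector_derivative_matrix_vector_mult[OF this y]
    have "((\<lambda>t'. L t t' *v fc (\<delta> t')) has_vector_derivative 0) (at t within J)"
      by (simp add: L_refl[OF tS])
    from bounded_linear.has_vector_derivative[OF bounded_bilinear.bounded_linear_right[OF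
          bounded_bilinear_matrix_vector_mult] this, of "L r t"]
    have "((\<lambda>t'. L r t *v (L t t' *v fc (\<delta> t'))) has_vector_derivative 0) (at t within J)"
      by simp
    then have "((\<lambda>t'. L r t *v (L t t' *v fc (\<delta> t'))) has_vector_derivative 0) (at t within ?T)"
      by (rule has_vector_derivative_within_subset) simp
    then have "((\<lambda>t'. L r t' *v fc (\<delta> t')) has_vector_derivative 0) (at t within ?T)"
    proof (rule has_vector_derivative_transform[OF t, rotated])
      show "L r t' *v fc (\<delta> t') = L r t *v (L t t' *v fc (\<delta> t'))" if "t' \<in> ?T" for t'
        unfolding matrix_vector_mul_assoc L_comp[OF T(1)[OF that] tS rS] ..
    qed
    then show ?thesis
      unfolding has_vector_derivative_def by simp
  qed
  have "convex ?T"
    using int by (intro convex_Int is_interval_convex convex_ball)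
  from has_derivative_zero_constant[OF this, of "\<lambda>t. L r t *v fc (\<delta> t)"] der
  have "\<exists>k. \<forall>t\<in>?T. L r t *v fc (\<delta> t) = k"
    by simp
  then obtain k where k: "\<forall>t\<in>?T. L r t *v fc (\<delta> t) = k"
    by (elim exE)
  have "I J \<gamma> t r (\<delta> t) = \<delta> r" if t: "t \<in> ?T" for t
  proof (rule frame_components_inj)
    have tJ: "t \<in> J"
      using t by blast
    show "\<gamma> r \<in> UU i"
      by (rule i(2))
    show "I J \<gamma> t r (\<delta> t) \<in> fibre B (\<gamma> r)"
      by (rule transport_in_fibre[OF I_transport \<gamma> tJ r horizontal_lift_fibre[OF \<delta> tJ]])
    show "\<delta> r \<in> fibre B (\<gamma> r)"
      by (rule horizontal_lift_fibre[OF \<delta> r])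
    have "fc (I J \<gamma> t r (\<delta> t)) = L r t *v fc (\<delta> t)"
      by (rule L_apply[OF T(1)[OF t] rS horizontal_lift_fibre[OF \<delta> tJ]])
    also have "\<dots> = L r r *v fc (\<delta> r)"
      using k t rT by simp
    also have "\<dots> = fc (\<delta> r)"
      unfolding L_refl[OF rS] by simp
    finally show "fc (I J \<gamma> t r (\<delta> t)) = fc (\<delta> r)" .
  qed
  with d(1) show ?thesis
    by blast
qed

lemma horizontal_lift_unique:
  assumes \<gamma>: "base_path B J \<gamma>" and \<delta>: "horizontal_lift B H J \<gamma> \<delta>" and s: "s \<in> J" and t: "t \<in> J"
  shows "\<delta> t = I J \<gamma> s t (\<delta> s)"
proof (cases "J \<subseteq> {s}")
  case True
  then have "t = s"
    using t by blast
  then show ?thesis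
    using transport_refl[OF I_transport \<gamma> s s horizontal_lift_fibre[OF \<delta> s]] by simp
next
  case False
  note fib = horizontal_lift_fibre[OF \<delta>]
  have int: "is_interval J"
    using \<gamma> unfolding C1_path_def by (elim conjE)
  have "I J \<gamma> t s (\<delta> t) = I J \<gamma> s s (\<delta> s)"
  \<comment> \<open>Transport from a parameter near \<open>r\<close> to \<open>s\<close> factors
    through \<open>r\<close>, so local constancy of the function transported to \<open>r\<close>
    carries over to the fixed fibre at \<open>s\<close>.\<close>
  proof (rule connected_local_const[where f = "\<lambda>t. I J \<gamma> t s (\<delta> t)", OF _ t s], goal_cases)
    case 1
    show ?case
      using int by (simp add: is_interval_connected)
  next
    case 2
    show ?case
    proof
      fix r assume r: "r \<in> J"
      have "\<not> J \<subseteq> {r}"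
        using False s by blast
      then obtain d where d: "d > 0" "\<forall>t\<in>J \<inter> ball r d. I J \<gamma> t r (\<delta> t) = \<delta> r"
        using horizontal_lift_locally_transported[OF \<gamma> \<delta> r] by blast
      have "I J \<gamma> r s (\<delta> r) = I J \<gamma> t' s (\<delta> t')" if t': "t' \<in> J" "dist t' r < d" for t'
      proof -
        have "I J \<gamma> t' r (\<delta> t') = \<delta> r"
          using d(2) t' by (simp add: dist_commute)
        then show ?thesis
          using transport_comp[OF I_transport \<gamma> t'(1) r fib[OF t'(1)] s] by simp
      qed
      then show "\<forall>\<^sub>F t' in at r within J. I J \<gamma> r s (\<delta> r) = I J \<gamma> t' s (\<delta> t')"
        unfolding eventually_at using d(1) by blast
    qed
  qed
  also have "\<dots> = \<delta> s"
    by (rule transport_refl[OF I_transport \<gamma> s s fib[OF s]])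
  finally have "I J \<gamma> s t (\<delta> s) = I J \<gamma> s t (I J \<gamma> t s (\<delta> t))"
    by simp
  also have "\<dots> = \<delta> t"
    using transport_comp[OF I_transport \<gamma> t s fib[OF t] t] transport_refl[OF I_transport \<gamma> t t fib[OF t]]
    by simp
  finally show ?thesis
    by simp
qed

section \<open>The generated connection, its parallel transport and its uniqueness\<close>

lemma transport_connection: "connection B H"
  unfolding connection_def
proof (intro conjI ballI allI impI)
  fix p assume "p \<in> total_space B"
  note c = transport_horizontal_complement[OF this]
  show "tvec.subspace (H p)" "tvec.dim (H p) = CARD('n)" "H p \<inter> vertical_space B p = {0}"
    "{v + h | v h. v \<in> vertical_space B p \<and> h \<in> H p} = tangent_space (total_atlas B) p"
    by (rule c)+
next
  fix J \<gamma> s p assume \<gamma>: "base_path B J \<gamma>" and s: "s \<in> J" and p: "p \<in> fibre B (\<gamma> s)"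
  have "I J \<gamma> s s p = p"
    by (rule transport_refl[OF I_transport \<gamma> s s p])
  moreover have "\<forall>t\<in>J. \<delta>' t = I J \<gamma> s t p" if "horizontal_lift B H J \<gamma> \<delta>' \<and> \<delta>' s = p" for \<delta>'
    using horizontal_lift_unique[OF \<gamma> _ s, of \<delta>'] that by blast
  ultimately show "\<exists>\<delta>. horizontal_lift B H J \<gamma> \<delta> \<and> \<delta> s = p \<and>
      (\<forall>\<delta>'. horizontal_lift B H J \<gamma> \<delta>' \<and> \<delta>' s = p \<longrightarrow> (\<forall>t\<in>J. \<delta>' t = \<delta> t))"
    using lift_horizontal[OF \<gamma> s p] by (intro exI[of _ "\<lambda>t. I J \<gamma> s t p"] conjI allI impI)
qed

lemma parallel_transport_eq:
  assumes \<gamma>: "base_path B J \<gamma>" and s: "s \<in> J" and t: "t \<in> J" and p: "p \<in> fibre B (\<gamma> s)"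
  shows "parallel_transport_along B H J \<gamma> s t p = I J \<gamma> s t p"
  using parallel_transport_along_lift[OF transport_connection \<gamma> lift_horizontal[OF \<gamma> s p] s t]
  unfolding transport_refl[OF I_transport \<gamma> s s p] .

lemma transports_agree: "transports_agree B (parallel_transport_along B H) I"
  unfolding transports_agree_def using parallel_transport_eq by blast

text \<open>The parallel transport over \<open>{\<sigma>..\<tau>}\<close> is \<open>I\<close> along
  the path on this very interval, so it is linear with \<open>I\<close>.\<close>

lemma transport_linear_connection: "linear_connection B H"
  unfolding linear_connection_def
proof (intro conjI transport_connection allI impI)
  fix \<sigma> \<tau> \<gamma> assume "\<sigma> \<le> \<tau> \<and> base_path B {\<sigma>..\<tau>} \<gamma>"
  then have st: "\<sigma> \<le> \<tau>" "\<sigma> \<in> {\<sigma>..\<tau>}" "\<tau> \<in> {\<sigma>..\<tau>}" and \<gamma>: "base_path B {\<sigma>..\<tau>} \<gamma>"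
    by auto
  have lin: "fibre_linear B (\<gamma> \<sigma>) (\<gamma> \<tau>) (I {\<sigma>..\<tau>} \<gamma> \<sigma> \<tau>)"
    using I_linear \<gamma> st(2,3) unfolding linear_transport_def by blast
  have eq: "parallel_transport B H \<sigma> \<tau> \<gamma> p = I {\<sigma>..\<tau>} \<gamma> \<sigma> \<tau> p" if "p \<in> fibre B (\<gamma> \<sigma>)" for p
    using parallel_transport_eq[OF \<gamma> st(2,3) that] st(1) by (simp add: parallel_transport_along_def)
  note ops = fibre_ops[OF base_path_in[OF \<gamma> st(2)]]
  show "fibre_linear B (\<gamma> \<sigma>) (\<gamma> \<tau>) (parallel_transport B H \<sigma> \<tau> \<gamma>)"
    using lin unfolding fibre_linear_def by (simp add: eq ops image_subset_iff)
qed

lemma transport_three_index_coefficients: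
  assumes i: "i \<in> M"
  shows "three_index_coefficients B H (UU i) (ee i) (cc i) (GG i)"
proof -
  interpret C1_coords B "UU i" "ee i" "cc i"
    by (rule coords[OF i])
  show ?thesis
    unfolding three_index_coefficients_iff using transport_horizontal_eq[OF i] by blast
qed

text \<open>Orbits of \<open>I\<close> coincide with horizontal lifts of \<open>H'\<close>, so their
  initial velocities, that is the elements of \<open>H p\<close>, lie in \<open>H' p\<close>. Both
  spaces are complements of the vertical space, and of two complements one cannot properly contain
  the other.\<close>

lemma connection_unique:
  assumes H': "connection B H'" and agree: "transports_agree B (parallel_transport_along B H') I"
    and p: "p \<in> total_space B"
  shows "H' p = H p"
proof -
  have sub: "H p \<subseteq> H' p"
  proof
    fix v assume "v \<in> H p"
    then obtain \<epsilon> \<gamma> where \<gamma>: "0 < \<epsilon>" "base_path B {0..\<epsilon>} \<gamma>" "p \<in> fibre B (\<gamma> 0)"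
      and v: "has_velocity (total_atlas B) {0..\<epsilon>} (\<lambda>t. I {0..\<epsilon>} \<gamma> 0 t p) 0 v"
      unfolding transport_horizontal_def by blast
    have 0: "0 \<in> {0..\<epsilon>}"
      using \<gamma>(1) by simp
    obtain \<delta> where \<delta>: "horizontal_lift B H' {0..\<epsilon>} \<gamma> \<delta>" "\<delta> 0 = p"
      using connection_lift[OF H' \<gamma>(2) 0 \<gamma>(3)] .
    have eq: "I {0..\<epsilon>} \<gamma> 0 t p = \<delta> t" if t: "t \<in> {0..\<epsilon>}" for t
    proof -
      have "I {0..\<epsilon>} \<gamma> 0 t p = parallel_transport_along B H' {0..\<epsilon>} \<gamma> 0 t p"
        using agree \<gamma>(2,3) 0 t unfolding transports_agree_def by simp
      also have "\<dots> = \<delta> t"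
        using parallel_transport_along_lift[OF H' \<gamma>(2) \<delta>(1) 0 t] unfolding \<delta>(2) .
      finally show ?thesis .
    qed
    obtain v' where v': "v' \<in> H' p" "has_velocity (total_atlas B) {0..\<epsilon>} \<delta> 0 v'"
      using \<delta> 0 unfolding horizontal_lift_def by metis
    \<comment> \<open>The orbit and the lift \<delta> agree on \<open>{0..\<epsilon>}\<close> only,
      but derivatives within this interval see nothing else.\<close>
    have "has_velocity (total_atlas B) {0..\<epsilon>} \<delta> 0 v"
      unfolding has_velocity_def
    proof (intro conjI ballI impI)
      show "v \<in> tangent_space (total_atlas B) (\<delta> 0)"
        using v eq[OF 0] unfolding has_velocity_def by simp
      fix c assume c: "c \<in> total_atlas B" "\<delta> 0 \<in> fst c"
      then have "(snd c \<circ> (\<lambda>t. I {0..\<epsilon>} \<gamma> 0 t p) has_vector_derivative v c) (at 0 within {0..\<epsilon>})"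
        using v eq[OF 0] unfolding has_velocity_def by simp
      then show "(snd c \<circ> \<delta> has_vector_derivative v c) (at 0 within {0..\<epsilon>})"
        by (rule has_vector_derivative_transform[OF 0, rotated]) (simp add: eq)
    qed
    from velocity_unique[OF p \<gamma>(1) \<delta>(2) this v'(2)] v'(1) show "v \<in> H' p"
      by simp
  qed
  moreover have "H' p \<subseteq> H p"
  proof
    fix v assume v: "v \<in> H' p"
    then have "v \<in> {v + h | v h. v \<in> vertical_space B p \<and> h \<in> H p}"
      unfolding transport_horizontal_complement(4)[OF p] using connection_tangent[OF H' p] by blast
    then obtain w h where wh: "v = w + h" "w \<in> vertical_space B p" "h \<in> H p"
      by blast
    have "w = v - h"
      using wh(1) by simp
    also have "\<dots> \<in> H' p"
      using wh(3) sub by (intro tvec.subspace_diff[OF connection_subspace[OF H' p] v]) blast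
    finally have "w = 0"
      using wh(2) connection_Int[OF H' p] by blast
    with wh show "v \<in> H p"
      by simp
  qed
  ultimately show ?thesis
    by blast
qed

end

theorem theorem9p1:
  fixes B :: "('e::t2_space, 'm::t2_space, 'k::{real_normed_field,euclidean_space},
                'n::finite, 'r::finite) vbundle"
  assumes "vector_bundle B"
  shows
    "(\<forall>H. linear_connection B H \<longrightarrow>
        C1_linear_transport B (parallel_transport_along B H) \<and>
        (\<forall>U e c \<Gamma>.
           frame B U e \<and> c \<in> base_atlas B \<and> three_index_coefficients B H U e c \<Gamma> \<longrightarrow>
           coefficients_representation B U e c (parallel_transport_along B H) \<Gamma>))
     \<and>
     (\<forall>I. \<forall>N :: 'i set. \<forall>U e c \<Gamma>.
        C1_linear_transport B I \<and>
        (\<forall>i\<in>N. frame B (U i) (e i) \<and> c i \<in> base_atlas B \<and>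
                coefficients_representation B (U i) (e i) (c i) I (\<Gamma> i)) \<and>
        base_space B \<subseteq> (\<Union>i\<in>N. U i \<inter> fst (c i)) \<longrightarrow>
        (\<exists>H. linear_connection B H \<and>
             transports_agree B (parallel_transport_along B H) I \<and>
             (\<forall>H'. linear_connection B H' \<and>
                    transports_agree B (parallel_transport_along B H') I \<longrightarrow>
                    (\<forall>p\<in>total_space B. H' p = H p)) \<and>
             (\<forall>i\<in>N. three_index_coefficients B H (U i) (e i) (c i) (\<Gamma> i))))"
proof -
  interpret C1_vbundle B
    by unfold_locales (rule assms)
  show ?thesis
  proof (rule conjI; intro allI impI)
    fix H assume H: "linear_connection B H"
    show "C1_linear_transport B (parallel_transport_along B H) \<and>
        (\<forall>U e c \<Gamma>.
           frame B U e \<and> c \<in> base_atlas B \<and> three_index_coefficients B H U e c \<Gamma> \<longrightarrow>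
           coefficients_representation B U e c (parallel_transport_along B H) \<Gamma>)"
    proof (intro conjI allI impI)
      show "C1_linear_transport B (parallel_transport_along B H)"
        by (rule parallel_transport_C1[OF H])
      fix U e c \<Gamma>
      assume *: "frame B U e \<and> c \<in> base_atlas B \<and> three_index_coefficients B H U e c \<Gamma>"
      interpret C1_coords B U e c
        by unfold_locales (use * in blast)+
      show "coefficients_representation B U e c (parallel_transport_along B H) \<Gamma>"
        using * by (intro parallel_transport_coefficients[OF H]) blast
    qed
  next
    fix I and N :: "'i set" and U e c \<Gamma>
    assume *: "C1_linear_transport B I \<and>
        (\<forall>i\<in>N. frame B (U i) (e i) \<and> c i \<in> base_atlas B \<and>
                coefficients_representation B (U i) (e i) (c i) I (\<Gamma> i)) \<and>
        base_space B \<subseteq> (\<Union>i\<in>N. U i \<inter> fst (c i))"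
    interpret transport_cover B I N U e c \<Gamma>
    proof (intro transport_cover.intro transport_cover_axioms.intro C1_vbundle_axioms)
      show "C1_linear_transport B I" "base_space B \<subseteq> (\<Union>i\<in>N. U i \<inter> fst (c i))"
        using * by blast+
      fix i assume i: "i \<in> N"
      show "coefficients_representation B (U i) (e i) (c i) I (\<Gamma> i)"
        using * i by blast
      show "C1_coords B (U i) (e i) (c i)"
        by unfold_locales (use * i in blast)+
    qed
    show "\<exists>H. linear_connection B H \<and>
             transports_agree B (parallel_transport_along B H) I \<and>
             (\<forall>H'. linear_connection B H' \<and>
                    transports_agree B (parallel_transport_along B H') I \<longrightarrow>
                    (\<forall>p\<in>total_space B. H' p = H p)) \<and>
             (\<forall>i\<in>N. three_index_coefficients B H (U i) (e i) (c i) (\<Gamma> i))"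
    proof (intro exI[of _ H] conjI allI impI ballI)
      show "linear_connection B H"
        by (rule transport_linear_connection)
      show "transports_agree B (parallel_transport_along B H) I"
        by (rule transports_agree)
      show "H' p = H p" if "linear_connection B H' \<and> transports_agree B (parallel_transport_along B H') I"
        "p \<in> total_space B" for H' p
        using that unfolding linear_connection_def by (intro connection_unique) blast+
      show "three_index_coefficients B H (U i) (e i) (c i) (\<Gamma> i)" if "i \<in> N" for i
        by (rule transport_three_index_coefficients[OF that])
    qed
  qed
qed

end
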